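(* Let $m,q_1,q_2\ge 2$ be integers, let $L=K_{q_1,q_2}$ be the complete bipartite graph, let $G_1$ be any group of order $q_1$ and $G_2$ any group of order $q_2$. Let $H=\pi_1(X_{2m,L})$ and $\Gamma=\Gamma_{2m}(G_1,G_2)$ be the groups defined in the context. Then $H$ is (isomorphic to) a subgroup of $\Gamma$ of index $q_1q_2$. Moreover, this subgroup is a maximal torsion-free subgroup of $\Gamma$ with minimal index; that is, it is torsion-free, it is not properly contained in any torsion-free subgroup of $\Gamma$, and every torsion-free finite-index subgroup of $\Gamma$ has index at least $q_1q_2$.
   Context: The complex $X=X_{2m,L}$. Let $L=K_{q_1,q_2}$ have vertex set $\{x_1,\dots,x_{q_1}\}\sqcup\{y_1,\dots,y_{q_2}\}$, with an edge $(x_i,y_j)$ for every $i,j$. For each edge $(x_i,y_j)$ of $L$ take a $2m$-gon $P_{ij}$, orient its boundary edges cyclically, and label them in cyclic order by the word $x_i^1y_j^1x_i^2y_j^2\cdots x_i^my_j^m$ (the superscripts are indices, not powers, so the $2m$ labels are pairwise distinct). $X$ is the 2-dimensional cell complex obtained by gluing all the polygons $P_{ij}$ together along edges with the same label, respecting orientation. $H=\pi_1(X)$ is its topological fundamental group. The group $\Gamma=\Gamma_{2m}(G_1,G_2)$. It is the group with presentation $$\Gamma=\langle G_{1,1},\dots,G_{1,m},G_{2,1},\dots,G_{2,m}\mid [G_{1,k},G_{2,k}]=[G_{2,k},G_{1,k+1}]=1,\ k\in\mathbb{Z}/m\mathbb{Z}\rangle,$$ where each $G_{i,k}$ is a copy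 of $G_i$ and the relations internal to each $G_{i,k}$ are implicitly included. Equivalently, $\Gamma$ is the graph product over a $2m$-cycle with the groups $G_1$ and $G_2$ placed alternately on the vertices. (It is a cocompact lattice in the automorphism group of the Bourdon building, the unique simply connected polygonal complex whose faces are regular right-angled $2m$-gons and whose vertex links are all $K_{q_1,q_2}$.) *)

theory Defs
  imports "HOL-Analysis.Analysis" "HOL-Algebra.Algebra"
begin

section \<open>Fundamental groups of abstract topological spaces\<close>

definition quotient_topology :: "'a topology \<Rightarrow> ('a \<Rightarrow> 'b) \<Rightarrow> 'b topology" where
  "quotient_topology T f =
     topology (\<lambda>U. U \<subseteq> f ` topspace T \<and> openin T {x \<in> topspace T. f x \<in> U})"

lemma openin_quotient_topology:
  "openin (quotient_topology T f) U \<longleftrightarrow>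
     U \<subseteq> f ` topspace T \<and> openin T {x \<in> topspace T. f x \<in> U}"
proof -
  have 1: "{x \<in> topspace T. f x \<in> S \<inter> S'} =
      {x \<in> topspace T. f x \<in> S} \<inter> {x \<in> topspace T. f x \<in> S'}" for S S'
    by auto
  have 2: "{x \<in> topspace T. f x \<in> \<Union> \<K>} = (\<Union>S\<in>\<K>. {x \<in> topspace T. f x \<in> S})" for \<K>
    by auto
  have "istopology (\<lambda>U. U \<subseteq> f ` topspace T \<and> openin T {x \<in> topspace T. f x \<in> U})"
    unfolding istopology_def by (auto simp only: 1 2 intro!: openin_Int openin_Union)
  then show ?thesis
    unfolding quotient_topology_def by (simp only: topology_inverse')
qed

lemma topspace_quotient_topology: "topspace (quotient_topology T f) = f ` topspace T"
proof (rule subset_antisym)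
  show "topspace (quotient_topology T f) \<subseteq> f ` topspace T"
    using openin_topspace[of "quotient_topology T f"] unfolding openin_quotient_topology
    by (rule conjunct1)
  have "{x \<in> topspace T. f x \<in> f ` topspace T} = topspace T"
    by auto
  then have "openin (quotient_topology T f) (f ` topspace T)"
    by (simp add: openin_quotient_topology)
  then show "f ` topspace T \<subseteq> topspace (quotient_topology T f)"
    by (rule openin_subset)
qed

lemma quotient_map_quotient_topology: "quotient_map T (quotient_topology T f) f"
  unfolding quotient_map_def by (simp add: topspace_quotient_topology openin_quotient_topology)

definition loops :: "'a topology \<Rightarrow> 'a \<Rightarrow> (real \<Rightarrow> 'a) set" where
  "loops T a = {g. pathin T g \<and> g 0 = a \<and> g 1 = a}"

definition loop_homotopic ::
    "'a topology \<Rightarrow> 'a \<Rightarrow> (real \<Rightarrow> 'a) \<Rightarrow> (real \<Rightarrow> 'a) \<Rightarrow> bool" where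
  "loop_homotopic T a = homotopic_with (\<lambda>r. r 0 = a \<and> r 1 = a) (top_of_set {0..1}) T"

definition loop_class :: "'a topology \<Rightarrow> 'a \<Rightarrow> (real \<Rightarrow> 'a) \<Rightarrow> (real \<Rightarrow> 'a) set" where
  "loop_class T a g = {h. loop_homotopic T a g h}"

text \<open>The library's \<open>joinpaths\<close> needs the point type to be of class \<open>topological_space\<close>.\<close>

definition join_loops :: "(real \<Rightarrow> 'a) \<Rightarrow> (real \<Rightarrow> 'a) \<Rightarrow> real \<Rightarrow> 'a" where
  "join_loops g h = (\<lambda>t. if t \<le> 1 / 2 then g (2 * t) else h (2 * t - 1))"

definition fundamental_group :: "'a topology \<Rightarrow> 'a \<Rightarrow> (real \<Rightarrow> 'a) set monoid" where
  "fundamental_group T a =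
     \<lparr>carrier = loop_class T a ` loops T a,
      monoid.mult = (\<lambda>A B. \<Union>g\<in>A. \<Union>h\<in>B. loop_class T a (join_loops g h)),
      one = loop_class T a (\<lambda>_. a)\<rparr>"

section \<open>Group presentations\<close>

text \<open>The letter \<open>(s, True)\<close> stands for the generator \<open>s\<close> and \<open>(s, False)\<close> for its inverse.
  Words are identified when they differ by insertions and deletions of the
  words \<open>s s\<inverse>\<close>, \<open>s\<inverse> s\<close> and of the relators.\<close>

type_synonym 'a word = "('a \<times> bool) list"

definition words :: "'a set \<Rightarrow> 'a word set" where
  "words S = lists (S \<times> UNIV)"

inductive word_step :: "'a set \<Rightarrow> 'a word set \<Rightarrow> 'a word \<Rightarrow> 'a word \<Rightarrow> bool"
  for S :: "'a set" and R :: "'a word set" where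
  cancel: "\<lbrakk>u \<in> words S; v \<in> words S; s \<in> S\<rbrakk>
      \<Longrightarrow> word_step S R (u @ [(s, b), (s, \<not> b)] @ v) (u @ v)"
| relator: "\<lbrakk>u \<in> words S; v \<in> words S; r \<in> R\<rbrakk> \<Longrightarrow> word_step S R (u @ r @ v) (u @ v)"

definition word_class :: "'a set \<Rightarrow> 'a word set \<Rightarrow> 'a word \<Rightarrow> 'a word set" where
  "word_class S R u = {v. equivclp (word_step S R) u v}"

text \<open>The group \<open>\<langle>S | R\<rangle>\<close>, for a set of relators \<open>R \<subseteq> words S\<close>.\<close>

definition presented_group :: "'a set \<Rightarrow> 'a word set \<Rightarrow> 'a word set monoid" where
  "presented_group S R =
     \<lparr>carrier = word_class S R ` words S,
      monoid.mult = (\<lambda>A B. \<Union>u\<in>A. \<Union>v\<in>B. word_class S R (u @ v)),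
      one = word_class S R []\<rparr>"

section \<open>The polygonal complex\<close>

text \<open>The regular polygon inscribed in the unit circle with vertices the \<open>n\<close>-th roots of unity;
  its side number \<open>e < n\<close> runs counterclockwise from \<open>vertex n e\<close> to \<open>vertex n (e + 1)\<close>.\<close>

definition vertex :: "nat \<Rightarrow> nat \<Rightarrow> complex" where
  "vertex n e = cis (2 * pi * real e / real n)"

definition polygon :: "nat \<Rightarrow> complex set" where
  "polygon n = convex hull (vertex n ` {..<n})"

definition side_point :: "nat \<Rightarrow> nat \<Rightarrow> real \<Rightarrow> complex" where
  "side_point n e t = (1 - t) *\<^sub>R vertex n e + t *\<^sub>R vertex n (Suc e)"

text \<open>\<open>XLabel i k\<close> is the letter $x_i^k$, \<open>YLabel j k\<close> is $y_j^k$; all indices start at 0.\<close>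

datatype edge_label = XLabel nat nat | YLabel nat nat

definition side_label :: "nat \<Rightarrow> nat \<Rightarrow> nat \<Rightarrow> edge_label" where
  "side_label i j e = (if even e then XLabel i (e div 2) else YLabel j (e div 2))"

text \<open>A point of the disjoint union is \<open>((i, j), z)\<close> with \<open>z\<close> in the polygon \<open>P\<^sub>i\<^sub>j\<close>.\<close>

type_synonym polygon_point = "(nat \<times> nat) \<times> complex"

definition polygons :: "nat \<Rightarrow> nat \<Rightarrow> nat \<Rightarrow> polygon_point topology" where
  "polygons m q1 q2 =
     sum_topology (\<lambda>_. top_of_set (polygon (2 * m))) ({..<q1} \<times> {..<q2})"

inductive glued :: "nat \<Rightarrow> nat \<Rightarrow> nat \<Rightarrow> polygon_point \<Rightarrow> polygon_point \<Rightarrow> bool"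
  for m q1 q2 :: nat where
  "\<lbrakk>i < q1; j < q2; i' < q1; j' < q2; e < 2 * m; e' < 2 * m;
    side_label i j e = side_label i' j' e'; 0 \<le> t; t \<le> 1\<rbrakk>
   \<Longrightarrow> glued m q1 q2 ((i, j), side_point (2 * m) e t) ((i', j'), side_point (2 * m) e' t)"

definition polygon_complex :: "nat \<Rightarrow> nat \<Rightarrow> nat \<Rightarrow> polygon_point set topology" where
  "polygon_complex m q1 q2 =
     quotient_topology (polygons m q1 q2) (\<lambda>p. {p'. equivclp (glued m q1 q2) p p'})"

section \<open>The graph product over a cycle\<close>

text \<open>\<open>Inl (k, g)\<close> is the copy of \<open>g\<close> in $G_{1,k}$ and \<open>Inr (k, h)\<close> is the copy of \<open>h\<close> in
  $G_{2,k}$, with \<open>k < m\<close> representing an element of $\mathbb{Z}/m\mathbb{Z}$.\<close>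

definition bourdon_generators ::
    "nat \<Rightarrow> ('a, 'c) monoid_scheme \<Rightarrow> ('b, 'd) monoid_scheme \<Rightarrow> (nat \<times> 'a + nat \<times> 'b) set" where
  "bourdon_generators m G1 G2 = ({..<m} \<times> carrier G1) <+> ({..<m} \<times> carrier G2)"

definition commutator_word :: "'a \<Rightarrow> 'a \<Rightarrow> 'a word" where
  "commutator_word s t = [(s, True), (t, True), (s, False), (t, False)]"

definition mult_table_words :: "('a, 'c) monoid_scheme \<Rightarrow> ('a \<Rightarrow> 's) \<Rightarrow> 's word set" where
  "mult_table_words G \<iota> =
     {[(\<iota> g, True), (\<iota> h, True), (\<iota> (g \<otimes>\<^bsub>G\<^esub> h), False)] | g h. g \<in> carrier G \<and> h \<in> carrier G}"

definition bourdon_relators ::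
    "nat \<Rightarrow> ('a, 'c) monoid_scheme \<Rightarrow> ('b, 'd) monoid_scheme
      \<Rightarrow> (nat \<times> 'a + nat \<times> 'b) word set" where
  "bourdon_relators m G1 G2 =
     (\<Union>k\<in>{..<m}. mult_table_words G1 (\<lambda>g. Inl (k, g))) \<union>
     (\<Union>k\<in>{..<m}. mult_table_words G2 (\<lambda>h. Inr (k, h))) \<union>
     {commutator_word (Inl (k, g)) (Inr (k, h)) | k g h.
        k < m \<and> g \<in> carrier G1 \<and> h \<in> carrier G2} \<union>
     {commutator_word (Inr (k, h)) (Inl (Suc k mod m, g)) | k g h.
        k < m \<and> g \<in> carrier G1 \<and> h \<in> carrier G2}"

definition bourdon_group ::
    "nat \<Rightarrow> ('a, 'c) monoid_scheme \<Rightarrow> ('b, 'd) monoid_scheme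
      \<Rightarrow> (nat \<times> 'a + nat \<times> 'b) word set monoid" where
  "bourdon_group m G1 G2 =
     presented_group (bourdon_generators m G1 G2) (bourdon_relators m G1 G2)"

section \<open>Torsion-free subgroups and index\<close>

definition torsion_free_in :: "('a, 'c) monoid_scheme \<Rightarrow> 'a set \<Rightarrow> bool" where
  "torsion_free_in G K \<longleftrightarrow>
     (\<forall>x\<in>K. \<forall>n::nat. n > 0 \<longrightarrow> x [^]\<^bsub>G\<^esub> n = \<one>\<^bsub>G\<^esub> \<longrightarrow> x = \<one>\<^bsub>G\<^esub>)"

definition finite_index :: "('a, 'c) monoid_scheme \<Rightarrow> 'a set \<Rightarrow> bool" where
  "finite_index G K \<longleftrightarrow> finite (rcosets\<^bsub>G\<^esub> K)"

text \<open>Meaningful only for subgroups of finite index: \<open>card\<close> of an infinite set is 0.\<close>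

definition subgroup_index :: "('a, 'c) monoid_scheme \<Rightarrow> 'a set \<Rightarrow> nat" where
  "subgroup_index G K = card (rcosets\<^bsub>G\<^esub> K)"

end

theory Submission
  imports Defs
begin

text \<open>The subgroup is the kernel of the map of $\Gamma$ onto $G_1 \times G_2$ that collapses the indices.

Index, maximality and minimality are formal: $G_{1,k} \times G_{2,k}$ maps isomorphically onto
$G_1 \times G_2$, so its elements represent the cosets of the kernel and it acts freely on the cosets
of every torsion-free subgroup. For torsion-freeness, retract $\Gamma$ onto the free product of the
$G_{1,k}$; the kernel of the retraction is a free product of conjugates of the $G_{2,k}$. In a free
product of copies of a group, the kernel of the folding map contains no torsion, because a
cyclically reduced word of length at least two has infinite order.

For the fundamental group, the $q_1 q_2$ chambers of the complex are labelled by $G_1 \times G_2$, and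
crossing sides turns words in the generators of $\Gamma$ into paths between centers of chambers. The
star of a vertex is contractible, so relators give null-homotopic paths, and by subdivision
every path between centers comes from a word. Conversely, a locally constant cocycle on the stars of
the vertices with values in $\Gamma$ has a homotopy-invariant holonomy, which recovers from such a
path the element of $\Gamma$ given by the word. Loops correspond to words with trivial image in
$G_1 \times G_2$.\<close>

section \<open>Presented groups\<close>

text \<open>No normal form theorem for \<Gamma> is proved in advance. Normal forms come from van der
  Waerden's device: \<Gamma> acts on sets of reduced words, and for this only the defining relators
  have to be checked. One action serves the image of the retraction, another its kernel; in the
  second, the image conjugates the names of the free factors, as the semidirect product demands. The
  universal cover of the complex is avoided as well. Showing that words with homotopic paths are
  equal in \<Gamma> calls for an invariant of paths, and holonomy builds it from local data: near a
  vertex, a chamber is labelled by its image in the group of that vertex. The labels jump at the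
  sides, where a point has several chambers, but the quotients of labels at two vertices do not, and
  transport along paths uses nothing else. The quotient space is replaced by a homeomorphic subset
  of \<open>complex \<times> real \<times> real\<close>, where paths, convexity and closed sets are
  accessible through coordinates.\<close>

lemma words_Nil [simp]: "[] \<in> words S"
  by (simp add: words_def)

lemma words_Cons [simp]: "x # w \<in> words S \<longleftrightarrow> fst x \<in> S \<and> w \<in> words S"
  by (cases x) (auto simp: words_def)

lemma words_append [simp]: "u @ v \<in> words S \<longleftrightarrow> u \<in> words S \<and> v \<in> words S"
  by (induction u) auto

definition inv_word :: "'a word \<Rightarrow> 'a word" where
  "inv_word w = rev (map (\<lambda>(s, b). (s, \<not> b)) w)"

lemma inv_word_simps [simp]: "inv_word [] = []" "inv_word (x # w) = inv_word w @ [(fst x, \<not> snd x)]"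
  by (auto simp: inv_word_def split_beta)

lemma inv_word_in_words [simp]: "inv_word w \<in> words S \<longleftrightarrow> w \<in> words S"
  by (induction w) auto

lemma inv_word_inv_word [simp]: "inv_word (inv_word w) = w"
  by (induction w) (auto simp: inv_word_def rev_map comp_def split_beta)

locale presentation =
  fixes S :: "'a set" and R :: "'a word set"
  assumes relators_words: "R \<subseteq> words S"
begin

abbreviation "weq \<equiv> equivclp (word_step S R)"

lemma word_step_words: "word_step S R u v \<Longrightarrow> u \<in> words S \<and> v \<in> words S"
  by (erule word_step.cases) (use relators_words in \<open>auto simp: subset_iff\<close>)

lemma weq_words: "weq u v \<Longrightarrow> u \<in> words S \<longleftrightarrow> v \<in> words S"
  by (induction rule: equivclp_induct) (use word_step_words in blast)+

lemma word_step_context: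
  assumes "word_step S R u v" "x \<in> words S" "y \<in> words S"
  shows "word_step S R (x @ u @ y) (x @ v @ y)"
  using assms(1)
proof cases
  case (cancel u' v' s b)
  then show ?thesis
    using assms word_step.cancel[of "x @ u'" S "v' @ y" s R b] by simp
next
  case (relator u' v' r)
  then show ?thesis
    using assms word_step.relator[of "x @ u'" S "v' @ y" r R] by simp
qed

lemma weq_context:
  assumes "weq u v" "x \<in> words S" "y \<in> words S"
  shows "weq (x @ u @ y) (x @ v @ y)"
  using assms(1)
proof (induction rule: equivclp_induct)
  case base
  then show ?case by (rule equivclp_refl)
next
  case (step v w)
  then have "weq (x @ v @ y) (x @ w @ y)"
    using word_step_context assms(2,3) by (meson r_into_equivclp equivclp_sym)
  then show ?case using step.IH by (rule equivclp_trans[rotated])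
qed

lemma weq_append:
  assumes "weq u u'" "weq v v'" "u \<in> words S" "v \<in> words S"
  shows "weq (u @ v) (u' @ v')"
proof -
  have "weq (u @ v) (u' @ v)"
    using weq_context[of u u' "[]" v] assms by simp
  also have "weq \<dots> (u' @ v')"
    using weq_context[of v v' u' "[]"] assms weq_words[of u u'] by simp
  finally (equivclp_trans) show ?thesis .
qed

lemma weq_inv_word: "w \<in> words S \<Longrightarrow> weq (w @ inv_word w) []"
proof (induction w)
  case (Cons x w)
  then have "weq ([x] @ (w @ inv_word w) @ [(fst x, \<not> snd x)]) ([x] @ [] @ [(fst x, \<not> snd x)])"
    by (intro weq_context) auto
  also have "weq \<dots> []"
    using Cons.prems word_step.cancel[of "[]" S "[]" "fst x" R "snd x"] by (simp add: r_into_equivclp)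
  finally (equivclp_trans) show ?case by simp
qed simp

lemma word_class_eq_iff: "word_class S R u = word_class S R v \<longleftrightarrow> weq u v"
  unfolding word_class_def
  by (auto intro: equivclp_trans equivclp_sym)

abbreviation "\<Gamma> \<equiv> presented_group S R"

lemma carrier_presented_group: "carrier \<Gamma> = word_class S R ` words S"
  and one_presented_group: "\<one>\<^bsub>\<Gamma>\<^esub> = word_class S R []"
  by (simp_all add: presented_group_def)

text \<open>The product is defined as a union over all representatives; by congruence all the united
  classes are equal, and the union collapses.\<close>

lemma mult_presented_group:
  assumes "u \<in> words S" "v \<in> words S"
  shows "word_class S R u \<otimes>\<^bsub>\<Gamma>\<^esub> word_class S R v = word_class S R (u @ v)"
proof -
  have "word_class S R (u' @ v') = word_class S R (u @ v)"
    if "u' \<in> word_class S R u" "v' \<in> word_class S R v" for u' v'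
    using that assms weq_append[of u u' v v'] unfolding word_class_eq_iff
    by (auto simp: word_class_def intro: equivclp_sym)
  moreover have "u \<in> word_class S R u" "v \<in> word_class S R v"
    by (auto simp: word_class_def)
  ultimately show ?thesis
    unfolding presented_group_def monoid.simps by blast
qed

lemma group_presented_group: "group \<Gamma>"
proof (rule groupI)
  show "\<exists>y\<in>carrier \<Gamma>. y \<otimes>\<^bsub>\<Gamma>\<^esub> x = \<one>\<^bsub>\<Gamma>\<^esub>" if x: "x \<in> carrier \<Gamma>" for x
  proof -
    obtain w where w: "w \<in> words S" "x = word_class S R w"
      using x by (auto simp: carrier_presented_group)
    have "word_class S R (inv_word w) \<otimes>\<^bsub>\<Gamma>\<^esub> x = \<one>\<^bsub>\<Gamma>\<^esub>"
      using w weq_inv_word[of "inv_word w"]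
      by (simp add: mult_presented_group one_presented_group word_class_eq_iff)
    then show ?thesis using w by (auto simp: carrier_presented_group)
  qed
qed (auto simp: carrier_presented_group one_presented_group mult_presented_group)

sublocale group \<Gamma>
  by (rule group_presented_group)

lemma inv_presented_group:
  "w \<in> words S \<Longrightarrow> inv\<^bsub>\<Gamma>\<^esub> word_class S R w = word_class S R (inv_word w)"
  by (rule inv_equality)
     (auto simp: carrier_presented_group one_presented_group mult_presented_group
       word_class_eq_iff intro: weq_inv_word[of "inv_word w", simplified])

definition gen :: "'a \<Rightarrow> 'a word set" where
  "gen s = word_class S R [(s, True)]"

lemma gen_closed [simp]: "s \<in> S \<Longrightarrow> gen s \<in> carrier \<Gamma>"
  by (auto simp: gen_def carrier_presented_group)

lemma word_class_closed [simp]: "w \<in> words S \<Longrightarrow> word_class S R w \<in> carrier \<Gamma>"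
  by (auto simp: carrier_presented_group)

lemma word_class_relator: "r \<in> R \<Longrightarrow> word_class S R r = \<one>\<^bsub>\<Gamma>\<^esub>"
  using word_step.relator[of "[]" S "[]" r R]
  by (auto simp: one_presented_group word_class_eq_iff)

end

section \<open>Evaluation of words and the universal property of a presentation\<close>

fun letter_val :: "('g, 'm) monoid_scheme \<Rightarrow> ('a \<Rightarrow> 'g) \<Rightarrow> 'a \<times> bool \<Rightarrow> 'g" where
  "letter_val G f (s, b) = (if b then f s else inv\<^bsub>G\<^esub> f s)"

fun word_val :: "('g, 'm) monoid_scheme \<Rightarrow> ('a \<Rightarrow> 'g) \<Rightarrow> 'a word \<Rightarrow> 'g" where
  "word_val G f [] = \<one>\<^bsub>G\<^esub>"
| "word_val G f (x # w) = letter_val G f x \<otimes>\<^bsub>G\<^esub> word_val G f w"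

context group
begin

lemma letter_val_closed [simp]: "f \<in> S \<rightarrow> carrier G \<Longrightarrow> fst x \<in> S \<Longrightarrow> letter_val G f x \<in> carrier G"
  by (cases x) (auto simp: Pi_iff)

lemma word_val_closed [simp]: "f \<in> S \<rightarrow> carrier G \<Longrightarrow> w \<in> words S \<Longrightarrow> word_val G f w \<in> carrier G"
  by (induction w) auto

lemma word_val_append:
  "f \<in> S \<rightarrow> carrier G \<Longrightarrow> u \<in> words S \<Longrightarrow> v \<in> words S \<Longrightarrow>
    word_val G f (u @ v) = word_val G f u \<otimes> word_val G f v"
  by (induction u) (auto simp: m_assoc)

end

context presentation
begin

lemma invariant_weq:
  assumes "\<And>u v. word_step S R u v \<Longrightarrow> F u = F v" "weq u v"
  shows "F u = F v"
  using assms(2) by (induction rule: equivclp_induct) (use assms(1) in auto)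

definition class_lift :: "('a word \<Rightarrow> 'b) \<Rightarrow> 'a word set \<Rightarrow> 'b" where
  "class_lift F A = F (SOME w. w \<in> words S \<and> A = word_class S R w)"

lemma class_lift_eq:
  assumes "\<And>u v. word_step S R u v \<Longrightarrow> F u = F v" "w \<in> words S"
  shows "class_lift F (word_class S R w) = F w"
proof -
  let ?v = "SOME v. v \<in> words S \<and> word_class S R w = word_class S R v"
  have "?v \<in> words S \<and> word_class S R w = word_class S R ?v"
    by (rule someI[of _ w]) (use assms in auto)
  then have "weq w ?v" by (simp add: word_class_eq_iff)
  then show ?thesis unfolding class_lift_def using invariant_weq[of F w ?v] assms by simp
qed

lemma word_val_step:
  assumes "group H" "f \<in> S \<rightarrow> carrier H" "\<And>r. r \<in> R \<Longrightarrow> word_val H f r = \<one>\<^bsub>H\<^esub>"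
    "word_step S R u v"
  shows "word_val H f u = word_val H f v"
proof -
  interpret H: group H by fact
  note closed = H.word_val_closed[OF assms(2)] and app = H.word_val_append[OF assms(2)]
  from assms(4) show ?thesis
  proof cases
    case (cancel u' v' s b)
    then have "f s \<in> carrier H" using assms(2) by auto
    then have "letter_val H f (s, b) \<otimes>\<^bsub>H\<^esub> (letter_val H f (s, \<not> b) \<otimes>\<^bsub>H\<^esub> y) = y" if "y \<in> carrier H" for y
      using that by (cases b) (simp_all add: H.m_assoc[symmetric])
    then show ?thesis
      using cancel closed[of v'] by (simp add: app del: letter_val.simps)
  next
    case (relator u' v' r)
    then show ?thesis
      using closed relators_words assms(3) by (auto simp: app subset_iff)
  qed
qed

definition ext :: "('g, 'm) monoid_scheme \<Rightarrow> ('a \<Rightarrow> 'g) \<Rightarrow> 'a word set \<Rightarrow> 'g" where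
  "ext H f = class_lift (word_val H f)"

text \<open>Von Dyck's theorem: evaluation of words does not change under deletion of relators that
  evaluate to the identity, so it descends to classes.\<close>

lemma
  assumes "group H" "f \<in> S \<rightarrow> carrier H" "\<And>r. r \<in> R \<Longrightarrow> word_val H f r = \<one>\<^bsub>H\<^esub>"
  shows ext_word_class: "w \<in> words S \<Longrightarrow> ext H f (word_class S R w) = word_val H f w"
    and ext_hom: "ext H f \<in> hom \<Gamma> H"
    and ext_gen: "s \<in> S \<Longrightarrow> ext H f (gen s) = f s"
proof -
  interpret H: group H by fact
  show *: "ext H f (word_class S R w) = word_val H f w" if "w \<in> words S" for w
    unfolding ext_def by (rule class_lift_eq) (use that word_val_step[OF assms] in auto)
  show "ext H f \<in> hom \<Gamma> H"
    using assms(2)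
    by (auto simp: hom_def carrier_presented_group mult_presented_group * H.word_val_append[OF assms(2)]
        intro!: H.word_val_closed)
  show "ext H f (gen s) = f s" if "s \<in> S"
  proof -
    have "f s \<in> carrier H" using that assms(2) by auto
    then show ?thesis using that by (simp add: gen_def *)
  qed
qed

lemma word_val_gen: "w \<in> words S \<Longrightarrow> word_val \<Gamma> gen w = word_class S R w"
proof (induction w)
  case Nil
  then show ?case by (simp add: one_presented_group)
next
  case (Cons x w)
  have "letter_val \<Gamma> gen x = word_class S R [x]"
    using Cons.prems by (cases x) (auto simp: gen_def inv_presented_group)
  then show ?case using Cons by (simp add: mult_presented_group)
qed

end

section \<open>Torsion in free products\<close>

text \<open>A pair \<open>(i, g)\<close> is a syllable from the copy of \<open>G\<close> with index
  \<open>i\<close>. Merging equal neighbouring indices and erasing trivial products keeps words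
  reduced.\<close>

fun syl_mul :: "('g, 'm) monoid_scheme \<Rightarrow> 'i \<Rightarrow> 'g \<Rightarrow> ('i \<times> 'g) list \<Rightarrow> ('i \<times> 'g) list" where
  "syl_mul G i g [] = (if g = \<one>\<^bsub>G\<^esub> then [] else [(i, g)])"
| "syl_mul G i g ((j, h) # w) =
     (if g = \<one>\<^bsub>G\<^esub> then (j, h) # w
      else if i = j then (if g \<otimes>\<^bsub>G\<^esub> h = \<one>\<^bsub>G\<^esub> then w else (i, g \<otimes>\<^bsub>G\<^esub> h) # w)
      else (i, g) # (j, h) # w)"

definition reduced :: "('g, 'm) monoid_scheme \<Rightarrow> 'i set \<Rightarrow> ('i \<times> 'g) list \<Rightarrow> bool" where
  "reduced G I w \<longleftrightarrow>
     set w \<subseteq> I \<times> (carrier G - {\<one>\<^bsub>G\<^esub>}) \<and> successively (\<lambda>x y. fst x \<noteq> fst y) w"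

lemma reduced_Nil [simp]: "reduced G I []"
  by (simp add: reduced_def)

lemma reduced_Cons:
  "reduced G I (x # w) \<longleftrightarrow> fst x \<in> I \<and> snd x \<in> carrier G \<and> snd x \<noteq> \<one>\<^bsub>G\<^esub> \<and> reduced G I w \<and>
     (w \<noteq> [] \<longrightarrow> fst x \<noteq> fst (hd w))"
  by (cases w; cases x) (auto simp: reduced_def)

text \<open>An injective relabelling neither creates nor destroys coincidences of neighbouring
  indices, so merging happens in the same places. It is applied to conjugations that permute free
  factors.\<close>

lemma syl_mul_map:
  assumes "inj_on f I" "i \<in> I" "reduced G I w"
  shows "syl_mul G (f i) g (map (apfst f) w) = map (apfst f) (syl_mul G i g w)"
proof (cases w)
  case (Cons x v)
  then have "f i = f (fst x) \<longleftrightarrow> i = fst x"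
    using assms by (auto simp: reduced_Cons dest: inj_onD)
  then show ?thesis using Cons by (cases x) auto
qed simp

lemma reduced_map:
  assumes "inj_on f I" "f ` I \<subseteq> J"
  shows "reduced G I w \<Longrightarrow> reduced G J (map (apfst f) w)"
proof (induction w)
  case (Cons x w)
  have "f (fst x) \<noteq> f (fst (hd w))" if "w \<noteq> []"
  proof -
    have "hd w \<in> set w" using that by simp
    then have "fst (hd w) \<in> I" using Cons.prems by (auto simp: reduced_def)
    then show ?thesis using Cons.prems that assms by (auto simp: reduced_Cons dest: inj_onD)
  qed
  then show ?case using Cons assms by (auto simp: reduced_Cons hd_map)
qed simp

lemma length_syl_mul: "length (syl_mul G i g w) \<le> Suc (length w)"
  by (cases w) auto

lemma syl_mul_one [simp]: "syl_mul G i \<one>\<^bsub>G\<^esub> w = w"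
  by (cases w) auto

lemma syl_mul_reduced_Cons: "reduced G I (x # w) \<Longrightarrow> syl_mul G (fst x) (snd x) w = x # w"
  by (cases w) (auto simp: reduced_Cons)

context group
begin

lemma reduced_syl_mul:
  "reduced G I w \<Longrightarrow> i \<in> I \<Longrightarrow> g \<in> carrier G \<Longrightarrow> reduced G I (syl_mul G i g w)"
  by (cases w) (auto simp: reduced_Cons split: if_splits)

text \<open>With \<open>syl_mul_one\<close>, this is van der Waerden's action of one free factor on
  reduced words. The delicate case erases a syllable and brings to the front one of a different
  index.\<close>

lemma syl_mul_mult:
  assumes "reduced G I w" "g \<in> carrier G" "h \<in> carrier G"
  shows "syl_mul G i g (syl_mul G i h w) = syl_mul G i (g \<otimes> h) w"
proof (cases "g = \<one> \<or> h = \<one>")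
  case True
  then show ?thesis using assms by auto
next
  case ne: False
  show ?thesis
  proof (cases w)
    case Nil
    then show ?thesis using ne assms by auto
  next
    case (Cons x v)
    obtain j k where x: "x = (j, k)" by fastforce
    have k: "k \<in> carrier G" "k \<noteq> \<one>" using assms Cons x by (auto simp: reduced_Cons)
    have v: "syl_mul G j g v = (j, g) # v"
      using assms ne Cons x by (cases v) (auto simp: reduced_Cons)
    have 1: "g \<otimes> h \<otimes> k = g" if "h \<otimes> k = \<one>"
      using that assms k by (simp add: m_assoc)
    have 2: "h \<otimes> k = k" if "h = \<one>" using that k by simp
    have 3: "g \<otimes> (h \<otimes> k) = k" if "g \<otimes> h = \<one>"
      using that assms k by (simp add: m_assoc[symmetric])
    show ?thesis using ne assms k x Cons v 1 3
      by (auto simp: m_assoc[symmetric])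
  qed
qed

end

definition syl_val :: "('x, 'm) monoid_scheme \<Rightarrow> ('i \<Rightarrow> 'g \<Rightarrow> 'x) \<Rightarrow> ('i \<times> 'g) list \<Rightarrow> 'x" where
  "syl_val H \<phi> w = foldr (\<lambda>(i, g) y. \<phi> i g \<otimes>\<^bsub>H\<^esub> y) w \<one>\<^bsub>H\<^esub>"

lemma syl_val_simps [simp]:
  "syl_val H \<phi> [] = \<one>\<^bsub>H\<^esub>"
  "syl_val H \<phi> (x # w) = \<phi> (fst x) (snd x) \<otimes>\<^bsub>H\<^esub> syl_val H \<phi> w"
  by (simp_all add: syl_val_def split_beta)

lemma syl_val_closed:
  assumes "group H" "\<And>i. i \<in> I \<Longrightarrow> \<phi> i \<in> carrier G \<rightarrow> carrier H" "reduced G I w"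
  shows "syl_val H \<phi> w \<in> carrier H"
proof -
  interpret H: group H by fact
  show ?thesis using assms(3,2) by (induction w) (auto simp: reduced_Cons Pi_iff)
qed

lemma syl_val_syl_mul:
  assumes "group G" "group H" "\<And>i. i \<in> I \<Longrightarrow> \<phi> i \<in> hom G H" "reduced G I w" "i \<in> I" "g \<in> carrier G"
  shows "syl_val H \<phi> (syl_mul G i g w) = \<phi> i g \<otimes>\<^bsub>H\<^esub> syl_val H \<phi> w"
proof -
  interpret G: group G by fact
  interpret H: group H by fact
  interpret \<phi>: group_hom G H "\<phi> i" using assms by unfold_locales
  show ?thesis
  proof (cases w)
    case Nil
    then show ?thesis using assms by simp
  next
    case (Cons x v)
    have v: "syl_val H \<phi> v \<in> carrier H" "\<phi> (fst x) (snd x) \<in> carrier H"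
      using syl_val_closed[of H I \<phi> G v] assms Cons
      by (auto simp: reduced_Cons hom_def Pi_iff)
    have x: "snd x \<in> carrier G" using assms Cons by (auto simp: reduced_Cons)
    then have "\<phi> i g \<otimes>\<^bsub>H\<^esub> \<phi> i (snd x) = \<phi> i (g \<otimes>\<^bsub>G\<^esub> snd x)" using assms by simp
    then show ?thesis using Cons assms v x
      by (cases x) (auto simp: H.m_assoc[symmetric] simp del: \<phi>.hom_mult)
  qed
qed

text \<open>Recognises \<open>N\<close> as the free product of the images of the
  \<open>\<phi> i\<close>, all copies of one group, without constructing a free product:
  \<open>D\<close> is a normal form, compatible with multiplication by a factor and inverted by
  evaluation. The map \<open>p\<close> folds all factors onto \<open>G\<close>.\<close>

locale free_product_action = H: group H + G: group G
  for H :: "('x, 'm) monoid_scheme" (structure) and G :: "('g, 'n) monoid_scheme" +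
  fixes N :: "'x set" and I :: "'i set" and \<phi> :: "'i \<Rightarrow> 'g \<Rightarrow> 'x"
    and D :: "'x \<Rightarrow> ('i \<times> 'g) list" and p :: "'x \<Rightarrow> 'g"
  assumes subgroup: "subgroup N H"
    and \<phi>_hom: "i \<in> I \<Longrightarrow> \<phi> i \<in> hom G H"
    and \<phi>_N: "i \<in> I \<Longrightarrow> g \<in> carrier G \<Longrightarrow> \<phi> i g \<in> N"
    and D_one: "D \<one> = []"
    and D_reduced: "x \<in> N \<Longrightarrow> reduced G I (D x)"
    and D_mult: "i \<in> I \<Longrightarrow> g \<in> carrier G \<Longrightarrow> x \<in> N \<Longrightarrow> D (\<phi> i g \<otimes> x) = syl_mul G i g (D x)"
    and D_inverse: "x \<in> N \<Longrightarrow> syl_val H \<phi> (D x) = x"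
    and p_hom: "p \<in> hom H G"
    and p_\<phi>: "i \<in> I \<Longrightarrow> g \<in> carrier G \<Longrightarrow> p (\<phi> i g) = g"
begin

abbreviation "ev \<equiv> syl_val H \<phi>"

lemma N_closed [simp]: "x \<in> N \<Longrightarrow> x \<in> carrier H"
  using subgroup by (simp add: subgroup.mem_carrier)

lemma ev_N: "set w \<subseteq> I \<times> carrier G \<Longrightarrow> ev w \<in> N"
  by (induction w) (auto intro!: subgroup.m_closed[OF subgroup] subgroup.one_closed[OF subgroup] \<phi>_N)

lemma ev_append:
  "set u \<subseteq> I \<times> carrier G \<Longrightarrow> set v \<subseteq> I \<times> carrier G \<Longrightarrow> ev (u @ v) = ev u \<otimes> ev v"
proof (induction u)
  case (Cons x u)
  then have "\<phi> (fst x) (snd x) \<in> carrier H" "ev u \<in> carrier H" "ev v \<in> carrier H"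
    using ev_N \<phi>_N by auto
  then show ?case using Cons by (simp add: H.m_assoc)
next
  case Nil
  then show ?case using ev_N[of v] by simp
qed

lemma reduced_set: "reduced G I w \<Longrightarrow> set w \<subseteq> I \<times> carrier G"
  by (auto simp: reduced_def)

text \<open>Uniqueness of normal forms. Each syllable of a reduced word differs in index from its
  successor, so building the word up from the right only ever prepends.\<close>

lemma D_ev: "reduced G I w \<Longrightarrow> D (ev w) = w"
proof (induction w)
  case (Cons x w)
  then have "reduced G I w" "fst x \<in> I" "snd x \<in> carrier G" by (auto simp: reduced_Cons)
  then have "D (ev (x # w)) = syl_mul G (fst x) (snd x) w"
    using D_mult[of "fst x" "snd x" "ev w"] ev_N[of w] reduced_set[of w] Cons.IH by (cases x) simp
  then show ?case using syl_mul_reduced_Cons[OF Cons.prems] by simp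
qed (simp add: D_one)

text \<open>The last and first syllables lie in different factors, so copies of \<open>w\<close> can
  be concatenated without cancellation. The \<open>n\<close>-th power then has a nonempty normal
  form, unlike the identity.\<close>

lemma cyclically_reduced_torsion_free:
  assumes "reduced G I w" "w \<noteq> []" "fst (last w) \<noteq> fst (hd w)" "n > 0"
  shows "ev w [^] (n::nat) \<noteq> \<one>"
proof -
  \<comment> \<open>The head is carried through the induction because the next copy of
    \<open>w\<close> is joined to it.\<close>
  have "reduced G I (concat (replicate n w)) \<and>
      (n > 0 \<longrightarrow> concat (replicate n w) \<noteq> [] \<and> hd (concat (replicate n w)) = hd w) \<and>
      ev (concat (replicate n w)) = ev w [^] n" for n
  proof (induction n)
    case (Suc n)
    let ?c = "concat (replicate n w)"
    have "reduced G I (w @ ?c)"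
      using assms Suc by (cases "n > 0") (auto simp: reduced_def successively_append_iff)
    moreover have "ev (w @ ?c) = ev w \<otimes> ev ?c"
      using assms(1) Suc.IH
      by (intro ev_append) (simp_all add: reduced_set del: set_concat set_replicate)
    moreover have "ev w \<in> carrier H"
      using ev_N[OF reduced_set[OF assms(1)]] by simp
    ultimately show ?case
      using assms(2) Suc H.nat_pow_Suc2[of "ev w" n] by simp
  qed simp
  note * = this[of n]
  show ?thesis
  proof
    assume "ev w [^] n = \<one>"
    then have "concat (replicate n w) = []"
      using * D_one by (metis D_ev)
    then show False using * assms(4) by blast
  qed
qed

text \<open>A torsion element conjugated so as to have a shortest reduced word lies in a free factor.\<close>

lemma torsion_free_kernel:
  assumes "x \<in> N" "p x = \<one>\<^bsub>G\<^esub>" "x [^] (n::nat) = \<one>" "n > 0"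
  shows "x = \<one>"
  using assms
proof (induction "length (D x)" arbitrary: x rule: less_induct)
  case less
  have x: "x \<in> carrier H" using less.prems by simp
  show ?case
  proof (rule ccontr)
    assume ne: "x \<noteq> \<one>"
    define w where "w = D x"
    have red: "reduced G I w" and ev: "ev w = x"
      using less.prems D_reduced D_inverse by (auto simp: w_def)
    have "w \<noteq> []" using ev ne by auto
    then obtain i g w' where w: "w = (i, g) # w'" by (metis list.exhaust surj_pair)
    have ig: "i \<in> I" "g \<in> carrier G" "g \<noteq> \<one>\<^bsub>G\<^esub>" using red by (auto simp: w reduced_Cons)
    show False
    proof (cases "w' = []")
      case True
      \<comment> \<open>A single syllable is detected by the folding map.\<close>
      then have "p x = g" using ev w ig p_\<phi> \<phi>_N by auto
      then show False using less.prems ig by simp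
    next
      case False
      then obtain j h u where w': "w' = u @ [(j, h)]" by (metis rev_exhaust surj_pair)
      have jh: "j \<in> I" "h \<in> carrier G" and u: "set u \<subseteq> I \<times> carrier G"
        using red reduced_set[OF red] by (auto simp: w w')
      show False
      proof (cases "i = j")
        case False
        then show False
          using cyclically_reduced_torsion_free[OF red _ _ less.prems(4)] ev less.prems(3)
          by (auto simp: w w')
      next
        case True
        \<comment> \<open>Conjugation moves the last syllable to the front, where it merges with the
          first since \<open>i = j\<close>. Two syllables become at most one, so the normal form
          gets shorter.\<close>
        define a where "a = \<phi> j h"
        define y where "y = a \<otimes> x \<otimes> inv a"
        have a: "a \<in> N" "a \<in> carrier H" using jh \<phi>_N by (auto simp: a_def)
        have uN: "ev u \<in> N" "ev u \<in> carrier H" and gN: "\<phi> i g \<in> carrier H"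
          using ev_N[OF u] ig \<phi>_N by auto
        have a_cancel: "inv a \<otimes> (a \<otimes> z) = z" if "z \<in> carrier H" for z
          using a that by (simp add: H.m_assoc[symmetric])
        have "x = \<phi> i g \<otimes> ev u \<otimes> a"
          using ev u jh a uN gN by (simp add: w w' ev_append a_def H.m_assoc)
        then have "y = \<phi> i (h \<otimes>\<^bsub>G\<^esub> g) \<otimes> ev u"
          using a uN gN jh ig \<phi>_hom[of i] True
          by (simp add: y_def H.m_assoc hom_mult a_def)
        moreover have "reduced G I u" using red by (auto simp: w w' reduced_def successively_append_iff successively_Cons)
        ultimately have "D y = syl_mul G i (h \<otimes>\<^bsub>G\<^esub> g) u"
          using D_mult ig jh uN D_ev by simp
        then have "length (D y) < length (D x)"
          using length_syl_mul[of G i "h \<otimes>\<^bsub>G\<^esub> g" u] unfolding w_def[symmetric] by (simp add: w w')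
        moreover have "y \<in> N"
          unfolding y_def using a less.prems subgroup
          by (simp add: subgroup.m_closed subgroup.m_inv_closed)
        moreover have "p y = \<one>\<^bsub>G\<^esub>"
        proof -
          interpret p: group_hom H G p using p_hom by unfold_locales
          show ?thesis using a x less.prems by (simp add: y_def)
        qed
        moreover have "y [^] n = \<one>"
        proof -
          have "y [^] k = a \<otimes> x [^] k \<otimes> inv a" for k :: nat
            by (induction k) (use a x in \<open>auto simp: y_def H.m_assoc a_cancel\<close>)
          then show ?thesis using a less.prems by simp
        qed
        ultimately have "y = \<one>" using less.hyps less.prems by blast
        moreover have "inv a \<otimes> y \<otimes> a = x" using a x by (simp add: y_def H.m_assoc a_cancel)
        ultimately show False using a ne by simp
      qed
    qed
  qed
qed

end

section \<open>The graph product over a cycle\<close>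

text \<open>The section puts a copy of the finite group \<open>D\<close>, consisting of torsion
  elements, into the group; a torsion-free subgroup meets it trivially. If the subgroup contains the
  kernel, this forces equality; in any case the copy represents \<open>order D\<close> distinct
  cosets.\<close>

lemma (in group) torsion_free_kernel_of_split_hom:
  assumes pr: "pr \<in> hom G D" "pr ` carrier G = carrier D" and D: "group D" "finite (carrier D)"
    and sec: "\<iota> \<in> hom D G" "\<And>d. d \<in> carrier D \<Longrightarrow> pr (\<iota> d) = d"
    and tf: "torsion_free_in G (kernel G D pr)"
  shows "finite_index G (kernel G D pr)" "subgroup_index G (kernel G D pr) = order D"
    "subgroup K' G \<Longrightarrow> torsion_free_in G K' \<Longrightarrow> \<not> kernel G D pr \<subset> K'"
    "subgroup K' G \<Longrightarrow> torsion_free_in G K' \<Longrightarrow> finite_index G K' \<Longrightarrow> order D \<le> subgroup_index G K'"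
proof -
  interpret D: group D by fact
  interpret pr: group_hom G D pr using pr by unfold_locales
  interpret \<iota>: group_hom D G \<iota> using sec by unfold_locales
  have "G Mod (kernel G D pr) \<cong> D"
    by (rule pr.FactGroup_iso) (use pr in simp)
  then have "\<exists>f. bij_betw f (rcosets kernel G D pr) (carrier D)"
    by (auto simp: is_iso_def iso_def FactGroup_def)
  then show "finite_index G (kernel G D pr)" "subgroup_index G (kernel G D pr) = order D"
    using D by (auto simp: finite_index_def subgroup_index_def order_def
        bij_betw_same_card bij_betw_finite)
  have trivial: "d = \<one>\<^bsub>D\<^esub>"
    if K': "subgroup K' G" "torsion_free_in G K'" and d: "d \<in> carrier D" "\<iota> d \<in> K'" for K' d
  proof -
    have "order D > 0" using D by (simp add: D.order_gt_0_iff_finite)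
    moreover have "\<iota> d [^] order D = \<one>"
      using d by (simp add: \<iota>.hom_nat_pow[symmetric] D.pow_order_eq_1)
    ultimately have "\<iota> d = \<one>" using K' d unfolding torsion_free_in_def by blast
    then show ?thesis using sec(2)[of d] d by simp
  qed
  show "\<not> kernel G D pr \<subset> K'" if K': "subgroup K' G" "torsion_free_in G K'"
  proof
    assume sub: "kernel G D pr \<subset> K'"
    then obtain x where x: "x \<in> K'" "x \<notin> kernel G D pr" by auto
    have xG: "x \<in> carrier G" using x K' by (meson subgroup.mem_carrier)
    define d where "d = pr x"
    have d: "d \<in> carrier D" "d \<noteq> \<one>\<^bsub>D\<^esub>" using x xG by (auto simp: d_def kernel_def)
    \<comment> \<open>As \<open>x\<close> and \<open>\<iota> d\<close> have the same image under
      \<open>pr\<close>, a subgroup that contains the kernel and \<open>x\<close> also contains the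
      torsion element \<open>\<iota> d\<close>.\<close>
    have "\<iota> d \<otimes> inv x \<in> kernel G D pr"
      using xG d sec(2)[of d] by (simp add: kernel_def d_def)
    then have "\<iota> d \<otimes> inv x \<otimes> x \<in> K'" using sub x K' by (meson psubsetD subgroup.m_closed)
    then have "\<iota> d \<in> K'" using xG d by (simp add: m_assoc)
    then show False using trivial K' d by blast
  qed
  show "order D \<le> subgroup_index G K'"
    if K': "subgroup K' G" "torsion_free_in G K'" "finite_index G K'"
  proof -
    have "inj_on (\<lambda>d. K' #> \<iota> d) (carrier D)"
    proof (rule inj_onI)
      fix d e assume de: "d \<in> carrier D" "e \<in> carrier D" "K' #> \<iota> d = K' #> \<iota> e"
      then have "\<iota> d \<in> K' #> \<iota> e" using K'(1) rcos_self[of "\<iota> d" K'] by simp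
      then obtain k where k: "k \<in> K'" "\<iota> d = k \<otimes> \<iota> e" by (auto simp: r_coset_def)
      then have "\<iota> (d \<otimes>\<^bsub>D\<^esub> inv\<^bsub>D\<^esub> e) = k"
        using de K'(1) by (simp add: m_assoc subgroup.mem_carrier)
      then have "d \<otimes>\<^bsub>D\<^esub> inv\<^bsub>D\<^esub> e = \<one>\<^bsub>D\<^esub>" using trivial K' k de by auto
      then show "d = e" using de by (metis D.inv_equality D.inv_inv D.inv_closed)
    qed
    moreover have "(\<lambda>d. K' #> \<iota> d) ` carrier D \<subseteq> rcosets K'"
      using \<iota>.hom_closed unfolding RCOSETS_def by blast
    ultimately show ?thesis
      using K'(3) by (auto simp: order_def subgroup_index_def finite_index_def intro: card_inj_on_le)
  qed
qed

text \<open>Elements of \<open>BijGroup Z\<close> are extensional functions, hence the restriction;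
  bijectivity comes from the action of the inverse element.\<close>

lemma restrict_hom_BijGroup:
  assumes "group G" "\<And>g z. g \<in> carrier G \<Longrightarrow> z \<in> Z \<Longrightarrow> \<alpha> g z \<in> Z"
    "\<And>z. z \<in> Z \<Longrightarrow> \<alpha> \<one>\<^bsub>G\<^esub> z = z"
    "\<And>g h z. g \<in> carrier G \<Longrightarrow> h \<in> carrier G \<Longrightarrow> z \<in> Z \<Longrightarrow> \<alpha> g (\<alpha> h z) = \<alpha> (g \<otimes>\<^bsub>G\<^esub> h) z"
  shows "(\<lambda>g. restrict (\<alpha> g) Z) \<in> hom G (BijGroup Z)"
proof -
  interpret group G by fact
  have "bij_betw (\<alpha> g) Z Z" if g: "g \<in> carrier G" for g
    by (rule bij_betwI[where g = "\<alpha> (inv\<^bsub>G\<^esub> g)"]) (use assms g in auto)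
  then show ?thesis
    using assms by (auto simp: hom_def BijGroup_def Bij_def compose_def fun_eq_iff)
qed

section \<open>The group \<Gamma>, its projection and its retraction\<close>

locale bourdon = G1: group G1 + G2: group G2
  for G1 :: "('a, 'c) monoid_scheme" and G2 :: "('b, 'd) monoid_scheme" +
  fixes m :: nat
  assumes m: "m \<ge> 2"
begin

abbreviation "S \<equiv> bourdon_generators m G1 G2"
abbreviation "R \<equiv> bourdon_relators m G1 G2"

lemma Suc_mod_less [simp]: "Suc k mod m < m"
  using m by simp

lemma generators_iff [simp]:
  "Inl (k, g) \<in> S \<longleftrightarrow> k < m \<and> g \<in> carrier G1"
  "Inr (k, h) \<in> S \<longleftrightarrow> k < m \<and> h \<in> carrier G2"
  by (auto simp: bourdon_generators_def)

sublocale presentation S R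
  by unfold_locales
    (auto simp: bourdon_relators_def mult_table_words_def commutator_word_def)

text \<open>The relators say exactly that the generators form such a family.\<close>

definition bourdon_family :: "('x, 'e) monoid_scheme \<Rightarrow> (nat \<times> 'a + nat \<times> 'b \<Rightarrow> 'x) \<Rightarrow> bool" where
  "bourdon_family H f \<longleftrightarrow> (\<forall>k<m. (\<lambda>g. f (Inl (k, g))) \<in> hom G1 H \<and> (\<lambda>h. f (Inr (k, h))) \<in> hom G2 H) \<and>
     (\<forall>k<m. \<forall>g\<in>carrier G1. \<forall>h\<in>carrier G2.
       f (Inl (k, g)) \<otimes>\<^bsub>H\<^esub> f (Inr (k, h)) = f (Inr (k, h)) \<otimes>\<^bsub>H\<^esub> f (Inl (k, g)) \<and>
       f (Inr (k, h)) \<otimes>\<^bsub>H\<^esub> f (Inl (Suc k mod m, g)) = f (Inl (Suc k mod m, g)) \<otimes>\<^bsub>H\<^esub> f (Inr (k, h)))"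

lemma bourdon_family_closed: "bourdon_family H f \<Longrightarrow> f \<in> S \<rightarrow> carrier H"
  by (auto simp: bourdon_family_def bourdon_generators_def hom_def Pi_iff)

lemma commutator_word_val:
  assumes "group H" "f s \<in> carrier H" "f t \<in> carrier H"
  shows "word_val H f (commutator_word s t) = \<one>\<^bsub>H\<^esub> \<longleftrightarrow> f s \<otimes>\<^bsub>H\<^esub> f t = f t \<otimes>\<^bsub>H\<^esub> f s"
proof -
  interpret H: group H by fact
  have "word_val H f (commutator_word s t) = (f s \<otimes>\<^bsub>H\<^esub> f t) \<otimes>\<^bsub>H\<^esub> inv\<^bsub>H\<^esub> (f t \<otimes>\<^bsub>H\<^esub> f s)"
    using assms by (simp add: commutator_word_def H.m_assoc H.inv_mult_group)
  then show ?thesis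
    using assms H.inv_solve_right[of "\<one>\<^bsub>H\<^esub>" "f s \<otimes>\<^bsub>H\<^esub> f t" "f t \<otimes>\<^bsub>H\<^esub> f s"]
    by (simp add: eq_commute[of "\<one>\<^bsub>H\<^esub>"])
qed

lemma relator_cases:
  assumes "r \<in> R"
  obtains (mult1) k g h where "k < m" "g \<in> carrier G1" "h \<in> carrier G1"
      "r = [(Inl (k, g), True), (Inl (k, h), True), (Inl (k, g \<otimes>\<^bsub>G1\<^esub> h), False)]"
    | (mult2) k g h where "k < m" "g \<in> carrier G2" "h \<in> carrier G2"
      "r = [(Inr (k, g), True), (Inr (k, h), True), (Inr (k, g \<otimes>\<^bsub>G2\<^esub> h), False)]"
    | (comm1) k g h where "k < m" "g \<in> carrier G1" "h \<in> carrier G2"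
      "r = commutator_word (Inl (k, g)) (Inr (k, h))"
    | (comm2) k g h where "k < m" "g \<in> carrier G1" "h \<in> carrier G2"
      "r = commutator_word (Inr (k, h)) (Inl (Suc k mod m, g))"
proof -
  from assms consider
      (1) k where "k < m" "r \<in> mult_table_words G1 (\<lambda>g. Inl (k, g))"
    | (2) k where "k < m" "r \<in> mult_table_words G2 (\<lambda>h. Inr (k, h))"
    | (3) k g h where "k < m" "g \<in> carrier G1" "h \<in> carrier G2"
        "r = commutator_word (Inl (k, g)) (Inr (k, h))"
    | (4) k g h where "k < m" "g \<in> carrier G1" "h \<in> carrier G2"
        "r = commutator_word (Inr (k, h)) (Inl (Suc k mod m, g))"
    unfolding bourdon_relators_def by (elim UnE UN_E CollectE exE conjE) (simp_all add: lessThan_iff)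
  then show ?thesis
  proof cases
    case 1
    then show ?thesis using mult1 unfolding mult_table_words_def by blast
  next
    case 2
    then show ?thesis using mult2 unfolding mult_table_words_def by blast
  qed (use comm1 comm2 in blast)+
qed

lemma bourdon_family_relators:
  assumes "group H" "bourdon_family H f" "r \<in> R"
  shows "word_val H f r = \<one>\<^bsub>H\<^esub>"
proof -
  interpret H: group H by fact
  have f: "f s \<in> carrier H" if "s \<in> S" for s using bourdon_family_closed assms that by auto
  have f1: "f (Inl (k, g)) \<in> carrier H" if "k < m" "g \<in> carrier G1" for k g using f that by simp
  have f2: "f (Inr (k, g)) \<in> carrier H" if "k < m" "g \<in> carrier G2" for k g using f that by simp
  show ?thesis
    using assms(3)
  proof (cases rule: relator_cases)
    case (mult1 k g h)
    then have "f (Inl (k, g \<otimes>\<^bsub>G1\<^esub> h)) = f (Inl (k, g)) \<otimes>\<^bsub>H\<^esub> f (Inl (k, h))"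
      using assms(2) by (auto simp: bourdon_family_def hom_def)
    then show ?thesis using mult1 f1 by (simp add: H.m_assoc[symmetric])
  next
    case (mult2 k g h)
    then have "f (Inr (k, g \<otimes>\<^bsub>G2\<^esub> h)) = f (Inr (k, g)) \<otimes>\<^bsub>H\<^esub> f (Inr (k, h))"
      using assms(2) by (auto simp: bourdon_family_def hom_def)
    then show ?thesis using mult2 f2 by (simp add: H.m_assoc[symmetric])
  next
    case (comm1 k g h)
    then show ?thesis
      using commutator_word_val[of H f, OF assms(1) f1[OF comm1(1,2)] f2[OF comm1(1,3)]] assms(2)
      by (simp add: bourdon_family_def)
  next
    case (comm2 k g h)
    then show ?thesis
      using commutator_word_val[of H f, OF assms(1) f2[OF comm2(1,3)] f1[OF Suc_mod_less comm2(2)]] assms(2)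
      by (simp add: bourdon_family_def)
  qed
qed

lemma
  assumes "group H" "bourdon_family H f"
  shows ext_family_hom: "ext H f \<in> hom \<Gamma> H"
    and ext_family_gen: "s \<in> S \<Longrightarrow> ext H f (gen s) = f s"
    and ext_family_word_class: "w \<in> words S \<Longrightarrow> ext H f (word_class S R w) = word_val H f w"
  using ext_hom ext_gen ext_word_class bourdon_family_closed[OF assms(2)]
    bourdon_family_relators[OF assms] assms(1) by blast+

lemma bourdon_family_gen: "bourdon_family \<Gamma> gen"
proof -
  have rel: "word_val \<Gamma> gen r = \<one>\<^bsub>\<Gamma>\<^esub>" if "r \<in> R" for r
    using that relators_words by (auto simp: word_val_gen word_class_relator)
  have *: "gen (\<iota> (g \<otimes>\<^bsub>G\<^esub> h)) = gen (\<iota> g) \<otimes>\<^bsub>\<Gamma>\<^esub> gen (\<iota> h)"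
    if "\<iota> g \<in> S" "\<iota> h \<in> S" "\<iota> (g \<otimes>\<^bsub>G\<^esub> h) \<in> S"
      "[(\<iota> g, True), (\<iota> h, True), (\<iota> (g \<otimes>\<^bsub>G\<^esub> h), False)] \<in> R" for \<iota> g h and G :: "('z, 'e) monoid_scheme"
  proof -
    have "gen (\<iota> g) \<otimes>\<^bsub>\<Gamma>\<^esub> gen (\<iota> h) \<otimes>\<^bsub>\<Gamma>\<^esub> inv\<^bsub>\<Gamma>\<^esub> gen (\<iota> (g \<otimes>\<^bsub>G\<^esub> h)) = \<one>\<^bsub>\<Gamma>\<^esub>"
      using rel[OF that(4)] that by (simp add: m_assoc)
    then show ?thesis using that
      by (metis gen_closed inv_closed inv_equality inv_inv m_closed)
  qed
  have R1: "[(Inl (k, g), True), (Inl (k, h), True), (Inl (k, g \<otimes>\<^bsub>G1\<^esub> h), False)] \<in> R"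
    if "k < m" "g \<in> carrier G1" "h \<in> carrier G1" for k g h
    using that unfolding bourdon_relators_def mult_table_words_def by blast
  have R2: "[(Inr (k, g), True), (Inr (k, h), True), (Inr (k, g \<otimes>\<^bsub>G2\<^esub> h), False)] \<in> R"
    if "k < m" "g \<in> carrier G2" "h \<in> carrier G2" for k g h
    using that unfolding bourdon_relators_def mult_table_words_def by blast
  have 1: "(\<lambda>g. gen (Inl (k, g))) \<in> hom G1 \<Gamma>" if "k < m" for k
    using that *[of "\<lambda>g. Inl (k, g)" _ _ G1] R1[of k] by (auto simp: hom_def)
  have 2: "(\<lambda>h. gen (Inr (k, h))) \<in> hom G2 \<Gamma>" if "k < m" for k
    using that *[of "\<lambda>h. Inr (k, h)" _ _ G2] R2[of k] by (auto simp: hom_def)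
  have 3: "commutator_word (Inl (k, g)) (Inr (k, h)) \<in> R"
    "commutator_word (Inr (k, h)) (Inl (Suc k mod m, g)) \<in> R"
    if "k < m" "g \<in> carrier G1" "h \<in> carrier G2" for k g h
    using that unfolding bourdon_relators_def by blast+
  show ?thesis
    unfolding bourdon_family_def
    using 1 2 3[THEN rel] by (simp add: commutator_word_val[OF group_presented_group])
qed

lemma gen_hom1: "k < m \<Longrightarrow> (\<lambda>g. gen (Inl (k, g))) \<in> hom G1 \<Gamma>"
  and gen_hom2: "k < m \<Longrightarrow> (\<lambda>h. gen (Inr (k, h))) \<in> hom G2 \<Gamma>"
  and gen_commute: "k < m \<Longrightarrow> g \<in> carrier G1 \<Longrightarrow> h \<in> carrier G2 \<Longrightarrow>
    gen (Inl (k, g)) \<otimes>\<^bsub>\<Gamma>\<^esub> gen (Inr (k, h)) = gen (Inr (k, h)) \<otimes>\<^bsub>\<Gamma>\<^esub> gen (Inl (k, g))"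
  and gen_commute': "k < m \<Longrightarrow> g \<in> carrier G1 \<Longrightarrow> h \<in> carrier G2 \<Longrightarrow>
    gen (Inr (k, h)) \<otimes>\<^bsub>\<Gamma>\<^esub> gen (Inl (Suc k mod m, g)) =
    gen (Inl (Suc k mod m, g)) \<otimes>\<^bsub>\<Gamma>\<^esub> gen (Inr (k, h))"
  using bourdon_family_gen by (auto simp: bourdon_family_def)

fun inv_generator :: "nat \<times> 'a + nat \<times> 'b \<Rightarrow> nat \<times> 'a + nat \<times> 'b" where
  "inv_generator (Inl (k, g)) = Inl (k, inv\<^bsub>G1\<^esub> g)"
| "inv_generator (Inr (k, h)) = Inr (k, inv\<^bsub>G2\<^esub> h)"

lemma inv_generator_closed: "s \<in> S \<Longrightarrow> inv_generator s \<in> S"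
  by (auto simp: bourdon_generators_def)

lemma inv_gen:
  assumes "s \<in> S"
  shows "inv\<^bsub>\<Gamma>\<^esub> gen s = gen (inv_generator s)"
proof -
  have *: "inv\<^bsub>\<Gamma>\<^esub> f g = f (inv\<^bsub>G\<^esub> g)" if "group G" "f \<in> hom G \<Gamma>" "g \<in> carrier G"
    for f g and G :: "('z, 'e) monoid_scheme"
  proof -
    interpret group_hom G \<Gamma> f
      by (intro group_hom.intro group_hom_axioms.intro that group_presented_group)
    show ?thesis using that by simp
  qed
  show ?thesis
    using assms *[OF G1.group_axioms gen_hom1] *[OF G2.group_axioms gen_hom2]
    by (auto simp: bourdon_generators_def)
qed

text \<open>Inverses of generators are again generators, because all elements of the groups
  $G_{i,k}$ are taken as generators; so positive words suffice.\<close>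

lemma \<Gamma>_induct [consumes 1, case_names one mult]:
  assumes "x \<in> carrier \<Gamma>" "P \<one>\<^bsub>\<Gamma>\<^esub>"
    and step: "\<And>s y. s \<in> S \<Longrightarrow> y \<in> carrier \<Gamma> \<Longrightarrow> P y \<Longrightarrow> P (gen s \<otimes>\<^bsub>\<Gamma>\<^esub> y)"
  shows "P x"
proof -
  have "P (word_val \<Gamma> gen w)" if "w \<in> words S" for w
    using that
  proof (induction w)
    case (Cons x w)
    obtain s b where x: "x = (s, b)" by fastforce
    have "letter_val \<Gamma> gen x \<in> gen ` S"
      using Cons.prems x inv_gen inv_generator_closed by auto
    then show ?case using Cons step by (auto simp: word_val_gen)
  qed (simp add: assms)
  then show ?thesis using assms(1) by (auto simp: carrier_presented_group word_val_gen)
qed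

definition proj_gen :: "nat \<times> 'a + nat \<times> 'b \<Rightarrow> 'a \<times> 'b" where
  "proj_gen = case_sum (\<lambda>(k, g). (g, \<one>\<^bsub>G2\<^esub>)) (\<lambda>(k, h). (\<one>\<^bsub>G1\<^esub>, h))"

abbreviation "GG \<equiv> G1 \<times>\<times> G2"

lemma group_GG: "group GG"
  by (rule DirProd_group) unfold_locales

sublocale GG: group GG
  by (rule group_GG)

lemma proj_family: "bourdon_family GG proj_gen"
  by (auto simp: bourdon_family_def proj_gen_def hom_def)

definition proj where "proj = ext GG proj_gen"

lemma proj_hom: "proj \<in> hom \<Gamma> GG"
  unfolding proj_def by (rule ext_family_hom[OF group_GG proj_family])

lemma proj_gen_eq: "s \<in> S \<Longrightarrow> proj (gen s) = proj_gen s"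
  unfolding proj_def by (rule ext_family_gen[OF group_GG proj_family])

sublocale proj: group_hom \<Gamma> GG proj
  using proj_hom by unfold_locales

lemma fst_proj_hom: "(\<lambda>x. fst (proj x)) \<in> hom \<Gamma> G1"
  and snd_proj_hom: "(\<lambda>x. snd (proj x)) \<in> hom \<Gamma> G2"
  using proj_hom by (auto simp: hom_def Pi_iff mult_DirProd' mem_Times_iff)

text \<open>An endomorphism of \<Gamma>, so that the free product of the $G_{1,k}$ appears as a
  subgroup, its image, and no second group has to be constructed.\<close>

definition retr where
  "retr = ext \<Gamma> (case_sum (\<lambda>s. gen (Inl s)) (\<lambda>_. \<one>\<^bsub>\<Gamma>\<^esub>))"

lemma retr_family: "bourdon_family \<Gamma> (case_sum (\<lambda>s. gen (Inl s)) (\<lambda>_. \<one>\<^bsub>\<Gamma>\<^esub>))"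
  using gen_hom1 by (auto simp: bourdon_family_def hom_def)

lemma retr_hom: "retr \<in> hom \<Gamma> \<Gamma>"
  unfolding retr_def by (rule ext_family_hom[OF group_presented_group retr_family])

lemma retr_gen [simp]:
  "k < m \<Longrightarrow> g \<in> carrier G1 \<Longrightarrow> retr (gen (Inl (k, g))) = gen (Inl (k, g))"
  "k < m \<Longrightarrow> h \<in> carrier G2 \<Longrightarrow> retr (gen (Inr (k, h))) = \<one>\<^bsub>\<Gamma>\<^esub>"
  unfolding retr_def
  by (subst ext_family_gen[OF group_presented_group retr_family]; simp)+

sublocale retr: group_hom \<Gamma> \<Gamma> retr
  using retr_hom by unfold_locales

lemma proj_retr: "x \<in> carrier \<Gamma> \<Longrightarrow> proj (retr x) = (fst (proj x), \<one>\<^bsub>G2\<^esub>)"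
proof (induction x rule: \<Gamma>_induct)
  case one
  then show ?case by (simp add: one_DirProd)
next
  case (mult s y)
  have "proj y \<in> carrier G1 \<times> carrier G2"
    using proj.hom_closed[OF mult(2)] by (simp add: DirProd_def)
  then show ?case
    using mult proj_gen_eq[of s]
    by (cases s; cases "proj y") (auto simp: proj_gen_def)
qed

end

lemma Bij_closed: "f \<in> Bij Z \<Longrightarrow> z \<in> Z \<Longrightarrow> f z \<in> Z"
  by (auto simp: Bij_def bij_betw_def)

lemma BijGroup_hom_mult:
  assumes "f \<in> hom G (BijGroup Z)" "x \<in> carrier G" "y \<in> carrier G" "z \<in> Z"
  shows "f (x \<otimes>\<^bsub>G\<^esub> y) z = f x (f y z)"
proof -
  have "f x \<in> Bij Z" "f y \<in> Bij Z"
    using assms by (auto simp: hom_def BijGroup_def)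
  then show ?thesis
    using assms by (auto simp: hom_def BijGroup_def compose_def)
qed

lemma BijGroup_hom_one:
  assumes "group G" "f \<in> hom G (BijGroup Z)" "z \<in> Z"
  shows "f \<one>\<^bsub>G\<^esub> z = z"
proof -
  interpret group_hom G "BijGroup Z" f
    by (intro group_hom.intro group_hom_axioms.intro group_BijGroup assms)
  show ?thesis using assms hom_one by (auto simp: BijGroup_def)
qed

section \<open>The image of the retraction as a free product\<close>

context bourdon
begin

lemma p1_retr: "x \<in> carrier \<Gamma> \<Longrightarrow> fst (proj (retr x)) = fst (proj x)"
  by (simp add: proj_retr)

lemma retr_retr: "x \<in> carrier \<Gamma> \<Longrightarrow> retr (retr x) = retr x"
proof (induction x rule: \<Gamma>_induct)
  case (mult s y)
  then show ?case by (cases s) auto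
qed simp

lemma trivial_hom: "group H \<Longrightarrow> (\<lambda>_. \<one>\<^bsub>H\<^esub>) \<in> hom G H"
  by (simp add: hom_def group.is_monoid monoid.l_one)

text \<open>The generators from $G_{2,k}$ act by the identity, so the commutator relators hold
  trivially; what remains is van der Waerden's action of the $G_{1,k}$.\<close>

definition \<Psi>1 where
  "\<Psi>1 = ext (BijGroup {w. reduced G1 {..<m} w})
     (case_sum (\<lambda>(k, g). restrict (syl_mul G1 k g) {w. reduced G1 {..<m} w})
        (\<lambda>_. \<one>\<^bsub>BijGroup {w. reduced G1 {..<m} w}\<^esub>))"

lemma
  shows \<Psi>1_hom: "\<Psi>1 \<in> hom \<Gamma> (BijGroup {w. reduced G1 {..<m} w})"
    and \<Psi>1_gen1: "k < m \<Longrightarrow> g \<in> carrier G1 \<Longrightarrow> reduced G1 {..<m} w \<Longrightarrow>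
       \<Psi>1 (gen (Inl (k, g))) w = syl_mul G1 k g w"
    and \<Psi>1_gen2: "k < m \<Longrightarrow> h \<in> carrier G2 \<Longrightarrow> reduced G1 {..<m} w \<Longrightarrow>
       \<Psi>1 (gen (Inr (k, h))) w = w"
proof -
  let ?Z = "{w. reduced G1 {..<m} w}"
  let ?f = "case_sum (\<lambda>(k, g). restrict (syl_mul G1 k g) ?Z) (\<lambda>_. \<one>\<^bsub>BijGroup ?Z\<^esub>)"
  interpret B: group "BijGroup ?Z" by (rule group_BijGroup)
  have 1: "(\<lambda>g. restrict (syl_mul G1 k g) ?Z) \<in> hom G1 (BijGroup ?Z)" if "k < m" for k
    by (rule restrict_hom_BijGroup[OF G1.group_axioms])
      (use that in \<open>auto simp: G1.reduced_syl_mul G1.syl_mul_mult\<close>)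
  then have fam: "bourdon_family (BijGroup ?Z) ?f"
    using trivial_hom[OF B.group_axioms] by (auto simp: bourdon_family_def hom_def Pi_iff)
  show "\<Psi>1 \<in> hom \<Gamma> (BijGroup ?Z)"
    unfolding \<Psi>1_def by (rule ext_family_hom[OF B.group_axioms fam])
  show "k < m \<Longrightarrow> g \<in> carrier G1 \<Longrightarrow> reduced G1 {..<m} w \<Longrightarrow> \<Psi>1 (gen (Inl (k, g))) w = syl_mul G1 k g w"
    unfolding \<Psi>1_def by (subst ext_family_gen[OF B.group_axioms fam]) auto
  show "k < m \<Longrightarrow> h \<in> carrier G2 \<Longrightarrow> reduced G1 {..<m} w \<Longrightarrow> \<Psi>1 (gen (Inr (k, h))) w = w"
    unfolding \<Psi>1_def by (subst ext_family_gen[OF B.group_axioms fam]) (auto simp: BijGroup_def)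
qed

lemma \<Psi>1_closed: "x \<in> carrier \<Gamma> \<Longrightarrow> reduced G1 {..<m} w \<Longrightarrow> reduced G1 {..<m} (\<Psi>1 x w)"
  using \<Psi>1_hom Bij_closed[of "\<Psi>1 x" _ w] by (auto simp: hom_def BijGroup_def Pi_iff)

lemma \<Psi>1_mult: "x \<in> carrier \<Gamma> \<Longrightarrow> y \<in> carrier \<Gamma> \<Longrightarrow> reduced G1 {..<m} w \<Longrightarrow>
    \<Psi>1 (x \<otimes>\<^bsub>\<Gamma>\<^esub> y) w = \<Psi>1 x (\<Psi>1 y w)"
  by (rule BijGroup_hom_mult[OF \<Psi>1_hom]) auto

text \<open>The orbit of the empty word spells \<open>retr x\<close>, which makes
  \<open>\<lambda>x. \<Psi>1 x []\<close> a normal form on the image of \<open>retr\<close>.\<close>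

lemma syl_val_\<Psi>1:
  "x \<in> carrier \<Gamma> \<Longrightarrow> syl_val \<Gamma> (\<lambda>k g. gen (Inl (k, g))) (\<Psi>1 x []) = retr x"
proof (induction x rule: \<Gamma>_induct)
  case one
  then show ?case using BijGroup_hom_one[OF group_presented_group \<Psi>1_hom] by simp
next
  case (mult s y)
  have red: "reduced G1 {..<m} (\<Psi>1 y [])" using mult by (simp add: \<Psi>1_closed)
  show ?case
  proof (cases s)
    case (Inl kg)
    then obtain k g where s: "s = Inl (k, g)" "k < m" "g \<in> carrier G1"
      using mult by (cases kg) auto
    then have "\<Psi>1 (gen s \<otimes>\<^bsub>\<Gamma>\<^esub> y) [] = syl_mul G1 k g (\<Psi>1 y [])"
      using mult red by (simp add: \<Psi>1_mult \<Psi>1_gen1)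
    then show ?thesis
      using syl_val_syl_mul[OF G1.group_axioms group_presented_group gen_hom1 red] s mult by simp
  next
    case (Inr kh)
    then obtain k h where s: "s = Inr (k, h)" "k < m" "h \<in> carrier G2"
      using mult by (cases kh) auto
    then show ?thesis
      using mult red by (simp add: \<Psi>1_mult \<Psi>1_gen2)
  qed
qed

text \<open>The folding map of the free product is the first component of \<open>proj\<close>, which
  \<open>retr\<close> does not change.\<close>

lemma torsion_free_retr:
  assumes "x \<in> carrier \<Gamma>" "fst (proj x) = \<one>\<^bsub>G1\<^esub>" "x [^]\<^bsub>\<Gamma>\<^esub> (n::nat) = \<one>\<^bsub>\<Gamma>\<^esub>" "n > 0"
  shows "retr x = \<one>\<^bsub>\<Gamma>\<^esub>"
proof -
  interpret free_product_action \<Gamma> G1 "retr ` carrier \<Gamma>" "{..<m}" "\<lambda>k g. gen (Inl (k, g))"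
    "\<lambda>x. \<Psi>1 x []" "\<lambda>x. fst (proj x)"
  proof (intro free_product_action.intro free_product_action_axioms.intro)
    show "subgroup (retr ` carrier \<Gamma>) \<Gamma>" by (rule retr.img_is_subgroup)
    show "gen (Inl (k, g)) \<in> retr ` carrier \<Gamma>" if "k \<in> {..<m}" "g \<in> carrier G1" for k :: nat and g
      using that by (intro image_eqI[of _ _ "gen (Inl (k, g))"]) auto
    show "\<Psi>1 \<one>\<^bsub>\<Gamma>\<^esub> [] = []" using BijGroup_hom_one[OF group_presented_group \<Psi>1_hom] by simp
    show "syl_val \<Gamma> (\<lambda>k g. gen (Inl (k, g))) (\<Psi>1 x []) = x" if "x \<in> retr ` carrier \<Gamma>" for x
      using that by (auto simp: syl_val_\<Psi>1 retr_retr)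
  qed (auto simp: group_presented_group G1.group_axioms gen_hom1 fst_proj_hom \<Psi>1_closed \<Psi>1_mult \<Psi>1_gen1 proj_gen_eq proj_gen_def)
  have "retr x [^]\<^bsub>\<Gamma>\<^esub> n = \<one>\<^bsub>\<Gamma>\<^esub>"
    using assms by (simp flip: retr.hom_nat_pow)
  then show ?thesis
    using torsion_free_kernel[of "retr x" n] assms by (auto simp: p1_retr)
qed

section \<open>The kernel of the retraction as a free product of conjugates\<close>

definition conj_map :: "(nat \<times> 'a + nat \<times> 'b) word set \<Rightarrow> ('b \<Rightarrow> (nat \<times> 'a + nat \<times> 'b) word set) \<Rightarrow>
    'b \<Rightarrow> (nat \<times> 'a + nat \<times> 'b) word set" where
  "conj_map a \<psi> = (\<lambda>h\<in>carrier G2. a \<otimes>\<^bsub>\<Gamma>\<^esub> \<psi> h \<otimes>\<^bsub>\<Gamma>\<^esub> inv\<^bsub>\<Gamma>\<^esub> a)"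

text \<open>Restricted to the carrier, as is \<open>conj_map\<close>: these functions serve as
  indices of free factors, so embeddings that agree on \<open>carrier G2\<close> must be equal as
  functions.\<close>

definition factor2 where "factor2 k = (\<lambda>h\<in>carrier G2. gen (Inr (k, h)))"

text \<open>The kernel of \<open>retr\<close> is the free product of the conjugates of the groups $G_{2,k}$ by
  elements of the image of \<open>retr\<close>; a free factor is named by its embedding of \<open>G2\<close>.\<close>

definition conj_factors where
  "conj_factors = {conj_map (retr a) (factor2 k) | a k. a \<in> carrier \<Gamma> \<and> k < m}"

lemma conj_factors_hom:
  assumes "\<psi> \<in> conj_factors" shows "\<psi> \<in> hom G2 \<Gamma>"
proof -
  obtain a k where ak: "\<psi> = conj_map (retr a) (factor2 k)" "a \<in> carrier \<Gamma>" "k < m"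
    using assms by (auto simp: conj_factors_def)
  let ?a = "retr a"
  have *: "?a \<otimes>\<^bsub>\<Gamma>\<^esub> (x \<otimes>\<^bsub>\<Gamma>\<^esub> y) \<otimes>\<^bsub>\<Gamma>\<^esub> inv\<^bsub>\<Gamma>\<^esub> ?a =
      (?a \<otimes>\<^bsub>\<Gamma>\<^esub> x \<otimes>\<^bsub>\<Gamma>\<^esub> inv\<^bsub>\<Gamma>\<^esub> ?a) \<otimes>\<^bsub>\<Gamma>\<^esub> (?a \<otimes>\<^bsub>\<Gamma>\<^esub> y \<otimes>\<^bsub>\<Gamma>\<^esub> inv\<^bsub>\<Gamma>\<^esub> ?a)"
    if "x \<in> carrier \<Gamma>" "y \<in> carrier \<Gamma>" for x y
  proof -
    have "inv\<^bsub>\<Gamma>\<^esub> ?a \<otimes>\<^bsub>\<Gamma>\<^esub> (?a \<otimes>\<^bsub>\<Gamma>\<^esub> z) = z" if "z \<in> carrier \<Gamma>" for z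
      using ak that by (simp add: m_assoc[symmetric] del: retr.hom_inv)
    then show ?thesis using that ak by (simp add: m_assoc)
  qed
  have "gen (Inr (k, g \<otimes>\<^bsub>G2\<^esub> h)) = gen (Inr (k, g)) \<otimes>\<^bsub>\<Gamma>\<^esub> gen (Inr (k, h))"
    if "g \<in> carrier G2" "h \<in> carrier G2" for g h
    using gen_hom2[OF ak(3)] that by (simp add: hom_def)
  then show ?thesis
    using ak * by (auto simp: hom_def conj_map_def factor2_def)
qed

lemma conj_factors_closed:
  "\<psi> \<in> conj_factors \<Longrightarrow> h \<in> carrier G2 \<Longrightarrow> \<psi> h \<in> carrier \<Gamma>"
  "\<psi> \<in> conj_factors \<Longrightarrow> \<psi> \<in> extensional (carrier G2)"
  using conj_factors_hom by (auto simp: hom_def conj_factors_def conj_map_def)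

lemma conj_map_mult:
  assumes "a \<in> carrier \<Gamma>" "b \<in> carrier \<Gamma>" "\<psi> \<in> carrier G2 \<rightarrow> carrier \<Gamma>"
  shows "conj_map a (conj_map b \<psi>) = conj_map (a \<otimes>\<^bsub>\<Gamma>\<^esub> b) \<psi>"
proof -
  have "\<psi> h \<in> carrier \<Gamma>" if "h \<in> carrier G2" for h using that assms by auto
  then show ?thesis using assms(1,2)
    by (auto simp: conj_map_def fun_eq_iff m_assoc inv_mult_group)
qed

lemma factor2_closed: "k < m \<Longrightarrow> factor2 k \<in> carrier G2 \<rightarrow> carrier \<Gamma>"
  by (auto simp: factor2_def)

lemma conj_map_one:
  assumes "\<psi> \<in> carrier G2 \<rightarrow> carrier \<Gamma>" "\<psi> \<in> extensional (carrier G2)"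
  shows "conj_map \<one>\<^bsub>\<Gamma>\<^esub> \<psi> = \<psi>"
proof -
  have "\<psi> h \<in> carrier \<Gamma>" if "h \<in> carrier G2" for h using that assms by auto
  then show ?thesis using assms(2) by (auto simp: conj_map_def fun_eq_iff extensional_def)
qed

lemma conj_map_conj_factors:
  assumes "\<psi> \<in> conj_factors" "a \<in> retr ` carrier \<Gamma>"
  shows "conj_map a \<psi> \<in> conj_factors"
proof -
  obtain b k where bk: "\<psi> = conj_map (retr b) (factor2 k)" "b \<in> carrier \<Gamma>" "k < m"
    using assms by (auto simp: conj_factors_def)
  obtain c where c: "a = retr c" "c \<in> carrier \<Gamma>" using assms by auto
  have "conj_map a \<psi> = conj_map (retr (c \<otimes>\<^bsub>\<Gamma>\<^esub> b)) (factor2 k)"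
    using bk c by (simp add: conj_map_mult factor2_closed)
  then show ?thesis unfolding conj_factors_def using bk c by blast
qed

lemma factor2_conj_factors: "k < m \<Longrightarrow> factor2 k \<in> conj_factors"
  using conj_map_one[of "factor2 k"] factor2_closed[of k] one_closed retr.hom_one
  unfolding conj_factors_def by (auto simp: factor2_def intro!: exI[of _ "\<one>\<^bsub>\<Gamma>\<^esub>"] exI[of _ k])

lemma conj_factors_Pi: "\<psi> \<in> conj_factors \<Longrightarrow> \<psi> \<in> carrier G2 \<rightarrow> carrier \<Gamma>"
  using conj_factors_closed by auto

lemma conj_map_inverse:
  assumes "a \<in> carrier \<Gamma>" "\<psi> \<in> conj_factors"
  shows "conj_map a (conj_map (inv\<^bsub>\<Gamma>\<^esub> a) \<psi>) = \<psi>" "conj_map (inv\<^bsub>\<Gamma>\<^esub> a) (conj_map a \<psi>) = \<psi>"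
  using assms by (simp_all add: conj_map_mult conj_factors_Pi conj_map_one conj_factors_closed)

lemma inj_conj_map: "a \<in> carrier \<Gamma> \<Longrightarrow> inj_on (conj_map a) conj_factors"
  by (rule inj_on_inverseI[of _ "conj_map (inv\<^bsub>\<Gamma>\<^esub> a)"]) (simp add: conj_map_inverse)

abbreviation "red2 \<equiv> reduced G2 conj_factors"

abbreviation "cmap a \<equiv> map (apfst (conj_map a))"

lemma red2_cmap: "red2 w \<Longrightarrow> a \<in> retr ` carrier \<Gamma> \<Longrightarrow> red2 (cmap a w)"
  by (rule reduced_map[of _ conj_factors]) (auto simp: inj_conj_map conj_map_conj_factors)

lemma cmap_mult:
  "red2 w \<Longrightarrow> a \<in> carrier \<Gamma> \<Longrightarrow> b \<in> carrier \<Gamma> \<Longrightarrow> cmap a (cmap b w) = cmap (a \<otimes>\<^bsub>\<Gamma>\<^esub> b) w"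
  by (auto simp: reduced_def conj_map_mult conj_factors_Pi)

lemma cmap_one: "red2 w \<Longrightarrow> cmap \<one>\<^bsub>\<Gamma>\<^esub> w = w"
  by (auto simp: reduced_def conj_map_one conj_factors_Pi conj_factors_closed intro!: map_idI)

lemma cmap_syl_mul:
  "red2 w \<Longrightarrow> a \<in> carrier \<Gamma> \<Longrightarrow> \<psi> \<in> conj_factors \<Longrightarrow>
    cmap a (syl_mul G2 \<psi> h w) = syl_mul G2 (conj_map a \<psi>) h (cmap a w)"
  by (simp add: syl_mul_map[OF inj_conj_map])

text \<open>Here the commutation relations enter: conjugation by $G_{1,k}$ or $G_{1,k+1}$ leaves the
  embedding of $G_{2,k}$ unchanged, so different conjugating elements may name the same free
  factor.\<close>

lemma conj_map_commuting:
  assumes "a \<in> carrier \<Gamma>" "k < m"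
    "\<And>h. h \<in> carrier G2 \<Longrightarrow> a \<otimes>\<^bsub>\<Gamma>\<^esub> gen (Inr (k, h)) = gen (Inr (k, h)) \<otimes>\<^bsub>\<Gamma>\<^esub> a"
  shows "conj_map a (factor2 k) = factor2 k"
  using assms by (auto simp: conj_map_def factor2_def fun_eq_iff m_assoc)

lemma gen1_retr: "k < m \<Longrightarrow> g \<in> carrier G1 \<Longrightarrow> gen (Inl (k, g)) \<in> retr ` carrier \<Gamma>"
  by (rule image_eqI[of _ _ "gen (Inl (k, g))"]) auto

text \<open>\<Gamma> is the semidirect product of the kernel of \<open>retr\<close> and its image.
  On normal forms of the kernel, $G_{2,k}$ acts by multiplication and $G_{1,k}$ by conjugation,
  which only renames free factors.\<close>

definition \<Psi>2 where
  "\<Psi>2 = ext (BijGroup {w. red2 w})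
     (case_sum (\<lambda>(k, g). restrict (cmap (gen (Inl (k, g)))) {w. red2 w})
        (\<lambda>(k, h). restrict (syl_mul G2 (factor2 k) h) {w. red2 w}))"

lemma
  shows \<Psi>2_hom: "\<Psi>2 \<in> hom \<Gamma> (BijGroup {w. red2 w})"
    and \<Psi>2_gen1: "k < m \<Longrightarrow> g \<in> carrier G1 \<Longrightarrow> red2 w \<Longrightarrow>
       \<Psi>2 (gen (Inl (k, g))) w = cmap (gen (Inl (k, g))) w"
    and \<Psi>2_gen2: "k < m \<Longrightarrow> h \<in> carrier G2 \<Longrightarrow> red2 w \<Longrightarrow>
       \<Psi>2 (gen (Inr (k, h))) w = syl_mul G2 (factor2 k) h w"
proof -
  let ?Z = "{w. red2 w}"
  let ?f = "case_sum (\<lambda>(k, g). restrict (cmap (gen (Inl (k, g)))) ?Z)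
    (\<lambda>(k, h). restrict (syl_mul G2 (factor2 k) h) ?Z)"
  interpret B: group "BijGroup ?Z" by (rule group_BijGroup)
  have 1: "(\<lambda>g. restrict (cmap (gen (Inl (k, g)))) ?Z) \<in> hom G1 (BijGroup ?Z)" if k: "k < m" for k
  proof (rule restrict_hom_BijGroup[OF G1.group_axioms])
    interpret g1: group_hom G1 \<Gamma> "\<lambda>g. gen (Inl (k, g))"
      by (intro group_hom.intro group_hom_axioms.intro group_presented_group G1.group_axioms gen_hom1 k)
    show "cmap (gen (Inl (k, g))) z \<in> ?Z" if "g \<in> carrier G1" "z \<in> ?Z" for g z
      using that k by (simp add: red2_cmap gen1_retr)
    show "cmap (gen (Inl (k, \<one>\<^bsub>G1\<^esub>))) z = z" if "z \<in> ?Z" for z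
      using that cmap_one by simp
    show "cmap (gen (Inl (k, g))) (cmap (gen (Inl (k, h))) z) = cmap (gen (Inl (k, g \<otimes>\<^bsub>G1\<^esub> h))) z"
      if "g \<in> carrier G1" "h \<in> carrier G1" "z \<in> ?Z" for g h z
      using that k cmap_mult[of z "gen (Inl (k, g))" "gen (Inl (k, h))"] by simp
  qed
  have 2: "(\<lambda>h. restrict (syl_mul G2 (factor2 k) h) ?Z) \<in> hom G2 (BijGroup ?Z)" if "k < m" for k
    by (rule restrict_hom_BijGroup[OF G2.group_axioms])
      (use that factor2_conj_factors in \<open>auto simp: G2.reduced_syl_mul G2.syl_mul_mult\<close>)
  \<comment> \<open>The commutator relators hold for the action because conjugation by a
    neighbouring $G_{1,k'}$ fixes the name \<open>factor2 k\<close> of the new syllable, while the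
    other syllables are renamed alike on both sides.\<close>
  have c: "cmap (gen (Inl (k', g))) (syl_mul G2 (factor2 k) h w) =
      syl_mul G2 (factor2 k) h (cmap (gen (Inl (k', g))) w)"
    if "k < m" "k' = k \<or> k' = Suc k mod m" "g \<in> carrier G1" "h \<in> carrier G2" "red2 w" for k k' g h w
  proof -
    have "k' < m" using that by auto
    moreover have "conj_map (gen (Inl (k', g))) (factor2 k) = factor2 k"
      using that gen_commute[of k g] gen_commute'[of k g]
      by (intro conj_map_commuting) auto
    ultimately show ?thesis
      using that by (simp add: cmap_syl_mul factor2_conj_factors)
  qed
  have mult: "restrict \<alpha> ?Z \<otimes>\<^bsub>BijGroup ?Z\<^esub> restrict \<beta> ?Z = restrict \<beta> ?Z \<otimes>\<^bsub>BijGroup ?Z\<^esub> restrict \<alpha> ?Z"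
    if "restrict \<alpha> ?Z \<in> carrier (BijGroup ?Z)" "restrict \<beta> ?Z \<in> carrier (BijGroup ?Z)"
      "\<And>z. z \<in> ?Z \<Longrightarrow> \<alpha> (\<beta> z) = \<beta> (\<alpha> z)" for \<alpha> \<beta>
  proof -
    have "\<alpha> z \<in> ?Z" "\<beta> z \<in> ?Z" if "z \<in> ?Z" for z
      using Bij_closed[of "restrict \<alpha> ?Z" ?Z z] Bij_closed[of "restrict \<beta> ?Z" ?Z z]
        \<open>restrict \<alpha> ?Z \<in> _\<close> \<open>restrict \<beta> ?Z \<in> _\<close> that by (simp_all add: BijGroup_def)
    then show ?thesis
      using that by (auto simp: BijGroup_def compose_def fun_eq_iff)
  qed
  have fam: "bourdon_family (BijGroup ?Z) ?f"
    unfolding bourdon_family_def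
  proof (intro conjI allI impI ballI)
    fix k assume k: "k < m"
    show "(\<lambda>g. ?f (Inl (k, g))) \<in> hom G1 (BijGroup ?Z)" using 1[OF k] by simp
    show "(\<lambda>h. ?f (Inr (k, h))) \<in> hom G2 (BijGroup ?Z)" using 2[OF k] by simp
    fix g h assume gh: "g \<in> carrier G1" "h \<in> carrier G2"
    have cl: "restrict (cmap (gen (Inl (k', g)))) ?Z \<in> carrier (BijGroup ?Z)" if "k' < m" for k'
      using 1[OF that] gh by (auto simp: hom_def)
    have cl2: "restrict (syl_mul G2 (factor2 k) h) ?Z \<in> carrier (BijGroup ?Z)"
      using 2[OF k] gh by (auto simp: hom_def)
    show "?f (Inl (k, g)) \<otimes>\<^bsub>BijGroup ?Z\<^esub> ?f (Inr (k, h)) = ?f (Inr (k, h)) \<otimes>\<^bsub>BijGroup ?Z\<^esub> ?f (Inl (k, g))"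
      unfolding sum.case prod.case
      by (rule mult[OF cl[OF k] cl2]) (use c k gh in auto)
    show "?f (Inr (k, h)) \<otimes>\<^bsub>BijGroup ?Z\<^esub> ?f (Inl (Suc k mod m, g)) =
        ?f (Inl (Suc k mod m, g)) \<otimes>\<^bsub>BijGroup ?Z\<^esub> ?f (Inr (k, h))"
      unfolding sum.case prod.case
      by (rule mult[OF cl2 cl[OF Suc_mod_less]]) (use c k gh in auto)
  qed
  show "\<Psi>2 \<in> hom \<Gamma> (BijGroup ?Z)"
    unfolding \<Psi>2_def by (rule ext_family_hom[OF B.group_axioms fam])
  show "k < m \<Longrightarrow> g \<in> carrier G1 \<Longrightarrow> red2 w \<Longrightarrow> \<Psi>2 (gen (Inl (k, g))) w = cmap (gen (Inl (k, g))) w"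
    unfolding \<Psi>2_def by (subst ext_family_gen[OF B.group_axioms fam]) auto
  show "k < m \<Longrightarrow> h \<in> carrier G2 \<Longrightarrow> red2 w \<Longrightarrow> \<Psi>2 (gen (Inr (k, h))) w = syl_mul G2 (factor2 k) h w"
    unfolding \<Psi>2_def by (subst ext_family_gen[OF B.group_axioms fam]) auto
qed

lemma \<Psi>2_closed: "x \<in> carrier \<Gamma> \<Longrightarrow> red2 w \<Longrightarrow> red2 (\<Psi>2 x w)"
  using \<Psi>2_hom Bij_closed[of "\<Psi>2 x" _ w] by (auto simp: hom_def BijGroup_def Pi_iff)

lemma \<Psi>2_mult: "x \<in> carrier \<Gamma> \<Longrightarrow> y \<in> carrier \<Gamma> \<Longrightarrow> red2 w \<Longrightarrow>
    \<Psi>2 (x \<otimes>\<^bsub>\<Gamma>\<^esub> y) w = \<Psi>2 x (\<Psi>2 y w)"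
  by (rule BijGroup_hom_mult[OF \<Psi>2_hom]) auto

lemma \<Psi>2_one: "red2 w \<Longrightarrow> \<Psi>2 \<one>\<^bsub>\<Gamma>\<^esub> w = w"
  by (rule BijGroup_hom_one[OF group_presented_group \<Psi>2_hom]) auto

lemma \<Psi>2_retr: "x \<in> carrier \<Gamma> \<Longrightarrow> red2 w \<Longrightarrow> \<Psi>2 (retr x) w = cmap (retr x) w"
proof (induction x arbitrary: w rule: \<Gamma>_induct)
  case one
  then show ?case by (simp add: \<Psi>2_one cmap_one)
next
  case (mult s y)
  show ?case
  proof (cases s)
    case (Inl kg)
    then obtain k g where s: "s = Inl (k, g)" "k < m" "g \<in> carrier G1"
      using mult by (cases kg) auto
    have "red2 (cmap (retr y) w)" using mult by (intro red2_cmap) auto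
    then show ?thesis using mult s by (simp add: \<Psi>2_mult \<Psi>2_gen1 cmap_mult del: map_map)
  next
    case (Inr kh)
    then show ?thesis using mult by (cases kh) auto
  qed
qed

lemma syl_val_cmap:
  assumes "red2 w" "a \<in> carrier \<Gamma>"
  shows "syl_val \<Gamma> (\<lambda>\<psi>. \<psi>) (cmap a w) = a \<otimes>\<^bsub>\<Gamma>\<^esub> syl_val \<Gamma> (\<lambda>\<psi>. \<psi>) w \<otimes>\<^bsub>\<Gamma>\<^esub> inv\<^bsub>\<Gamma>\<^esub> a"
  using assms(1)
proof (induction w)
  case Nil
  then show ?case using assms by simp
next
  case (Cons x w)
  have x: "fst x \<in> conj_factors" "snd x \<in> carrier G2" "red2 w" using Cons.prems by (auto simp: reduced_Cons)
  have c: "fst x (snd x) \<in> carrier \<Gamma>" "syl_val \<Gamma> (\<lambda>\<psi>. \<psi>) w \<in> carrier \<Gamma>"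
    using x conj_factors_closed(1) syl_val_closed[OF group_presented_group conj_factors_Pi x(3), of "\<lambda>\<psi>. \<psi>"] by auto
  have "inv\<^bsub>\<Gamma>\<^esub> a \<otimes>\<^bsub>\<Gamma>\<^esub> (a \<otimes>\<^bsub>\<Gamma>\<^esub> z) = z" if "z \<in> carrier \<Gamma>" for z
    using assms that by (simp add: m_assoc[symmetric])
  then show ?case
    using Cons.IH x c assms by (simp add: conj_map_def m_assoc)
qed

text \<open>The semidirect factorisation of \<open>x\<close>: the orbit of the empty word spells the
  kernel part. A generator from $G_{1,k}$ passes through it by conjugation, one from $G_{2,k}$ is
  absorbed into it.\<close>

lemma syl_val_\<Psi>2:
  "x \<in> carrier \<Gamma> \<Longrightarrow> syl_val \<Gamma> (\<lambda>\<psi>. \<psi>) (\<Psi>2 x []) \<otimes>\<^bsub>\<Gamma>\<^esub> retr x = x"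
proof (induction x rule: \<Gamma>_induct)
  case one
  then show ?case by (simp add: \<Psi>2_one)
next
  case (mult s y)
  have red: "red2 (\<Psi>2 y [])" using mult by (simp add: \<Psi>2_closed)
  have c: "syl_val \<Gamma> (\<lambda>\<psi>. \<psi>) (\<Psi>2 y []) \<in> carrier \<Gamma>"
    by (rule syl_val_closed[OF group_presented_group conj_factors_Pi red])
  show ?case
  proof (cases s)
    case (Inl kg)
    then obtain k g where s: "s = Inl (k, g)" "k < m" "g \<in> carrier G1"
      using mult by (cases kg) auto
    let ?a = "gen s"
    have "syl_val \<Gamma> (\<lambda>\<psi>. \<psi>) (\<Psi>2 (?a \<otimes>\<^bsub>\<Gamma>\<^esub> y) []) =
        ?a \<otimes>\<^bsub>\<Gamma>\<^esub> syl_val \<Gamma> (\<lambda>\<psi>. \<psi>) (\<Psi>2 y []) \<otimes>\<^bsub>\<Gamma>\<^esub> inv\<^bsub>\<Gamma>\<^esub> ?a"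
      using mult red s by (simp add: \<Psi>2_mult \<Psi>2_gen1 syl_val_cmap)
    moreover have "retr (?a \<otimes>\<^bsub>\<Gamma>\<^esub> y) = ?a \<otimes>\<^bsub>\<Gamma>\<^esub> retr y" using s mult by simp
    moreover have "inv\<^bsub>\<Gamma>\<^esub> ?a \<otimes>\<^bsub>\<Gamma>\<^esub> (?a \<otimes>\<^bsub>\<Gamma>\<^esub> retr y) = retr y"
      using s mult by (simp add: m_assoc[symmetric])
    ultimately show ?thesis using mult s c by (simp add: m_assoc)
  next
    case (Inr kh)
    then obtain k h where s: "s = Inr (k, h)" "k < m" "h \<in> carrier G2"
      using mult by (cases kh) auto
    have "syl_val \<Gamma> (\<lambda>\<psi>. \<psi>) (syl_mul G2 (factor2 k) h (\<Psi>2 y [])) =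
        factor2 k h \<otimes>\<^bsub>\<Gamma>\<^esub> syl_val \<Gamma> (\<lambda>\<psi>. \<psi>) (\<Psi>2 y [])"
      by (rule syl_val_syl_mul[OF G2.group_axioms group_presented_group conj_factors_hom red])
        (use s factor2_conj_factors in auto)
    then show ?thesis using mult red s c by (simp add: \<Psi>2_mult \<Psi>2_gen2 factor2_def m_assoc)
  qed
qed

text \<open>The kernel of \<open>retr\<close> satisfies the axioms of
  \<open>free_product_action\<close>. The second component of \<open>proj\<close> is the folding
  map, because the conjugating elements lie in the image of \<open>retr\<close> and have trivial
  second component.\<close>

lemma torsion_free_kernel_retr:
  assumes "x \<in> carrier \<Gamma>" "retr x = \<one>\<^bsub>\<Gamma>\<^esub>" "snd (proj x) = \<one>\<^bsub>G2\<^esub>"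
    "x [^]\<^bsub>\<Gamma>\<^esub> (n::nat) = \<one>\<^bsub>\<Gamma>\<^esub>" "n > 0"
  shows "x = \<one>\<^bsub>\<Gamma>\<^esub>"
proof -
  have conj_factors_kernel: "\<psi> h \<in> kernel \<Gamma> \<Gamma> retr" "snd (proj (\<psi> h)) = h"
      "\<Psi>2 (\<psi> h \<otimes>\<^bsub>\<Gamma>\<^esub> x) [] = syl_mul G2 \<psi> h (\<Psi>2 x [])"
    if \<psi>: "\<psi> \<in> conj_factors" and h: "h \<in> carrier G2" and x: "x \<in> carrier \<Gamma>" for \<psi> h x
  proof -
    obtain b k where bk: "\<psi> = conj_map (retr b) (factor2 k)" "b \<in> carrier \<Gamma>" "k < m"
      using \<psi> by (auto simp: conj_factors_def)
    define a where "a = retr b"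
    have a: "a \<in> carrier \<Gamma>" "a \<in> retr ` carrier \<Gamma>" "retr a = a" "retr (inv\<^bsub>\<Gamma>\<^esub> a) = inv\<^bsub>\<Gamma>\<^esub> a"
      "inv\<^bsub>\<Gamma>\<^esub> a \<in> retr ` carrier \<Gamma>"
      using bk retr_retr by (auto simp: a_def simp flip: retr.hom_inv)
    have \<psi>h: "\<psi> h = a \<otimes>\<^bsub>\<Gamma>\<^esub> gen (Inr (k, h)) \<otimes>\<^bsub>\<Gamma>\<^esub> inv\<^bsub>\<Gamma>\<^esub> a"
      using bk h by (simp add: conj_map_def factor2_def a_def)
    show "\<psi> h \<in> kernel \<Gamma> \<Gamma> retr"
      using \<psi>h a h bk by (simp add: kernel_def)
    interpret p2: group_hom \<Gamma> G2 "\<lambda>x. snd (proj x)"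
      by (intro group_hom.intro group_hom_axioms.intro group_presented_group G2.group_axioms snd_proj_hom)
    have "snd (proj a) = \<one>\<^bsub>G2\<^esub>" using bk by (simp add: a_def proj_retr)
    then show "snd (proj (\<psi> h)) = h"
      using \<psi>h a h bk by (simp add: proj_gen_eq proj_gen_def del: proj.hom_mult proj.hom_inv)
    let ?w = "\<Psi>2 x []"
    have red: "red2 ?w" "red2 (cmap (inv\<^bsub>\<Gamma>\<^esub> a) ?w)" using x a by (simp_all add: \<Psi>2_closed red2_cmap)
    have "\<Psi>2 (inv\<^bsub>\<Gamma>\<^esub> a) ?w = cmap (inv\<^bsub>\<Gamma>\<^esub> a) ?w"
      using \<Psi>2_retr[of "inv\<^bsub>\<Gamma>\<^esub> a" ?w] a red by simp
    \<comment> \<open>With \<open>\<psi> h\<close> written as a conjugate by \<open>a\<close>, the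
      outer factors act by inverse renamings and the middle one multiplies. The renamings cancel on
      the old word and turn \<open>factor2 k\<close> into \<open>\<psi>\<close>.\<close>
    then have "\<Psi>2 (\<psi> h \<otimes>\<^bsub>\<Gamma>\<^esub> x) [] = \<Psi>2 a (syl_mul G2 (factor2 k) h (cmap (inv\<^bsub>\<Gamma>\<^esub> a) ?w))"
      using \<psi>h a h x bk red by (simp add: m_assoc \<Psi>2_mult \<Psi>2_closed \<Psi>2_gen2)
    also have "red2 (syl_mul G2 (factor2 k) h (cmap (inv\<^bsub>\<Gamma>\<^esub> a) ?w))"
      using red h bk by (simp add: G2.reduced_syl_mul factor2_conj_factors)
    then have "\<Psi>2 a (syl_mul G2 (factor2 k) h (cmap (inv\<^bsub>\<Gamma>\<^esub> a) ?w)) =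
        cmap a (syl_mul G2 (factor2 k) h (cmap (inv\<^bsub>\<Gamma>\<^esub> a) ?w))"
      using \<Psi>2_retr[of a] a by simp
    also have "\<dots> = syl_mul G2 \<psi> h (cmap a (cmap (inv\<^bsub>\<Gamma>\<^esub> a) ?w))"
      using cmap_syl_mul[OF red(2) a(1) factor2_conj_factors[OF bk(3)], of h] bk by (simp add: a_def)
    also have "cmap a (cmap (inv\<^bsub>\<Gamma>\<^esub> a) ?w) = ?w"
      using cmap_mult[OF red(1), of a "inv\<^bsub>\<Gamma>\<^esub> a"] a cmap_one[OF red(1)] by simp
    finally show "\<Psi>2 (\<psi> h \<otimes>\<^bsub>\<Gamma>\<^esub> x) [] = syl_mul G2 \<psi> h ?w" .
  qed
  have "free_product_action \<Gamma> G2 (kernel \<Gamma> \<Gamma> retr) conj_factors (\<lambda>\<psi>. \<psi>)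
    (\<lambda>x. \<Psi>2 x []) (\<lambda>x. snd (proj x))"
  proof (intro free_product_action.intro free_product_action_axioms.intro)
    show "subgroup (kernel \<Gamma> \<Gamma> retr) \<Gamma>" by (rule retr.subgroup_kernel)
    show "\<psi> h \<in> kernel \<Gamma> \<Gamma> retr" "snd (proj (\<psi> h)) = h" if "\<psi> \<in> conj_factors" "h \<in> carrier G2" for \<psi> h
      using conj_factors_kernel[OF that one_closed] by auto
    show "\<Psi>2 (\<psi> h \<otimes>\<^bsub>\<Gamma>\<^esub> x) [] = syl_mul G2 \<psi> h (\<Psi>2 x [])"
      if "\<psi> \<in> conj_factors" "h \<in> carrier G2" "x \<in> kernel \<Gamma> \<Gamma> retr" for \<psi> h x
      by (rule conj_factors_kernel(3)) (use that in \<open>auto simp: kernel_def\<close>)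
    show "syl_val \<Gamma> (\<lambda>\<psi>. \<psi>) (\<Psi>2 x []) = x" if "x \<in> kernel \<Gamma> \<Gamma> retr" for x
    proof -
      have x: "x \<in> carrier \<Gamma>" "retr x = \<one>\<^bsub>\<Gamma>\<^esub>" using that by (auto simp: kernel_def)
      then have "syl_val \<Gamma> (\<lambda>\<psi>. \<psi>) (\<Psi>2 x []) \<in> carrier \<Gamma>"
        by (intro syl_val_closed[OF group_presented_group conj_factors_Pi \<Psi>2_closed]) auto
      then show ?thesis using syl_val_\<Psi>2[of x] x by simp
    qed
    show "red2 (\<Psi>2 x [])" if "x \<in> kernel \<Gamma> \<Gamma> retr" for x
      using that by (simp add: kernel_def \<Psi>2_closed)
    show "\<Psi>2 \<one>\<^bsub>\<Gamma>\<^esub> [] = []" by (rule \<Psi>2_one) simp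
  qed (simp_all add: group_presented_group G2.group_axioms conj_factors_hom snd_proj_hom)
  then show ?thesis
    by (rule free_product_action.torsion_free_kernel[of _ _ _ _ _ _ _ x n]) (use assms in \<open>simp_all add: kernel_def\<close>)
qed

theorem torsion_free_kernel_proj: "torsion_free_in \<Gamma> (kernel \<Gamma> GG proj)"
  unfolding torsion_free_in_def
proof (intro ballI allI impI)
  fix x and n :: nat
  assume "x \<in> kernel \<Gamma> GG proj" "n > 0" "x [^]\<^bsub>\<Gamma>\<^esub> n = \<one>\<^bsub>\<Gamma>\<^esub>"
  then show "x = \<one>\<^bsub>\<Gamma>\<^esub>"
    using torsion_free_kernel_retr[of x n] torsion_free_retr[of x n] by (auto simp: kernel_def one_DirProd)
qed

end

section \<open>Holonomy of locally constant cocycles\<close>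

text \<open>The cocycle \<open>b e x \<otimes> inv (b f x)\<close> is locally constant on the intersection of two sets of the
  cover, although \<open>b\<close> is not. A section along a map \<open>F\<close> plays the part of a lift of \<open>F\<close> to the
  covering space with this cocycle.\<close>

locale holonomy = group G
  for G :: "('g, 'm) monoid_scheme" (structure) +
  fixes M :: "'a::topological_space set" and E :: "'i set" and Q :: "'i \<Rightarrow> 'a set" and b :: "'i \<Rightarrow> 'a \<Rightarrow> 'g"
  assumes open_Q: "e \<in> E \<Longrightarrow> open (Q e)"
    and cover: "x \<in> M \<Longrightarrow> \<exists>e\<in>E. x \<in> Q e"
    and b_closed [simp]: "e \<in> E \<Longrightarrow> x \<in> M \<Longrightarrow> b e x \<in> carrier G"
    and cocycle: "\<lbrakk>e \<in> E; f \<in> E; x \<in> M; x \<in> Q e; x \<in> Q f\<rbrakk> \<Longrightarrow>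
      \<exists>V. open V \<and> x \<in> V \<and> (\<forall>y\<in>V \<inter> M. b e y \<otimes> inv (b f y) = b e x \<otimes> inv (b f x))"
begin

definition parallel :: "'z::topological_space set \<Rightarrow> ('z \<Rightarrow> 'a) \<Rightarrow> ('z \<Rightarrow> 'g) \<Rightarrow> bool" where
  "parallel Z F s \<longleftrightarrow> continuous_on Z F \<and> F ` Z \<subseteq> M \<and> (\<forall>z\<in>Z. s z \<in> carrier G) \<and>
     (\<forall>z\<in>Z. \<exists>e\<in>E. F z \<in> Q e \<and>
       (\<exists>V. open V \<and> z \<in> V \<and> (\<forall>y\<in>V \<inter> Z. s y \<otimes> inv (b e (F y)) = s z \<otimes> inv (b e (F z)))))"

lemma parallel_closed: "parallel Z F s \<Longrightarrow> z \<in> Z \<Longrightarrow> s z \<in> carrier G"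
  by (simp add: parallel_def)

lemma parallel_in: "parallel Z F s \<Longrightarrow> z \<in> Z \<Longrightarrow> F z \<in> M"
  by (auto simp: parallel_def)

text \<open>A change of chart multiplies on the right by
  \<open>b e (F y) \<otimes> inv (b f (F y))\<close>, which is constant for \<open>F y\<close> near
  \<open>F z\<close> by the cocycle condition.\<close>

lemma parallel_any_chart:
  assumes s: "parallel Z F s" and z: "z \<in> Z" and f: "f \<in> E" "F z \<in> Q f"
  shows "\<exists>V. open V \<and> z \<in> V \<and> (\<forall>y\<in>V \<inter> Z. s y \<otimes> inv (b f (F y)) = s z \<otimes> inv (b f (F z)))"
proof -
  obtain e V where e: "e \<in> E" "F z \<in> Q e" and V: "open V" "z \<in> V"
      "\<And>y. y \<in> V \<Longrightarrow> y \<in> Z \<Longrightarrow> s y \<otimes> inv (b e (F y)) = s z \<otimes> inv (b e (F z))"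
    using s z unfolding parallel_def by (metis IntI)
  obtain W where W: "open W" "F z \<in> W"
      "\<And>y. y \<in> W \<Longrightarrow> y \<in> M \<Longrightarrow> b e y \<otimes> inv (b f y) = b e (F z) \<otimes> inv (b f (F z))"
    using cocycle[OF e(1) f(1) parallel_in[OF s z] e(2) f(2)] by auto
  obtain W' where W': "open W'" "z \<in> W'" "\<And>y. y \<in> Z \<Longrightarrow> y \<in> W' \<Longrightarrow> F y \<in> W"
    using s z W unfolding parallel_def continuous_on_topological by metis
  have split: "s y \<otimes> inv (b f (F y)) = (s y \<otimes> inv (b e (F y))) \<otimes> (b e (F y) \<otimes> inv (b f (F y)))"
    if "y \<in> Z" for y
  proof -
    have "inv (b e (F y)) \<otimes> (b e (F y) \<otimes> inv (b f (F y))) = inv (b f (F y))"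
      using parallel_in[OF s that] e f by (simp add: m_assoc[symmetric])
    then show ?thesis
      using parallel_closed[OF s that] parallel_in[OF s that] e f by (simp add: m_assoc)
  qed
  have "s y \<otimes> inv (b f (F y)) = s z \<otimes> inv (b f (F z))" if "y \<in> V \<inter> W'" "y \<in> Z" for y
    using that V(3) W(3)[of "F y"] W'(3) parallel_in[OF s] unfolding split[OF that(2)] split[OF z] by simp
  then show ?thesis
    using V W' by (intro exI[of _ "V \<inter> W'"]) auto
qed

lemma parallelE:
  assumes "parallel Z F s" "z \<in> Z"
  obtains e V where "e \<in> E" "F z \<in> Q e" "open V" "z \<in> V"
    "\<And>y. y \<in> V \<Longrightarrow> y \<in> Z \<Longrightarrow> s y \<otimes> inv (b e (F y)) = s z \<otimes> inv (b e (F z))"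
  using assms unfolding parallel_def by (metis IntI)

lemma parallel_subset:
  assumes s: "parallel Z F s" and Z': "Z' \<subseteq> Z"
  shows "parallel Z' F s"
  unfolding parallel_def
proof (intro conjI ballI)
  show "continuous_on Z' F" using s Z' continuous_on_subset unfolding parallel_def by blast
  show "F ` Z' \<subseteq> M" using parallel_in[OF s] Z' by blast
  fix z assume z: "z \<in> Z'"
  then show "s z \<in> carrier G" using parallel_closed[OF s] Z' by blast
  obtain e V where "e \<in> E" "F z \<in> Q e" "open V" "z \<in> V"
      "\<And>y. y \<in> V \<Longrightarrow> y \<in> Z \<Longrightarrow> s y \<otimes> inv (b e (F y)) = s z \<otimes> inv (b e (F z))"
    using parallelE[OF s] z Z' by blast
  then show "\<exists>e\<in>E. F z \<in> Q e \<and> (\<exists>V. open V \<and> z \<in> V \<and>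
      (\<forall>y\<in>V \<inter> Z'. s y \<otimes> inv (b e (F y)) = s z \<otimes> inv (b e (F z))))"
    using Z' by (intro bexI[of _ e] conjI exI[of _ V]) auto
qed

lemma parallel_cong:
  assumes "parallel Z F s" "\<And>z. z \<in> Z \<Longrightarrow> F z = F' z"
  shows "parallel Z F' s"
proof -
  have "continuous_on Z F'" using assms continuous_on_cong unfolding parallel_def by metis
  then show ?thesis using assms unfolding parallel_def by (auto simp: image_subset_iff)
qed

lemma parallel_compose:
  assumes s: "parallel Z F s" and \<phi>: "continuous_on Z' \<phi>" "\<phi> ` Z' \<subseteq> Z"
  shows "parallel Z' (F \<circ> \<phi>) (s \<circ> \<phi>)"
  unfolding parallel_def
proof (intro conjI ballI)
  show "continuous_on Z' (F \<circ> \<phi>)"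
    using s \<phi> unfolding parallel_def by (blast intro: continuous_on_compose continuous_on_subset)
  show "(F \<circ> \<phi>) ` Z' \<subseteq> M"
    using parallel_in[OF s] \<phi> by auto
  fix z assume z: "z \<in> Z'"
  then have \<phi>z: "\<phi> z \<in> Z" using \<phi> by auto
  then show "(s \<circ> \<phi>) z \<in> carrier G" using parallel_closed[OF s] by simp
  obtain e V where e: "e \<in> E" "F (\<phi> z) \<in> Q e" and V: "open V" "\<phi> z \<in> V"
      "\<And>y. y \<in> V \<Longrightarrow> y \<in> Z \<Longrightarrow> s y \<otimes> inv (b e (F y)) = s (\<phi> z) \<otimes> inv (b e (F (\<phi> z)))"
    using s \<phi>z unfolding parallel_def by (metis IntI)
  obtain W where "open W" "z \<in> W" "\<And>y. y \<in> Z' \<Longrightarrow> y \<in> W \<Longrightarrow> \<phi> y \<in> V"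
    using \<phi>(1) V z unfolding continuous_on_topological by metis
  then show "\<exists>e\<in>E. (F \<circ> \<phi>) z \<in> Q e \<and> (\<exists>V. open V \<and> z \<in> V \<and> (\<forall>y\<in>V \<inter> Z'.
      (s \<circ> \<phi>) y \<otimes> inv (b e ((F \<circ> \<phi>) y)) = (s \<circ> \<phi>) z \<otimes> inv (b e ((F \<circ> \<phi>) z))))"
    using e V(3) \<phi> by (intro bexI[of _ e] conjI exI[of _ W]) auto
qed

lemma parallel_left_mult:
  assumes s: "parallel Z F s" and k: "k \<in> carrier G"
  shows "parallel Z F (\<lambda>z. k \<otimes> s z)"
proof -
  have *: "k \<otimes> s y \<otimes> inv (b e (F y)) = k \<otimes> (s y \<otimes> inv (b e (F y)))" if "y \<in> Z" "e \<in> E" for y e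
    using parallel_closed[OF s] parallel_in[OF s] k that by (simp add: m_assoc)
  show ?thesis
    unfolding parallel_def
  proof (intro conjI ballI)
    show "continuous_on Z F" "F ` Z \<subseteq> M" using s by (auto simp: parallel_def)
    fix z assume z: "z \<in> Z"
    show "k \<otimes> s z \<in> carrier G" using parallel_closed[OF s z] k by simp
    obtain e V where e: "e \<in> E" "F z \<in> Q e" and V: "open V" "z \<in> V"
        "\<And>y. y \<in> V \<Longrightarrow> y \<in> Z \<Longrightarrow> s y \<otimes> inv (b e (F y)) = s z \<otimes> inv (b e (F z))"
      using s z unfolding parallel_def by (metis IntI)
    have "k \<otimes> s y \<otimes> inv (b e (F y)) = k \<otimes> s z \<otimes> inv (b e (F z))" if "y \<in> V" "y \<in> Z" for y
      unfolding *[OF that(2) e(1)] *[OF z e(1)] V(3)[OF that] ..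
    then show "\<exists>e\<in>E. F z \<in> Q e \<and> (\<exists>V. open V \<and> z \<in> V \<and> (\<forall>y\<in>V \<inter> Z.
        k \<otimes> s y \<otimes> inv (b e (F y)) = k \<otimes> s z \<otimes> inv (b e (F z))))"
      using e V by (intro bexI[of _ e] conjI exI[of _ V]) simp_all
  qed
qed

text \<open>In a common chart the factors \<open>inv (b e (F y))\<close> cancel from the quotient of
  the two sections, which is therefore locally constant.\<close>

lemma parallel_unique:
  assumes s: "parallel Z F s" and s': "parallel Z F s'" and Z: "connected Z" "z \<in> Z" "w \<in> Z"
  shows "s z \<otimes> inv (s' z) = s w \<otimes> inv (s' w)"
proof (rule connected_local_const[OF Z, of "\<lambda>z. s z \<otimes> inv (s' z)"], rule ballI)
  fix z assume z: "z \<in> Z"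
  obtain e V where e: "e \<in> E" "F z \<in> Q e" and V: "open V" "z \<in> V"
      "\<And>y. y \<in> V \<Longrightarrow> y \<in> Z \<Longrightarrow> s y \<otimes> inv (b e (F y)) = s z \<otimes> inv (b e (F z))"
    using s z unfolding parallel_def by (metis IntI)
  obtain V' where V': "open V'" "z \<in> V'"
      "\<And>y. y \<in> V' \<Longrightarrow> y \<in> Z \<Longrightarrow> s' y \<otimes> inv (b e (F y)) = s' z \<otimes> inv (b e (F z))"
    using parallel_any_chart[OF s' z e] by auto
  have *: "s y \<otimes> inv (s' y) = (s y \<otimes> inv (b e (F y))) \<otimes> inv (s' y \<otimes> inv (b e (F y)))" if "y \<in> Z" for y
  proof -
    have "inv (b e (F y)) \<otimes> (b e (F y) \<otimes> inv (s' y)) = inv (s' y)"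
      using parallel_in[OF s that] parallel_closed[OF s' that] e by (simp add: m_assoc[symmetric])
    then show ?thesis
      using parallel_closed[OF s that] parallel_closed[OF s' that] parallel_in[OF s that] e
      by (simp add: m_assoc inv_mult_group)
  qed
  have "s z \<otimes> inv (s' z) = s y \<otimes> inv (s' y)" if "y \<in> V \<inter> V'" "y \<in> Z" for y
    using V(3)[of y] V'(3)[of y] that unfolding *[OF that(2)] *[OF z] by simp
  then show "\<forall>\<^sub>F y in at z within Z. s z \<otimes> inv (s' z) = s y \<otimes> inv (s' y)"
    unfolding eventually_at_topological using V V' by (intro exI[of _ "V \<inter> V'"]) auto
qed

lemma parallel_chart:
  assumes "e \<in> E" "continuous_on Z F" "F ` Z \<subseteq> M \<inter> Q e"
  shows "parallel Z F (\<lambda>z. b e (F z))"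
  unfolding parallel_def
proof (intro conjI ballI)
  fix z assume "z \<in> Z"
  then show "\<exists>f\<in>E. F z \<in> Q f \<and> (\<exists>V. open V \<and> z \<in> V \<and> (\<forall>y\<in>V \<inter> Z.
      b e (F y) \<otimes> inv (b f (F y)) = b e (F z) \<otimes> inv (b f (F z))))"
    using assms by (intro bexI[of _ e] conjI exI[of _ UNIV]) (auto simp: image_subset_iff)
qed (use assms in auto)

text \<open>On the connected overlap the sections differ by a constant left factor, and left
  multiplication preserves parallel sections; after this correction they can be pasted.\<close>

lemma parallel_Un:
  assumes AB: "closed A" "closed B" "connected (A \<inter> B)"
    and s: "parallel A F s" and s': "parallel B F s'"
  shows "\<exists>s. parallel (A \<union> B) F s"
proof -
  obtain t where t: "parallel B F t" "\<And>z. z \<in> A \<inter> B \<Longrightarrow> t z = s z"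
  proof (cases "A \<inter> B = {}")
    case True
    then show ?thesis using that s' by blast
  next
    case False
    then obtain w where w: "w \<in> A" "w \<in> B" by auto
    let ?k = "s w \<otimes> inv (s' w)"
    have "?k \<otimes> s' z = s z" if "z \<in> A" "z \<in> B" for z
    proof -
      have "s w \<otimes> inv (s' w) = s z \<otimes> inv (s' z)"
        by (rule parallel_unique[OF _ _ AB(3), of F])
          (use s s' w that in \<open>auto intro: parallel_subset\<close>)
      then show ?thesis
        using parallel_closed[OF s] parallel_closed[OF s'] that by (simp add: m_assoc)
    qed
    moreover have "parallel B F (\<lambda>z. ?k \<otimes> s' z)"
      using parallel_closed[OF s] parallel_closed[OF s'] w by (intro parallel_left_mult s') simp
    ultimately show ?thesis using that by auto
  qed
  define u where "u z = (if z \<in> A then s z else t z)" for z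
  have uA: "u z = s z" if "z \<in> A" for z using that by (simp add: u_def)
  have uB: "u z = t z" if "z \<in> B" for z using that t(2) by (simp add: u_def)
  have "parallel (A \<union> B) F u"
    unfolding parallel_def
  proof (intro conjI ballI)
    show "continuous_on (A \<union> B) F"
      using s s' AB by (auto simp: parallel_def intro: continuous_on_closed_Un)
    show "F ` (A \<union> B) \<subseteq> M" using s s' by (auto simp: parallel_def)
    fix z assume z: "z \<in> A \<union> B"
    then show "u z \<in> carrier G"
      using uA uB parallel_closed[OF s] parallel_closed[OF t(1)] by auto
    obtain e where e: "e \<in> E" "F z \<in> Q e"
      using z cover parallel_in[OF s] parallel_in[OF s'] by (metis UnE)
    \<comment> \<open>Each piece is treated separately: a point outside a closed piece has a
      neighbourhood that misses it, where nothing has to be checked.\<close>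
    have nbhd: "\<exists>V. open V \<and> z \<in> V \<and> (\<forall>y\<in>V \<inter> C. u y \<otimes> inv (b e (F y)) = u z \<otimes> inv (b e (F z)))"
      if C: "closed C" "parallel C F r" "\<And>y. y \<in> C \<Longrightarrow> u y = r y" for C r
    proof (cases "z \<in> C")
      case True
      then show ?thesis using parallel_any_chart[OF C(2) True e] C(3) by auto
    next
      case False
      then show ?thesis using C(1) by (intro exI[of _ "- C"]) auto
    qed
    obtain V where V: "open V" "z \<in> V" "\<And>y. y \<in> V \<Longrightarrow> y \<in> A \<Longrightarrow> u y \<otimes> inv (b e (F y)) = u z \<otimes> inv (b e (F z))"
      using nbhd[OF AB(1) s uA] by auto
    obtain W where W: "open W" "z \<in> W" "\<And>y. y \<in> W \<Longrightarrow> y \<in> B \<Longrightarrow> u y \<otimes> inv (b e (F y)) = u z \<otimes> inv (b e (F z))"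
      using nbhd[OF AB(2) t(1) uB] by auto
    show "\<exists>e\<in>E. F z \<in> Q e \<and> (\<exists>V. open V \<and> z \<in> V \<and>
        (\<forall>y\<in>V \<inter> (A \<union> B). u y \<otimes> inv (b e (F y)) = u z \<otimes> inv (b e (F z))))"
      using e V W by (intro bexI[of _ e] conjI exI[of _ "V \<inter> W"]) auto
  qed
  then show ?thesis by blast
qed

lemma parallel_local:
  assumes "continuous_on Z F" "F ` Z \<subseteq> M" "z \<in> Z"
  shows "\<exists>V. open V \<and> z \<in> V \<and> (\<exists>s. parallel (V \<inter> Z) F s)"
proof -
  obtain e where e: "e \<in> E" "F z \<in> Q e" using cover assms by blast
  then obtain V where V: "open V" "z \<in> V" "\<And>y. y \<in> Z \<Longrightarrow> y \<in> V \<Longrightarrow> F y \<in> Q e"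
    using assms open_Q unfolding continuous_on_topological by metis
  have "parallel (V \<inter> Z) F (\<lambda>z. b e (F z))"
    by (rule parallel_chart[OF e(1)]) (use assms V in \<open>auto intro: continuous_on_subset\<close>)
  then show ?thesis using V by blast
qed

text \<open>Bisection in the second coordinate gives sections over thin strips, bisection in the
  first joins the strips. Adjacent closed pieces meet in a convex set, so \<open>parallel_Un\<close>
  applies.\<close>

lemma parallel_square:
  fixes F :: "real \<times> real \<Rightarrow> 'a"
  assumes F: "continuous_on ({0..1} \<times> {0..1}) F" "F ` ({0..1} \<times> {0..1}) \<subseteq> M"
  shows "\<exists>s. parallel ({0..1} \<times> {0..1}) F s"
proof -
  let ?I = "{0..1} :: real set"
  have strip: "\<exists>\<delta>>0. \<exists>s. parallel (({x - \<delta>..x + \<delta>} \<inter> ?I) \<times> ({0..1} \<inter> ?I)) F s" if x: "x \<in> ?I" for x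
    using zero_le_one
  proof (induction rule: Bolzano[where P = "\<lambda>c d. \<exists>\<delta>>0. \<exists>s. parallel (({x - \<delta>..x + \<delta>} \<inter> ?I) \<times> ({c..d} \<inter> ?I)) F s"])
    case (trans a c d)
    then obtain \<delta>1 \<delta>2 s1 s2 where *: "\<delta>1 > 0" "\<delta>2 > 0"
        "parallel (({x - \<delta>1..x + \<delta>1} \<inter> ?I) \<times> ({a..c} \<inter> ?I)) F s1"
        "parallel (({x - \<delta>2..x + \<delta>2} \<inter> ?I) \<times> ({c..d} \<inter> ?I)) F s2" by blast
    define \<delta> where "\<delta> = min \<delta>1 \<delta>2"
    let ?J = "{x - \<delta>..x + \<delta>} \<inter> ?I"
    have "parallel (?J \<times> ({a..c} \<inter> ?I)) F s1" "parallel (?J \<times> ({c..d} \<inter> ?I)) F s2"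
      by (rule parallel_subset[OF *(3)] parallel_subset[OF *(4)]; auto simp: \<delta>_def)+
    moreover have "(?J \<times> ({a..c} \<inter> ?I)) \<inter> (?J \<times> ({c..d} \<inter> ?I)) = ?J \<times> ({c} \<inter> ?I)"
      using trans by auto
    then have "connected ((?J \<times> ({a..c} \<inter> ?I)) \<inter> (?J \<times> ({c..d} \<inter> ?I)))"
      by (simp only:) (intro convex_connected convex_Times convex_Int convex_closed_interval convex_singleton)
    moreover have "closed (?J \<times> ({a..c} \<inter> ?I))" "closed (?J \<times> ({c..d} \<inter> ?I))"
      by (intro closed_Times closed_Int closed_atLeastAtMost)+
    ultimately have "\<exists>s. parallel (?J \<times> ({a..c} \<inter> ?I) \<union> ?J \<times> ({c..d} \<inter> ?I)) F s"
      by (metis parallel_Un)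
    moreover have "?J \<times> ({a..c} \<inter> ?I) \<union> ?J \<times> ({c..d} \<inter> ?I) = ?J \<times> ({a..d} \<inter> ?I)"
      using trans by auto
    ultimately show ?case using *(1,2) by (intro exI[of _ \<delta>]) (auto simp: \<delta>_def)
  next
    case (local t)
    then have "(x, t) \<in> ?I \<times> ?I" using x by auto
    then obtain V s where V: "open V" "(x, t) \<in> V" "parallel (V \<inter> ?I \<times> ?I) F s"
      using parallel_local[OF F] by blast
    obtain A B where AB: "open A" "open B" "x \<in> A" "t \<in> B" "A \<times> B \<subseteq> V"
      using open_prod_elim[OF V(1,2)] by (metis mem_Sigma_iff)
    obtain \<delta> where \<delta>: "\<delta> > 0" "cball x \<delta> \<subseteq> A" using AB open_contains_cball by blast
    obtain \<epsilon> where \<epsilon>: "\<epsilon> > 0" "ball t \<epsilon> \<subseteq> B" using AB open_contains_ball by blast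
    have "parallel (({x - \<delta>..x + \<delta>} \<inter> ?I) \<times> ({c..d} \<inter> ?I)) F s" if "c \<le> t" "t \<le> d" "d - c < \<epsilon>" for c d
    proof (rule parallel_subset[OF V(3)])
      have "{x - \<delta>..x + \<delta>} \<subseteq> A" using \<delta> by (simp add: cball_eq_atLeastAtMost)
      moreover have "{c..d} \<subseteq> B" using \<epsilon> that by (auto simp: dist_real_def subset_iff)
      ultimately show "({x - \<delta>..x + \<delta>} \<inter> ?I) \<times> ({c..d} \<inter> ?I) \<subseteq> V \<inter> ?I \<times> ?I" using AB(5) by blast
    qed
    then show ?case using \<delta>(1) \<epsilon>(1) by blast
  qed
  have "\<exists>s. parallel (({0..1} \<inter> ?I) \<times> ?I) F s"
    using zero_le_one
  proof (induction rule: Bolzano[where P = "\<lambda>c d. \<exists>s. parallel (({c..d} \<inter> ?I) \<times> ?I) F s"])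
    case (trans a c d)
    have "(({a..c} \<inter> ?I) \<times> ?I) \<inter> (({c..d} \<inter> ?I) \<times> ?I) = ({c} \<inter> ?I) \<times> ?I"
      using trans by auto
    then have "connected ((({a..c} \<inter> ?I) \<times> ?I) \<inter> (({c..d} \<inter> ?I) \<times> ?I))"
      by (simp only:) (intro convex_connected convex_Times convex_Int convex_closed_interval convex_singleton)
    moreover have "closed (({a..c} \<inter> ?I) \<times> ?I)" "closed (({c..d} \<inter> ?I) \<times> ?I)"
      by (intro closed_Times closed_Int closed_atLeastAtMost)+
    ultimately have "\<exists>s. parallel (({a..c} \<inter> ?I) \<times> ?I \<union> ({c..d} \<inter> ?I) \<times> ?I) F s"
      using trans parallel_Un by metis
    moreover have "({a..c} \<inter> ?I) \<times> ?I \<union> ({c..d} \<inter> ?I) \<times> ?I = ({a..d} \<inter> ?I) \<times> ?I"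
      using trans by auto
    ultimately show ?case by simp
  next
    case (local x)
    then obtain \<delta> s where \<delta>: "\<delta> > 0" and s: "parallel (({x - \<delta>..x + \<delta>} \<inter> ?I) \<times> ({0..1} \<inter> ?I)) F s"
      using strip[of x] by auto
    have "parallel (({c..d} \<inter> ?I) \<times> ?I) F s" if "c \<le> x \<and> x \<le> d \<and> d - c < \<delta>" for c d
      by (rule parallel_subset[OF s]) (use that in auto)
    then show ?case using \<delta> by blast
  qed
  then show ?thesis by simp
qed

text \<open>A path is read as a square that is constant in its first coordinate; the section over
  the square is restricted to one edge.\<close>

lemma parallel_path:
  assumes "path g" "path_image g \<subseteq> M"
  shows "\<exists>s. parallel {0..1} g s"
proof -
  have "continuous_on ({0..1::real} \<times> {0..1}) (\<lambda>z. g (snd z))"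
    by (rule continuous_on_compose2[of "{0..1}" g _ snd])
      (use assms in \<open>auto simp: path_def intro!: continuous_intros\<close>)
  moreover have "(\<lambda>z. g (snd z)) ` ({0..1::real} \<times> {0..1}) \<subseteq> M"
    using assms by (auto simp: path_image_def)
  ultimately obtain s where s: "parallel ({0..1::real} \<times> {0..1}) (\<lambda>z. g (snd z)) s"
    using parallel_square by blast
  have "parallel {0..1} ((\<lambda>z. g (snd z)) \<circ> Pair (0::real)) (s \<circ> Pair (0::real))"
    by (rule parallel_compose[OF s]) (auto intro!: continuous_intros)
  then show ?thesis by (auto simp: comp_def)
qed

text \<open>Well defined since two sections along a path differ by a left factor, which cancels in
  \<open>inv (s 0) \<otimes> s 1\<close>.\<close>

definition hol :: "(real \<Rightarrow> 'a) \<Rightarrow> 'g" where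
  "hol g = (THE x. \<exists>s. parallel {0..1} g s \<and> x = inv (s 0) \<otimes> s 1)"

lemma hol_eq:
  assumes s: "parallel {0..1} g s"
  shows "hol g = inv (s 0) \<otimes> s 1"
  unfolding hol_def
proof (rule the_equality)
  fix x assume "\<exists>s. parallel {0..1} g s \<and> x = inv (s 0) \<otimes> s 1"
  then obtain t where t: "parallel {0..1} g t" "x = inv (t 0) \<otimes> t 1" by blast
  have "s 0 \<otimes> inv (t 0) = s 1 \<otimes> inv (t 1)"
    by (rule parallel_unique[OF s t(1)]) auto
  moreover have c: "s 0 \<in> carrier G" "s 1 \<in> carrier G" "t 0 \<in> carrier G" "t 1 \<in> carrier G"
    using parallel_closed[OF s] parallel_closed[OF t(1)] by auto
  moreover have "s 1 = s 1 \<otimes> inv (t 1) \<otimes> t 1" "s 0 \<otimes> inv (t 0) \<otimes> t 1 = s 0 \<otimes> (inv (t 0) \<otimes> t 1)"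
    using c by (simp_all add: m_assoc)
  ultimately have "s 1 = s 0 \<otimes> x" using t(2) by simp
  then show "x = inv (s 0) \<otimes> s 1" using c t(2) by (simp add: m_assoc[symmetric])
qed (use s in blast)

lemma hol_closed:
  assumes "path g" "path_image g \<subseteq> M"
  shows "hol g \<in> carrier G"
  using parallel_path[OF assms] hol_eq parallel_closed by (metis atLeastAtMost_iff inv_closed m_closed order_refl zero_le_one)

lemma hol_chart:
  assumes "e \<in> E" "path g" "path_image g \<subseteq> M \<inter> Q e"
  shows "hol g = inv (b e (pathstart g)) \<otimes> b e (pathfinish g)"
  using hol_eq[OF parallel_chart[OF assms(1)]] assms
  by (simp add: path_def path_image_def pathstart_def pathfinish_def)

text \<open>One section along the joined path restricts to sections along both halves, and its value
  at the midpoint cancels.\<close>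

lemma hol_join:
  assumes g: "path g" "path_image g \<subseteq> M" and h: "path h" "path_image h \<subseteq> M"
    and gh: "pathfinish g = pathstart h"
  shows "hol (g +++ h) = hol g \<otimes> hol h"
proof -
  obtain s where s: "parallel {0..1} (g +++ h) s"
    using parallel_path[of "g +++ h"] assms by (auto simp: path_image_join)
  have "parallel {0..1} ((g +++ h) \<circ> (\<lambda>t. t / 2)) (s \<circ> (\<lambda>t. t / 2))"
    by (rule parallel_compose[OF s]) (auto intro!: continuous_intros)
  then have sg: "parallel {0..1} g (s \<circ> (\<lambda>t. t / 2))"
    by (rule parallel_cong) (auto simp: joinpaths_def)
  have "parallel {0..1} ((g +++ h) \<circ> (\<lambda>t. t / 2 + 1 / 2)) (s \<circ> (\<lambda>t. t / 2 + 1 / 2))"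
    by (rule parallel_compose[OF s]) (auto intro!: continuous_intros)
  then have sh: "parallel {0..1} h (s \<circ> (\<lambda>t. t / 2 + 1 / 2))"
    by (rule parallel_cong) (use gh in \<open>auto simp: joinpaths_def pathfinish_def pathstart_def\<close>)
  have c: "s 0 \<in> carrier G" "s (1/2) \<in> carrier G" "s 1 \<in> carrier G"
    using parallel_closed[OF s] by auto
  have "inv (s 0) \<otimes> s 1 = (inv (s 0) \<otimes> s (1/2)) \<otimes> (inv (s (1/2)) \<otimes> s 1)"
  proof -
    have "s (1/2) \<otimes> (inv (s (1/2)) \<otimes> s 1) = s 1" using c by (simp add: m_assoc[symmetric])
    then show ?thesis using c by (simp add: m_assoc)
  qed
  then show ?thesis using hol_eq[OF s] hol_eq[OF sg] hol_eq[OF sh] by simp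
qed

text \<open>A section over the homotopy square restricts to sections along \<open>p\<close> and
  \<open>q\<close>, whose values at the ends agree because the homotopy is constant on the two
  remaining edges.\<close>

lemma hol_homotopic:
  assumes "homotopic_paths M p q"
  shows "hol p = hol q"
proof -
  obtain h :: "real \<times> real \<Rightarrow> 'a"
    where h': "continuous_on ({0..1} \<times> {0..1}) h" "\<forall>x\<in>{0..1}. \<forall>y\<in>{0..1}. h (x, y) \<in> M"
      "\<forall>x\<in>{0..1}. h (0, x) = p x" "\<forall>x\<in>{0..1}. h (1, x) = q x"
      "\<forall>t\<in>{0..1}. h (t, 0) = p 0 \<and> h (t, 1) = p 1"
    using assms unfolding homotopic_paths
    by (auto simp: pathstart_def pathfinish_def image_subset_iff Pi_iff simp del: atLeastAtMost_iff)
  then have h: "continuous_on ({0..1} \<times> {0..1}) h" "h ` ({0..1} \<times> {0..1}) \<subseteq> M"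
      "\<And>x. x \<in> {0..1} \<Longrightarrow> h (0, x) = p x" "\<And>x. x \<in> {0..1} \<Longrightarrow> h (1, x) = q x"
      "\<And>t. t \<in> {0..1} \<Longrightarrow> h (t, 0) = p 0 \<and> h (t, 1) = p 1"
    by auto
  obtain s where s: "parallel ({0..1} \<times> {0..1}) h s" using parallel_square[OF h(1,2)] by blast
  have p: "parallel {0..1} p (s \<circ> Pair 0)"
    by (rule parallel_cong[OF parallel_compose[OF s, of _ "Pair 0"]]) (use h in \<open>auto intro!: continuous_intros\<close>)
  have q: "parallel {0..1} q (s \<circ> Pair 1)"
    by (rule parallel_cong[OF parallel_compose[OF s, of _ "Pair 1"]]) (use h in \<open>auto intro!: continuous_intros\<close>)
  \<comment> \<open>Along a constant path a chart gives a constant section, and by uniqueness every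
    other section is constant too.\<close>
  have edge: "s (0, x) = s (1, x)" if x: "x \<in> {0..1}" and const: "\<And>t. t \<in> {0..1} \<Longrightarrow> h (t, x) = p x" for x
  proof -
    have px: "p x \<in> M" using parallel_in[OF p x] .
    have 1: "parallel {0..1} (\<lambda>_. p x) (s \<circ> (\<lambda>t. (t, x)))"
      by (rule parallel_cong[OF parallel_compose[OF s, of _ "\<lambda>t. (t, x)"]]) (use const x in \<open>auto intro!: continuous_intros\<close>)
    obtain e where e: "e \<in> E" "p x \<in> Q e" using cover[OF px] by blast
    have 2: "parallel {0..1::real} (\<lambda>_. p x) (\<lambda>_. b e (p x))"
      by (rule parallel_chart[OF e(1)]) (use e px in auto)
    have "s (0, x) \<otimes> inv (b e (p x)) = s (1, x) \<otimes> inv (b e (p x))"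
      using parallel_unique[OF 1 2, of 0 1] by simp
    then show ?thesis
      using parallel_closed[OF 1, of 0] parallel_closed[OF 1, of 1] e px by simp
  qed
  then have "s (0, 0) = s (1, 0)" "s (0, 1) = s (1, 1)" using h(5) by auto
  then show ?thesis using hol_eq[OF p] hol_eq[OF q] by simp
qed

lemma hol_reversepath:
  assumes "path g" "path_image g \<subseteq> M"
  shows "hol (reversepath g) = inv (hol g)"
proof -
  obtain s where s: "parallel {0..1} g s" using parallel_path[OF assms] by blast
  have "parallel {0..1} (g \<circ> (\<lambda>t. 1 - t)) (s \<circ> (\<lambda>t. 1 - t))"
    by (rule parallel_compose[OF s]) (auto intro!: continuous_intros)
  then have "parallel {0..1} (reversepath g) (s \<circ> (\<lambda>t. 1 - t))"
    by (simp add: reversepath_def comp_def)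
  then show ?thesis
    using hol_eq[OF s] parallel_closed[OF s] by (simp add: hol_eq inv_mult_group)
qed

end

section \<open>The polygon\<close>

text \<open>Signed distance of \<open>z\<close> from the line through side number \<open>\<sigma>\<close>, positive on the inner side.\<close>

definition side_dist :: "nat \<Rightarrow> nat \<Rightarrow> complex \<Rightarrow> real" where
  "side_dist n \<sigma> z = cos (pi / n) - Re (z * cis (- (pi * (2 * real \<sigma> + 1) / n)))"

text \<open>In \<open>side_dist\<close>, \<open>cos (pi / n)\<close> is the apothem and
  \<open>pi * (2 * real \<sigma> + 1) / n\<close> the direction of the midpoint of side
  \<open>\<sigma>\<close>. Measured from it, the vertices lie at odd multiples of
  \<open>pi / n\<close>.\<close>

lemma side_dist_vertex:
  assumes "n > 0"
  shows "side_dist n \<sigma> (vertex n k) = cos (pi / n) - cos (pi * (2 * real k - 2 * real \<sigma> - 1) / n)"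
proof -
  have "2 * pi * real k / real n + - (pi * (2 * real \<sigma> + 1) / real n) =
      pi * (2 * real k - 2 * real \<sigma> - 1) / n"
    using assms by (simp add: field_simps)
  then show ?thesis by (simp add: side_dist_def vertex_def cis_mult)
qed

text \<open>Replacing \<open>j > n\<close> by \<open>2 * n - j\<close> keeps the cosine and brings
  the angle into the interval from 0 to \<open>pi\<close>, where the cosine is injective and
  decreasing.\<close>

lemma cos_odd_multiple:
  fixes j :: nat
  assumes "n \<ge> 3" "1 \<le> j" "j \<le> 2 * n - 1"
  shows "cos (pi * j / n) \<le> cos (pi / n)" "cos (pi * j / n) = cos (pi / n) \<longleftrightarrow> j = 1 \<or> j = 2 * n - 1"
proof -
  define i where "i = (if j \<le> n then j else 2 * n - j)"
  have i: "1 \<le> i" "i \<le> n" "i = 1 \<longleftrightarrow> j = 1 \<or> j = 2 * n - 1" using assms by (auto simp: i_def)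
  have c: "cos (pi * j / n) = cos (pi * i / n)"
  proof (cases "j \<le> n")
    case False
    then have "pi * i / n = 2 * pi - pi * j / n"
      using assms by (simp add: i_def of_nat_diff field_simps)
    then show ?thesis by (simp add: cos_diff)
  qed (simp add: i_def)
  have b: "0 \<le> pi / n" "pi / n \<le> pi" "0 \<le> pi * i / n" "pi * i / n \<le> pi"
    using i assms by (auto simp: field_simps)
  have "pi / n \<le> pi * i / n" using i assms by (auto simp: field_simps)
  then show "cos (pi * j / n) \<le> cos (pi / n)" using c b by (simp add: cos_mono_le_eq)
  have "cos (pi * i / n) = cos (pi / n) \<longleftrightarrow> pi * i / n = pi / n"
    using b cos_inj_pi by metis
  then show "cos (pi * j / n) = cos (pi / n) \<longleftrightarrow> j = 1 \<or> j = 2 * n - 1"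
    using c i assms by auto
qed

lemma
  assumes "n \<ge> 3" "k < n" "\<sigma> < n"
  shows side_dist_vertex_nonneg: "0 \<le> side_dist n \<sigma> (vertex n k)"
    and side_dist_vertex_eq_0: "side_dist n \<sigma> (vertex n k) = 0 \<longleftrightarrow> k = \<sigma> \<or> k = Suc \<sigma> mod n"
proof -
  \<comment> \<open>The absolute value of \<open>2 * k - 2 * \<sigma> - 1\<close>. It is
    \<open>1\<close> at \<open>k = \<sigma>\<close> and \<open>k = \<sigma> + 1\<close>, and
    \<open>2 * n - 1\<close> in the wrap-around case \<open>\<sigma> = n - 1\<close>,
    \<open>k = 0\<close>.\<close>
  define j where "j = (if k > \<sigma> then 2 * (k - \<sigma>) - 1 else 2 * (\<sigma> - k) + 1)"
  have "cos (pi * (2 * real k - 2 * real \<sigma> - 1) / n) = cos (pi * j / n)"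
  proof (cases "k > \<sigma>")
    case True
    then have "2 * real k - 2 * real \<sigma> - 1 = j" by (simp add: j_def of_nat_diff)
    then show ?thesis by simp
  next
    case False
    then have "2 * real k - 2 * real \<sigma> - 1 = - real j" by (simp add: j_def of_nat_diff)
    then show ?thesis by (metis cos_minus minus_divide_left mult_minus_right)
  qed
  then have d: "side_dist n \<sigma> (vertex n k) = cos (pi / n) - cos (pi * j / n)"
    using assms by (simp add: side_dist_vertex)
  have j: "1 \<le> j" "j \<le> 2 * n - 1" using assms by (auto simp: j_def)
  show "0 \<le> side_dist n \<sigma> (vertex n k)" using d cos_odd_multiple(1)[OF assms(1) j] by simp
  have "j = 1 \<or> j = 2 * n - 1 \<longleftrightarrow> k = \<sigma> \<or> k = Suc \<sigma> mod n"
    using assms by (cases "Suc \<sigma> = n") (auto simp: j_def)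
  then show "side_dist n \<sigma> (vertex n k) = 0 \<longleftrightarrow> k = \<sigma> \<or> k = Suc \<sigma> mod n"
    using d cos_odd_multiple(2)[OF assms(1) j] by auto
qed

lemma vertex_mod: "n > 0 \<Longrightarrow> vertex n (Suc k mod n) = vertex n (Suc k)" if "k < n" for k
proof (cases "Suc k = n")
  case True
  assume "n > 0"
  then have "vertex n n = vertex n 0" by (simp add: vertex_def)
  then show ?thesis using True by simp
qed (use that in simp)

lemma side_dist_affine:
  "side_dist n \<sigma> ((1 - t) *\<^sub>R a + t *\<^sub>R b) = (1 - t) * side_dist n \<sigma> a + t * side_dist n \<sigma> b"
  by (simp add: side_dist_def algebra_simps)

lemma side_dist_sum:
  assumes "finite A" "sum u A = 1"
  shows "side_dist n \<sigma> (\<Sum>k\<in>A. u k *\<^sub>R v k) = (\<Sum>k\<in>A. u k * side_dist n \<sigma> (v k))"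
proof -
  let ?c = "cis (- (pi * (2 * real \<sigma> + 1) / n))"
  have "Re ((\<Sum>k\<in>A. u k *\<^sub>R v k) * ?c) = (\<Sum>k\<in>A. u k * Re (v k * ?c))"
    by (simp add: sum_distrib_right)
  moreover have "cos (pi / n) = (\<Sum>k\<in>A. u k * cos (pi / n))"
    by (simp add: sum_distrib_right[symmetric] assms)
  ultimately show ?thesis
    by (simp add: side_dist_def right_diff_distrib sum_subtractf)
qed

lemma continuous_on_side_dist [continuous_intros]:
  "continuous_on A f \<Longrightarrow> continuous_on A (\<lambda>x. side_dist n \<sigma> (f x))"
  unfolding side_dist_def by (intro continuous_intros)

lemma inj_vertex:
  assumes "n > 0" shows "inj_on (vertex n) {..<n}"
proof (rule inj_onI)
  fix k l assume kl: "k \<in> {..<n}" "l \<in> {..<n}" "vertex n k = vertex n l"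
  have "inj_on (\<lambda>k. cis (2 * pi * real k / real n)) {..<n}"
    using Complex.bij_betw_roots_unity[OF assms] by (auto simp: bij_betw_def)
  then show "k = l" using kl by (auto simp: vertex_def dest: inj_onD)
qed

lemma polygon_coordinates:
  assumes "n > 0" "z \<in> polygon n"
  obtains u where "\<And>k. k < n \<Longrightarrow> 0 \<le> u k" "sum u {..<n} = 1" "z = (\<Sum>k<n. u k *\<^sub>R vertex n k)"
proof -
  obtain u where u: "\<forall>x\<in>vertex n ` {..<n}. 0 \<le> u x" "sum u (vertex n ` {..<n}) = 1"
      "(\<Sum>x\<in>vertex n ` {..<n}. u x *\<^sub>R x) = z"
    using assms unfolding polygon_def by (auto simp: convex_hull_finite)
  then show ?thesis
    using that[of "u \<circ> vertex n"] inj_vertex[OF assms(1)] by (auto simp: sum.reindex)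
qed

lemma vertex_in_polygon: "k < n \<Longrightarrow> vertex n k \<in> polygon n"
  unfolding polygon_def by (rule hull_inc) simp

lemma convex_polygon: "convex (polygon n)"
  by (simp add: polygon_def)

lemma compact_polygon: "compact (polygon n)"
  by (simp add: polygon_def finite_imp_compact_convex_hull)

lemma side_dist_nonneg:
  assumes "n \<ge> 3" "\<sigma> < n" "z \<in> polygon n"
  shows "0 \<le> side_dist n \<sigma> z"
proof -
  obtain u where u: "\<And>k. k < n \<Longrightarrow> 0 \<le> u k" "sum u {..<n} = 1" "z = (\<Sum>k<n. u k *\<^sub>R vertex n k)"
    using polygon_coordinates[of n z] assms by auto
  then show ?thesis
    using side_dist_vertex_nonneg[OF assms(1) _ assms(2)]
    by (auto simp: side_dist_sum intro!: sum_nonneg mult_nonneg_nonneg)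
qed

lemma side_point_in_polygon:
  assumes "\<sigma> < n" "0 \<le> t" "t \<le> 1"
  shows "side_point n \<sigma> t \<in> polygon n"
proof -
  have "vertex n (Suc \<sigma>) \<in> polygon n"
    using vertex_mod[of \<sigma> n] vertex_in_polygon[of "Suc \<sigma> mod n" n] assms by simp
  then show ?thesis
    unfolding side_point_def using assms
    by (intro convexD_alt[OF convex_polygon]) (auto simp: vertex_in_polygon)
qed

lemma side_dist_side_point:
  assumes "n \<ge> 3" "\<sigma> < n"
  shows "side_dist n \<sigma> (side_point n \<sigma> t) = 0"
proof -
  have "side_dist n \<sigma> (vertex n (Suc \<sigma> mod n)) = 0"
    using assms by (subst side_dist_vertex_eq_0) auto
  moreover have "side_dist n \<sigma> (vertex n \<sigma>) = 0"
    using assms by (subst side_dist_vertex_eq_0) auto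
  ultimately show ?thesis
    using assms by (simp add: side_point_def side_dist_affine vertex_mod)
qed

text \<open>In barycentric coordinates the distance is a sum of nonnegative terms; it vanishes only
  if all weight sits on the two ends of the side.\<close>

lemma side_dist_eq_0_imp:
  assumes "n \<ge> 3" "\<sigma> < n" "z \<in> polygon n" "side_dist n \<sigma> z = 0"
  obtains t where "0 \<le> t" "t \<le> 1" "z = side_point n \<sigma> t"
proof -
  obtain u where u: "\<And>k. k < n \<Longrightarrow> 0 \<le> u k" "sum u {..<n} = 1" "z = (\<Sum>k<n. u k *\<^sub>R vertex n k)"
    using polygon_coordinates[of n z] assms by auto
  let ?\<tau> = "Suc \<sigma> mod n"
  have \<tau>: "?\<tau> < n" "\<sigma> \<noteq> ?\<tau>" using assms by (auto simp: mod_Suc)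
  have "(\<Sum>k<n. u k * side_dist n \<sigma> (vertex n k)) = 0"
    using assms(4) u by (simp add: side_dist_sum)
  then have "\<forall>k\<in>{..<n}. u k * side_dist n \<sigma> (vertex n k) = 0"
    by (subst (asm) sum_nonneg_eq_0_iff) (use u side_dist_vertex_nonneg assms in auto)
  then have z: "u k = 0" if "k < n" "k \<noteq> \<sigma>" "k \<noteq> ?\<tau>" for k
    using that side_dist_vertex_eq_0[OF assms(1) that(1) assms(2)] by auto
  have "(\<Sum>k<n. u k *\<^sub>R vertex n k) = (\<Sum>k\<in>{\<sigma>, ?\<tau>}. u k *\<^sub>R vertex n k)"
    by (rule sum.mono_neutral_right) (use z assms in auto)
  moreover have "sum u {..<n} = sum u {\<sigma>, ?\<tau>}"
    by (rule sum.mono_neutral_right) (use z assms in auto)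
  ultimately have "z = u \<sigma> *\<^sub>R vertex n \<sigma> + u ?\<tau> *\<^sub>R vertex n ?\<tau>" "u \<sigma> + u ?\<tau> = 1"
    using u \<tau> by auto
  then have "z = side_point n \<sigma> (u ?\<tau>)"
    using assms vertex_mod[of \<sigma> n] by (simp add: side_point_def eq_diff_eq[symmetric])
  moreover have "0 \<le> u ?\<tau>" "u ?\<tau> \<le> 1" using u(1)[of ?\<tau>] u(1)[of \<sigma>] \<tau> assms \<open>u \<sigma> + u ?\<tau> = 1\<close> by auto
  ultimately show ?thesis using that by blast
qed

text \<open>Written as a convex combination of the vertices, so that membership in the polygon and
  positive distance from all sides can be read off.\<close>

definition center :: "nat \<Rightarrow> complex" where
  "center n = (\<Sum>k<n. (1 / n) *\<^sub>R vertex n k)"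

lemma center_in_polygon: "n > 0 \<Longrightarrow> center n \<in> polygon n"
  unfolding center_def by (rule convex_sum) (auto simp: convex_polygon vertex_in_polygon)

lemma side_dist_center:
  assumes "n \<ge> 3" "\<sigma> < n"
  shows "0 < side_dist n \<sigma> (center n)"
proof -
  \<comment> \<open>A vertex off side \<open>\<sigma>\<close>, available since
    \<open>n \<ge> 3\<close>; it alone makes the average distance positive.\<close>
  define \<tau> where "\<tau> = Suc (Suc \<sigma>) mod n"
  have \<tau>: "\<tau> < n" "\<tau> \<noteq> \<sigma>" "\<tau> \<noteq> Suc \<sigma> mod n" using assms by (auto simp: \<tau>_def mod_Suc)
  have "0 < side_dist n \<sigma> (vertex n \<tau>)"
    using side_dist_vertex_nonneg[OF assms(1) \<tau>(1) assms(2)]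
      side_dist_vertex_eq_0[OF assms(1) \<tau>(1) assms(2)] \<tau> by linarith
  then have "0 < (\<Sum>k<n. 1 / n * side_dist n \<sigma> (vertex n k))"
    using \<tau> assms side_dist_vertex_nonneg by (intro sum_pos2[of _ \<tau>]) auto
  then show ?thesis unfolding center_def by (subst side_dist_sum) (use assms in auto)
qed

section \<open>A model of the complex in Euclidean space\<close>

text \<open>\<open>parity_dist m 1\<close> vanishes exactly on the sides labelled $y_j^k$, where the index \<open>i\<close> is
  forgotten, and \<open>parity_dist m 0\<close> on those labelled $x_i^k$, where \<open>j\<close> is.\<close>

definition parity_dist :: "nat \<Rightarrow> nat \<Rightarrow> complex \<Rightarrow> real" where
  "parity_dist m r z = (\<Prod>k<m. side_dist (2 * m) (2 * k + r) z)"

lemma continuous_on_parity_dist [continuous_intros]: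
  "continuous_on A f \<Longrightarrow> continuous_on A (\<lambda>x. parity_dist m r (f x))"
  unfolding parity_dist_def by (intro continuous_intros)

lemma parity_dist_eq_0: "parity_dist m r z = 0 \<longleftrightarrow> (\<exists>k<m. side_dist (2 * m) (2 * k + r) z = 0)"
  by (auto simp: parity_dist_def)

text \<open>The product of the distances to all sides of one parity switches off the coordinate of
  the index that gluing forgets on them, and separates the indices everywhere else in the
  polygon.\<close>

definition model_point :: "nat \<Rightarrow> nat \<Rightarrow> nat \<Rightarrow> complex \<Rightarrow> complex \<times> real \<times> real" where
  "model_point m i j z = (z, real i * parity_dist m 1 z, real j * parity_dist m 0 z)"

lemma model_point_eq_iff:
  "model_point m i j z = model_point m i' j' z' \<longleftrightarrow>
     z = z' \<and> (i = i' \<or> parity_dist m 1 z = 0) \<and> (j = j' \<or> parity_dist m 0 z = 0)"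
  by (auto simp: model_point_def)

lemma fst_model_point [simp]: "fst (model_point m i j z) = z"
  by (simp add: model_point_def)

lemma continuous_on_model_point [continuous_intros]:
  "continuous_on A f \<Longrightarrow> continuous_on A (\<lambda>x. model_point m i j (f x))"
  unfolding model_point_def by (intro continuous_intros)

definition model :: "nat \<Rightarrow> nat \<Rightarrow> nat \<Rightarrow> (complex \<times> real \<times> real) set" where
  "model m q1 q2 = (\<Union>i<q1. \<Union>j<q2. model_point m i j ` polygon (2 * m))"

definition model_map :: "nat \<Rightarrow> polygon_point \<Rightarrow> complex \<times> real \<times> real" where
  "model_map m = (\<lambda>((i, j), z). model_point m i j z)"

text \<open>A label determines the number of its side, so gluing only joins equal points
  \<open>z\<close> of two polygons; the parity of the side decides which index is retained.\<close>

lemma glued_imp_model_map_eq: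
  assumes m: "m \<ge> 2" and "glued m q1 q2 p p'"
  shows "model_map m p = model_map m p'"
  using assms(2)
proof cases
  case (1 i j i' j' e e' t)
  have e: "side_dist (2 * m) e (side_point (2 * m) e t) = 0"
    by (rule side_dist_side_point) (use 1 m in auto)
  show ?thesis
  proof (cases "even e")
    case True
    then have "even e'" "i = i'" "e div 2 = e' div 2" using 1(9) by (auto simp: side_label_def split: if_splits)
    moreover obtain k where k: "e = 2 * k" using True by (auto elim: evenE)
    ultimately have "e' = e" by (auto elim: evenE)
    moreover have "parity_dist m 0 (side_point (2 * m) e t) = 0"
      using e k 1 by (auto simp: parity_dist_eq_0)
    ultimately show ?thesis using 1 \<open>i = i'\<close> by (simp add: model_map_def model_point_eq_iff)
  next
    case False
    then have "odd e'" "j = j'" "e div 2 = e' div 2" using 1(9) by (auto simp: side_label_def split: if_splits)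
    moreover obtain k where k: "e = 2 * k + 1" using False by (auto elim: oddE)
    ultimately have "e' = e" by (auto elim: oddE)
    moreover have "parity_dist m 1 (side_point (2 * m) e t) = 0"
      using e k 1 by (auto simp: parity_dist_eq_0 intro!: exI[of _ k])
    ultimately show ?thesis using 1 \<open>j = j'\<close> by (simp add: model_map_def model_point_eq_iff)
  qed
qed

lemma equivclp_glued_imp:
  assumes "m \<ge> 2" "equivclp (glued m q1 q2) p p'"
  shows "model_map m p = model_map m p'"
  using assms(2) by (induction rule: equivclp_induct) (use glued_imp_model_map_eq[OF assms(1)] in metis)+

lemma equivclp_glued_side:
  assumes m: "m \<ge> 2" and ij: "i < q1" "i' < q1" "j < q2" "j' < q2" and k: "k < m" and z: "z \<in> polygon (2 * m)"
  shows "side_dist (2 * m) (2 * k + 1) z = 0 \<Longrightarrow> glued m q1 q2 ((i, j), z) ((i', j), z)"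
    and "side_dist (2 * m) (2 * k) z = 0 \<Longrightarrow> glued m q1 q2 ((i, j), z) ((i, j'), z)"
proof -
  assume "side_dist (2 * m) (2 * k + 1) z = 0"
  then obtain t where "0 \<le> t" "t \<le> 1" "z = side_point (2 * m) (2 * k + 1) t"
    using side_dist_eq_0_imp[of "2 * m" "2 * k + 1" z] m k z by auto
  then show "glued m q1 q2 ((i, j), z) ((i', j), z)"
    using glued.intros[of i q1 j q2 i' j "2 * k + 1" m "2 * k + 1" t] ij k by (simp add: side_label_def)
next
  assume "side_dist (2 * m) (2 * k) z = 0"
  then obtain t where "0 \<le> t" "t \<le> 1" "z = side_point (2 * m) (2 * k) t"
    using side_dist_eq_0_imp[of "2 * m" "2 * k" z] m k z by auto
  then show "glued m q1 q2 ((i, j), z) ((i, j'), z)"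
    using glued.intros[of i q1 j q2 i j' "2 * k" m "2 * k" t] ij k by (simp add: side_label_def)
qed

lemma topspace_polygons: "topspace (polygons m q1 q2) = ({..<q1} \<times> {..<q2}) \<times> polygon (2 * m)"
  by (simp add: polygons_def)

text \<open>The indices can be changed one at a time over the same \<open>z\<close>:
  \<open>i\<close> on a side of odd number, then \<open>j\<close> on a side of even number.\<close>

lemma equivclp_glued_iff:
  assumes m: "m \<ge> 2" and p: "p \<in> topspace (polygons m q1 q2)" and p': "p' \<in> topspace (polygons m q1 q2)"
  shows "equivclp (glued m q1 q2) p p' \<longleftrightarrow> model_map m p = model_map m p'"
proof
  assume eq: "model_map m p = model_map m p'"
  obtain i j z where ij: "p = ((i, j), z)" "i < q1" "j < q2" "z \<in> polygon (2 * m)"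
    using p by (auto simp: topspace_polygons)
  obtain i' j' z' where ij': "p' = ((i', j'), z')" "i' < q1" "j' < q2" "z' \<in> polygon (2 * m)"
    using p' by (auto simp: topspace_polygons)
  have z: "z' = z" "i = i' \<or> parity_dist m 1 z = 0" "j = j' \<or> parity_dist m 0 z = 0"
    using eq ij ij' by (auto simp: model_map_def model_point_eq_iff)
  have "equivclp (glued m q1 q2) ((i, j), z) ((i', j), z)"
    using z(2) equivclp_glued_side(1)[OF m, of i q1 i' j q2 j] ij ij'
    by (auto simp: parity_dist_eq_0 intro: r_into_equivclp)
  moreover have "equivclp (glued m q1 q2) ((i', j), z) ((i', j'), z)"
    using z(3) equivclp_glued_side(2)[OF m, of i' q1 i' j q2 j'] ij ij'
    by (auto simp: parity_dist_eq_0 intro: r_into_equivclp)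
  ultimately show "equivclp (glued m q1 q2) p p'"
    using ij ij' z(1) by (auto intro: equivclp_trans)
qed (rule equivclp_glued_imp[OF m])

lemma model_map_image: "model_map m ` topspace (polygons m q1 q2) = model m q1 q2"
  by (force simp: topspace_polygons model_map_def model_def)

lemma continuous_map_model_map:
  "continuous_map (polygons m q1 q2) (top_of_set (model m q1 q2)) (model_map m)"
  unfolding continuous_map_in_subtopology
proof
  have *: "continuous_map (top_of_set (polygon (2 * m))) euclidean (model_point m i j)" for i j
    by (simp add: continuous_on_model_point)
  show "continuous_map (polygons m q1 q2) euclidean (model_map m)"
    unfolding continuous_map_def
  proof (intro conjI allI impI)
    fix U :: "(complex \<times> real \<times> real) set" assume U: "openin euclidean U"
    have "openin (top_of_set (polygon (2 * m))) {z. (c, z) \<in> {x \<in> topspace (polygons m q1 q2). model_map m x \<in> U}}"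
      if c: "c \<in> {..<q1} \<times> {..<q2}" for c
    proof -
      obtain i j where "c = (i, j)" by fastforce
      then have "{z. (c, z) \<in> {x \<in> topspace (polygons m q1 q2). model_map m x \<in> U}} =
          {z \<in> topspace (top_of_set (polygon (2 * m))). model_point m i j z \<in> U}"
        using c by (auto simp: topspace_polygons model_map_def)
      then show ?thesis
        using openin_continuous_map_preimage[OF *[of i j] U] by simp
    qed
    then show "openin (polygons m q1 q2) {x \<in> topspace (polygons m q1 q2). model_map m x \<in> U}"
      unfolding polygons_def openin_sum_topology by auto
  qed simp
  show "model_map m \<in> topspace (polygons m q1 q2) \<rightarrow> model m q1 q2"
    using model_map_image by blast
qed

lemma compact_space_polygons: "compact_space (polygons m q1 q2)"
proof -
  let ?I = "{..<q1} \<times> {..<q2}"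
  have "compactin (polygons m q1 q2) (Pair c ` polygon (2 * m))" if "c \<in> ?I" for c
  proof (rule image_compactin)
    show "compactin (top_of_set (polygon (2 * m))) (polygon (2 * m))"
      by (simp add: compactin_subtopology compact_polygon)
    show "continuous_map (top_of_set (polygon (2 * m))) (polygons m q1 q2) (Pair c)"
      unfolding polygons_def
      using continuous_map_component_injection[OF that, of "\<lambda>_. top_of_set (polygon (2 * m))"] by simp
  qed
  then have "compactin (polygons m q1 q2) (\<Union>c\<in>?I. Pair c ` polygon (2 * m))"
    by (intro compactin_Union) auto
  moreover have "(\<Union>c\<in>?I. Pair c ` polygon (2 * m)) = topspace (polygons m q1 q2)"
    by (auto simp: topspace_polygons)
  ultimately show ?thesis by (simp add: compact_space_def)
qed

text \<open>The induced map is a continuous bijection from a compact space onto a Hausdorff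
  space.\<close>

theorem homeomorphic_map_model:
  assumes m: "m \<ge> 2"
  shows "\<exists>F. homeomorphic_map (polygon_complex m q1 q2) (top_of_set (model m q1 q2)) F"
proof -
  let ?P = "polygons m q1 q2" and ?C = "polygon_complex m q1 q2"
  define \<pi> where "\<pi> p = {p'. equivclp (glued m q1 q2) p p'}" for p
  \<comment> \<open>\<open>model_map m\<close> is constant on each class, so its image there is a
    singleton.\<close>
  define F where "F A = the_elem (model_map m ` A)" for A
  have q: "quotient_map ?P ?C \<pi>"
    unfolding polygon_complex_def \<pi>_def by (rule quotient_map_quotient_topology)
  have F: "F (\<pi> p) = model_map m p" for p
  proof -
    have "model_map m ` \<pi> p = {model_map m p}"
    proof -
      have "p \<in> \<pi> p" by (simp add: \<pi>_def)
      moreover have "model_map m p' = model_map m p" if "p' \<in> \<pi> p" for p'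
        using equivclp_glued_imp[OF m, of q1 q2 p p'] that by (simp add: \<pi>_def)
      ultimately show ?thesis by blast
    qed
    then show ?thesis by (simp add: F_def)
  qed
  have top: "topspace ?C = \<pi> ` topspace ?P"
    using q by (simp add: quotient_map_def)
  have "homeomorphic_map ?C (top_of_set (model m q1 q2)) F"
  proof (rule continuous_imp_homeomorphic_map)
    have "F \<circ> \<pi> = model_map m" using F by auto
    then show "continuous_map ?C (top_of_set (model m q1 q2)) F"
      using continuous_compose_quotient_map[OF q] continuous_map_model_map by metis
    show "compact_space ?C"
      using image_compactin[OF _ quotient_imp_continuous_map[OF q], of "topspace ?P"] compact_space_polygons
      by (simp add: compact_space_def top)
    show "Hausdorff_space (top_of_set (model m q1 q2))"
      by (simp add: Hausdorff_space_subtopology)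
    show "F ` topspace ?C = topspace (top_of_set (model m q1 q2))"
      using model_map_image[of m q1 q2] by (simp add: top image_image F)
    show "inj_on F (topspace ?C)"
    proof (rule inj_onI)
      fix A B assume "A \<in> topspace ?C" "B \<in> topspace ?C" "F A = F B"
      then obtain p p' where p: "A = \<pi> p" "B = \<pi> p'" "p \<in> topspace ?P" "p' \<in> topspace ?P"
          "model_map m p = model_map m p'"
        using F by (auto simp: top)
      then have "equivclp (glued m q1 q2) p p'" by (simp add: equivclp_glued_iff[OF m])
      then show "A = B"
        unfolding p \<pi>_def by (auto intro: equivclp_trans equivclp_sym)
    qed
  qed
  then show ?thesis by blast
qed

section \<open>Stars of vertices\<close>

definition incident :: "nat \<Rightarrow> nat \<Rightarrow> nat \<Rightarrow> bool" where
  "incident n e \<sigma> \<longleftrightarrow> e = \<sigma> \<or> e = Suc \<sigma> mod n"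

text \<open>Taken in the whole plane, so that it is open and convex; for a vertex \<open>e\<close>,
  intersecting with the polygon gives the polygon without the sides that miss
  \<open>e\<close>.\<close>

definition star :: "nat \<Rightarrow> nat \<Rightarrow> complex set" where
  "star n e = {z. \<forall>\<sigma><n. \<not> incident n e \<sigma> \<longrightarrow> 0 < side_dist n \<sigma> z}"

lemma open_star: "open (star n e)"
proof -
  have "star n e = (\<Inter>\<sigma>\<in>{\<sigma>. \<sigma> < n \<and> \<not> incident n e \<sigma>}. {z. 0 < side_dist n \<sigma> z})"
    by (auto simp: star_def)
  then show ?thesis
    by (auto intro!: open_INT open_Collect_less continuous_intros)
qed

lemma vertex_in_star: "n \<ge> 3 \<Longrightarrow> e < n \<Longrightarrow> vertex n e \<in> star n e"
  using side_dist_vertex_nonneg side_dist_vertex_eq_0 by (fastforce simp: star_def incident_def less_le)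

lemma center_in_star: "n \<ge> 3 \<Longrightarrow> center n \<in> star n e"
  by (simp add: star_def side_dist_center)

lemma convex_star: "convex (star n e)"
  unfolding convex_alt
proof (intro ballI allI impI)
  fix x y and u :: real
  assume xy: "x \<in> star n e" "y \<in> star n e" and u: "0 \<le> u \<and> u \<le> 1"
  have "0 < (1 - u) * a + u * b" if "0 < a" "0 < b" for a b :: real
    using that u by (cases "u = 1") (auto intro!: add_pos_nonneg)
  then show "(1 - u) *\<^sub>R x + u *\<^sub>R y \<in> star n e"
    using xy by (simp add: star_def side_dist_affine)
qed

text \<open>A point of side \<open>\<sigma>\<close> other than its final vertex has positive weight
  on vertex \<open>\<sigma>\<close>, and so lies in the star of that vertex. Points off the boundary
  lie in every star.\<close>

lemma star_cover:
  assumes n: "n \<ge> 3" and z: "z \<in> polygon n"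
  shows "\<exists>e<n. z \<in> star n e"
proof (cases "\<exists>\<sigma><n. side_dist n \<sigma> z = 0")
  case False
  then have "z \<in> star n 0"
    using side_dist_nonneg[OF n _ z] by (force simp: star_def less_le)
  then show ?thesis using n by (intro exI[of _ 0]) auto
next
  case True
  then obtain \<sigma> t where \<sigma>: "\<sigma> < n" and t: "0 \<le> t" "t \<le> 1" "z = side_point n \<sigma> t"
    using side_dist_eq_0_imp[OF n _ z] by blast
  show ?thesis
  proof (cases "t = 1")
    case True
    then have "z = vertex n (Suc \<sigma> mod n)"
      using t \<sigma> n by (simp add: side_point_def vertex_mod)
    then show ?thesis using vertex_in_star[of n "Suc \<sigma> mod n"] n by (intro exI[of _ "Suc \<sigma> mod n"]) simp
  next
    case False
    have "0 < side_dist n \<tau> z" if \<tau>: "\<tau> < n" "\<not> incident n \<sigma> \<tau>" for \<tau>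
    proof -
      have "0 < side_dist n \<tau> (vertex n \<sigma>)"
        using vertex_in_star[OF n \<sigma>] \<tau> by (simp add: star_def)
      moreover have "0 \<le> side_dist n \<tau> (vertex n (Suc \<sigma>))"
        using side_dist_vertex_nonneg[OF n, of "Suc \<sigma> mod n" \<tau>] \<tau> \<sigma> vertex_mod[of \<sigma> n] by simp
      ultimately show ?thesis
        using t False unfolding t(3) side_point_def side_dist_affine
        by (intro add_pos_nonneg mult_pos_pos mult_nonneg_nonneg) auto
    qed
    then show ?thesis using \<sigma> by (auto simp: star_def)
  qed
qed

lemma star_side:
  "z \<in> star n e \<Longrightarrow> \<sigma> < n \<Longrightarrow> side_dist n \<sigma> z = 0 \<Longrightarrow> incident n e \<sigma>"
  by (auto simp: star_def)

lemma side_dist_incident_vertex: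
  "n \<ge> 3 \<Longrightarrow> e < n \<Longrightarrow> \<sigma> < n \<Longrightarrow> incident n e \<sigma> \<Longrightarrow> side_dist n \<sigma> (vertex n e) = 0"
  by (auto simp: side_dist_vertex_eq_0 incident_def)

text \<open>Fails for a digon, whose two sides have the same ends.\<close>

lemma incident_unique:
  assumes "n \<ge> 3" "e \<noteq> f" "e < n" "f < n" "\<sigma> < n" "\<tau> < n"
    "incident n e \<sigma>" "incident n f \<sigma>" "incident n e \<tau>" "incident n f \<tau>"
  shows "\<sigma> = \<tau>"
  using assms unfolding incident_def by (auto simp: mod_Suc split: if_splits)

definition side_path :: "nat \<Rightarrow> nat \<Rightarrow> real \<Rightarrow> complex" where
  "side_path n \<sigma> = linepath (center n) (side_point n \<sigma> (1 / 2))"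

text \<open>A different side contains at most one end of side \<open>\<sigma>\<close>, so the
  midpoint, an average of both ends, has positive distance from it.\<close>

lemma side_path_star:
  assumes n: "n \<ge> 3" and \<sigma>: "\<sigma> < n" and e: "incident n e \<sigma>" and t: "t \<in> {0..1}"
  shows "side_path n \<sigma> t \<in> polygon n \<inter> star n e"
proof -
  let ?z = "side_point n \<sigma> (1 / 2)"
  have "?z \<in> polygon n" using \<sigma> by (intro side_point_in_polygon) auto
  moreover have "?z \<in> star n e"
  proof -
    have "0 < side_dist n \<tau> ?z" if \<tau>: "\<tau> < n" "\<not> incident n e \<tau>" for \<tau>
    proof -
      define \<rho> where "\<rho> = Suc \<sigma> mod n"
      have \<rho>: "\<rho> < n" "\<rho> \<noteq> \<sigma>" using n \<sigma> by (auto simp: \<rho>_def mod_Suc)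
      have "\<tau> \<noteq> \<sigma>" using \<tau> e by auto
      then have "\<not> incident n \<sigma> \<tau> \<or> \<not> incident n \<rho> \<tau>"
        using incident_unique[OF n, of \<sigma> \<rho> \<sigma> \<tau>] \<rho> \<sigma> \<tau> by (auto simp: incident_def \<rho>_def)
      moreover have "0 \<le> side_dist n \<tau> (vertex n \<sigma>)" "0 \<le> side_dist n \<tau> (vertex n \<rho>)"
        using side_dist_vertex_nonneg[OF n] \<sigma> \<tau> \<rho> by auto
      moreover have "0 < side_dist n \<tau> (vertex n \<sigma>)" if "\<not> incident n \<sigma> \<tau>"
        using vertex_in_star[OF n \<sigma>] \<tau> that by (simp add: star_def)
      moreover have "0 < side_dist n \<tau> (vertex n \<rho>)" if "\<not> incident n \<rho> \<tau>"
        using vertex_in_star[OF n \<rho>(1)] \<tau> that by (simp add: star_def)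
      moreover have "side_dist n \<tau> ?z = side_dist n \<tau> (vertex n \<sigma>) / 2 + side_dist n \<tau> (vertex n \<rho>) / 2"
        using vertex_mod[of \<sigma> n] \<sigma> side_dist_affine[of n \<tau> "1 / 2" "vertex n \<sigma>" "vertex n (Suc \<sigma>)"]
        by (simp add: side_point_def \<rho>_def)
      ultimately show ?thesis by linarith
    qed
    then show ?thesis by (simp add: star_def)
  qed
  moreover have "center n \<in> polygon n" "center n \<in> star n e"
    using n by (auto intro: center_in_polygon center_in_star)
  ultimately show ?thesis
    using t convex_polygon[of n] convex_star[of n e] by (auto simp: side_path_def linepath_def convex_alt)
qed

section \<open>The complex with chambers labelled by \<open>G1 \<times> G2\<close>\<close>

text \<open>The enumerations \<open>n1\<close> and \<open>n2\<close> are arbitrary: the complex only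
  knows how many polygons it has, and group elements are used as their names.\<close>

locale bourdon_complex = bourdon G1 G2 m
  for G1 :: "('a, 'c) monoid_scheme" and G2 :: "('b, 'd) monoid_scheme" and m +
  fixes q1 q2 :: nat and n1 :: "'a \<Rightarrow> nat" and n2 :: "'b \<Rightarrow> nat"
  assumes n1: "bij_betw n1 (carrier G1) {..<q1}" and n2: "bij_betw n2 (carrier G2) {..<q2}"
begin

abbreviation "N \<equiv> 2 * m"
abbreviation "P \<equiv> polygon N"
abbreviation "M \<equiv> model m q1 q2"

lemma N_ge_3: "N \<ge> 3" and N_pos: "N > 0"
  using m by auto

definition pt :: "'a \<times> 'b \<Rightarrow> complex \<Rightarrow> complex \<times> real \<times> real" where
  "pt d z = model_point m (n1 (fst d)) (n2 (snd d)) z"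

lemma carrier_GG: "carrier GG = carrier G1 \<times> carrier G2"
  by (simp add: DirProd_def)

lemma finite_GG: "finite (carrier GG)"
  using bij_betw_finite[OF n1] bij_betw_finite[OF n2] by (simp add: carrier_GG)

lemma pt_eq_iff:
  "d \<in> carrier GG \<Longrightarrow> d' \<in> carrier GG \<Longrightarrow> pt d z = pt d' z' \<longleftrightarrow>
    z = z' \<and> (fst d = fst d' \<or> parity_dist m 1 z = 0) \<and> (snd d = snd d' \<or> parity_dist m 0 z = 0)"
  using n1 n2 by (auto simp: pt_def model_point_eq_iff carrier_GG bij_betw_def inj_on_eq_iff)

lemma fst_pt [simp]: "fst (pt d z) = z"
  by (simp add: pt_def)

lemma continuous_on_pt [continuous_intros]: "continuous_on A f \<Longrightarrow> continuous_on A (\<lambda>x. pt d (f x))"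
  unfolding pt_def by (intro continuous_intros)

lemma M_eq: "M = (\<Union>d\<in>carrier GG. pt d ` P)"
proof -
  have "{..<q1} = n1 ` carrier G1" "{..<q2} = n2 ` carrier G2"
    using n1 n2 by (auto simp: bij_betw_def)
  then have "M = (\<Union>g\<in>carrier G1. \<Union>h\<in>carrier G2. pt (g, h) ` P)"
    by (simp add: model_def pt_def)
  then show ?thesis by (force simp: carrier_GG)
qed

lemma pt_in_M: "d \<in> carrier GG \<Longrightarrow> z \<in> P \<Longrightarrow> pt d z \<in> M"
  by (auto simp: M_eq)

lemma in_M_E:
  assumes "x \<in> M" obtains d z where "d \<in> carrier GG" "z \<in> P" "x = pt d z"
  using assms by (auto simp: M_eq)

definition Q :: "nat \<Rightarrow> (complex \<times> real \<times> real) set" where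
  "Q e = fst -` star N e"

lemma pt_in_Q [simp]: "pt d z \<in> Q e \<longleftrightarrow> z \<in> star N e"
  by (simp add: Q_def)

lemma open_Q: "open (Q e)"
  unfolding Q_def using open_vimage_fst[OF open_star] by (simp add: vimage_def)

definition shrink :: "nat \<Rightarrow> real \<times> complex \<Rightarrow> complex" where
  "shrink e = (\<lambda>(t, z). (1 - t) *\<^sub>R z + t *\<^sub>R vertex N e)"

lemma shrink_closed:
  assumes "e < N" "z \<in> P" "z \<in> star N e" "t \<in> {0..1}"
  shows "shrink e (t, z) \<in> P" "shrink e (t, z) \<in> star N e"
  using assms vertex_in_polygon[of e N] vertex_in_star[OF N_ge_3 assms(1)] convex_polygon[of N] convex_star[of N e]
  by (auto simp: shrink_def convex_alt)

text \<open>A side through a point of the star contains vertex \<open>e\<close>, hence the whole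
  segment along which the point is moved.\<close>

lemma parity_dist_shrink:
  assumes e: "e < N" and z: "z \<in> star N e" and r: "r < 2" "parity_dist m r z = 0"
  shows "parity_dist m r (shrink e (t, z)) = 0"
proof -
  obtain k where k: "k < m" "side_dist N (2 * k + r) z = 0" using r by (auto simp: parity_dist_eq_0)
  have \<sigma>: "2 * k + r < N" using k r by simp
  have "side_dist N (2 * k + r) (vertex N e) = 0"
    by (rule side_dist_incident_vertex[OF N_ge_3 e \<sigma> star_side[OF z \<sigma> k(2)]])
  then show ?thesis using k by (auto simp: parity_dist_eq_0 shrink_def side_dist_affine)
qed

lemma pt_shrink_cong:
  assumes "e < N" "z \<in> star N e" "d \<in> carrier GG" "d' \<in> carrier GG" "pt d z = pt d' z"
  shows "pt d (shrink e (t, z)) = pt d' (shrink e (t, z))"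
  using assms parity_dist_shrink[of e z 0 t] parity_dist_shrink[of e z 1 t] by (auto simp: pt_eq_iff)

lemma closed_chamber: "closed (pt d ` P)"
  by (intro compact_imp_closed compact_continuous_image continuous_intros compact_polygon)

text \<open>The straight contractions of the chambers towards vertex \<open>e\<close> agree at
  common points, because the motion preserves the sides that make chambers coincide. As the chambers
  are closed and finite in number, they paste to a contraction of the star.\<close>

lemma contractible_star:
  assumes e: "e < N"
  shows "contractible (M \<inter> Q e)"
proof -
  let ?Z = "{0..1::real} \<times> (M \<inter> Q e)"
  define ch where "ch x = (SOME d. d \<in> carrier GG \<and> x \<in> pt d ` P)" for x
  define h where "h = (\<lambda>(t, x). pt (ch x) (shrink e (t, fst x)))"
  have h: "h (t, pt d z) = pt d (shrink e (t, z))" if "d \<in> carrier GG" "z \<in> P" "z \<in> star N e" for t d z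
  proof -
    have "ch (pt d z) \<in> carrier GG \<and> pt d z \<in> pt (ch (pt d z)) ` P"
      unfolding ch_def by (rule someI[of _ d]) (use that in auto)
    then have "ch (pt d z) \<in> carrier GG" "pt (ch (pt d z)) z = pt d z"
      by (auto simp del: fst_pt) (metis fst_pt)
    then show ?thesis using pt_shrink_cong[OF e that(3) _ that(1)] by (simp add: h_def)
  qed
  have "continuous_map (top_of_set ?Z) euclidean h"
  proof (rule pasting_lemma_closed[where I = "carrier GG" and T = "\<lambda>d. ?Z \<inter> UNIV \<times> pt d ` P"
        and f = "\<lambda>d (t, x). pt d (shrink e (t, fst x))"])
    show "finite (carrier GG)" by (rule finite_GG)
    show "closedin (top_of_set ?Z) (?Z \<inter> UNIV \<times> pt d ` P)" for d
      by (intro closedin_closed_Int closed_Times closed_UNIV closed_chamber)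
    show "continuous_map (subtopology (top_of_set ?Z) (?Z \<inter> UNIV \<times> pt d ` P)) euclidean
        (\<lambda>(t, x). pt d (shrink e (t, fst x)))" for d
      by (simp add: subtopology_subtopology shrink_def split_def continuous_intros)
    show "(\<lambda>(t, x). pt d (shrink e (t, fst x))) y = (\<lambda>(t, x). pt d' (shrink e (t, fst x))) y"
      if "d \<in> carrier GG" "d' \<in> carrier GG"
        "y \<in> topspace (top_of_set ?Z) \<inter> (?Z \<inter> UNIV \<times> pt d ` P) \<inter> (?Z \<inter> UNIV \<times> pt d' ` P)" for d d' y
    proof -
      obtain t x where y: "y = (t, x)" by (cases y)
      have "x \<in> pt d ` P" "x \<in> pt d' ` P" "x \<in> Q e" using that y by auto
      then obtain z z' where "x = pt d z" "x = pt d' z'" "z \<in> star N e" by (metis imageE pt_in_Q)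
      moreover then have "z' = z" by (metis fst_pt)
      ultimately show ?thesis using pt_shrink_cong[OF e _ that(1,2)] y by auto
    qed
    show "\<exists>d. d \<in> carrier GG \<and> y \<in> ?Z \<inter> UNIV \<times> pt d ` P \<and> h y = (\<lambda>(t, x). pt d (shrink e (t, fst x))) y"
      if y: "y \<in> topspace (top_of_set ?Z)" for y
    proof -
      obtain t x where tx: "y = (t, x)" by (cases y)
      then obtain d z where "d \<in> carrier GG" "z \<in> P" "x = pt d z" using y by (auto elim: in_M_E)
      then show ?thesis using h[of d z t] y tx by (intro exI[of _ d]) auto
    qed
  qed
  then have cont: "continuous_on ?Z h" by simp
  have img: "h ` ?Z \<subseteq> M \<inter> Q e"
  proof
    fix y assume "y \<in> h ` ?Z"
    then obtain t d z where "t \<in> {0..1}" "d \<in> carrier GG" "z \<in> P" "z \<in> star N e" "y = h (t, pt d z)"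
      by (auto elim!: in_M_E)
    then show "y \<in> M \<inter> Q e" using h shrink_closed[OF e] pt_in_M by simp
  qed
  have h0: "h (0, x) = x" if "x \<in> M \<inter> Q e" for x
    using that h[of _ _ 0] by (auto elim!: in_M_E simp: shrink_def)
  have h1: "h (1, x) = pt \<one>\<^bsub>GG\<^esub> (vertex N e)" if "x \<in> M \<inter> Q e" for x
  proof -
    obtain d z where d: "d \<in> carrier GG" "z \<in> P" "x = pt d z" "z \<in> star N e"
      using \<open>x \<in> _\<close> by (auto elim!: in_M_E)
    \<comment> \<open>The two sides at a vertex have consecutive numbers modulo the even
      \<open>N\<close>. Both parities occur, so all chambers have the same point there.\<close>
    have zero: "parity_dist m r (vertex N e) = 0" if "r < 2" for r
    proof -
      have "\<exists>\<sigma><N. incident N e \<sigma> \<and> \<sigma> mod 2 = r"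
      proof (cases "e mod 2 = r")
        case True
        then show ?thesis using e by (auto simp: incident_def)
      next
        case False
        define \<sigma> where "\<sigma> = (if e = 0 then N - 1 else e - 1)"
        have "\<sigma> < N" "Suc \<sigma> mod N = e" using e m by (auto simp: \<sigma>_def)
        moreover have "\<sigma> mod 2 = r"
        proof (cases "e = 0")
          case True
          have "\<sigma> = 2 * (m - 1) + 1" using True m by (simp add: \<sigma>_def)
          moreover have "r = 1" using False True that by simp
          ultimately show ?thesis by simp
        next
          case False
          then have "e = Suc \<sigma>" by (simp add: \<sigma>_def)
          then show ?thesis using \<open>e mod 2 \<noteq> r\<close> that by presburger
        qed
        ultimately show ?thesis by (auto simp: incident_def)
      qed
      then obtain \<sigma> where \<sigma>: "\<sigma> < N" "incident N e \<sigma>" "\<sigma> mod 2 = r" by blast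
      have "side_dist N \<sigma> (vertex N e) = 0"
        by (rule side_dist_incident_vertex[OF N_ge_3 e \<sigma>(1,2)])
      moreover have "\<sigma> = 2 * (\<sigma> div 2) + r" "\<sigma> div 2 < m" using \<sigma> by auto
      ultimately show ?thesis by (metis parity_dist_eq_0)
    qed
    then have "pt d (vertex N e) = pt \<one>\<^bsub>GG\<^esub> (vertex N e)"
      using d(1) zero[of 0] zero[of 1] by (subst pt_eq_iff) auto
    then show ?thesis using h[OF d(1,2,4)] d(3) by (simp add: shrink_def)
  qed
  have "homotopic_with (\<lambda>_. True) (top_of_set (M \<inter> Q e)) (top_of_set (M \<inter> Q e)) id (\<lambda>_. pt \<one>\<^bsub>GG\<^esub> (vertex N e))"
    using cont img h0 h1
    by (subst homotopic_with) (auto simp: image_subset_iff Pi_iff intro!: exI[of _ h])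
  then show ?thesis unfolding contractible_def by blast
qed

lemma homotopic_in_star:
  assumes "e < N" "path p" "path q" "path_image p \<subseteq> M \<inter> Q e" "path_image q \<subseteq> M \<inter> Q e"
    "pathstart p = pathstart q" "pathfinish p = pathfinish q"
  shows "homotopic_paths M p q"
proof (rule homotopic_paths_subset)
  show "homotopic_paths (M \<inter> Q e) p q"
    using contractible_imp_simply_connected[OF contractible_star[OF assms(1)]] assms
    unfolding simply_connected_eq_homotopic_paths by metis
qed auto

section \<open>The cocycle\<close>

text \<open>Side \<open>2 k + 1\<close> of the polygon is stabilised by $G_{1,k}$ and side \<open>2 k + 2\<close> (modulo \<open>2 m\<close>) by
  $G_{2,k}$, so that vertex \<open>e\<close> is stabilised by $G_{1,k} \times G_{2,l}$ with \<open>k = level1 e\<close> and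
  \<open>l = level2 e\<close>.\<close>

definition level2 :: "nat \<Rightarrow> nat" where
  "level2 e = (if e div 2 = 0 then m - 1 else e div 2 - 1)"

definition level1 :: "nat \<Rightarrow> nat" where
  "level1 e = (if even e then level2 e else e div 2)"

lemma level_less: "e < N \<Longrightarrow> level1 e < m" "e < N \<Longrightarrow> level2 e < m"
  using m by (auto simp: level1_def level2_def)

definition vertex_emb :: "nat \<Rightarrow> 'a \<times> 'b \<Rightarrow> (nat \<times> 'a + nat \<times> 'b) word set" where
  "vertex_emb e d = gen (Inl (level1 e, fst d)) \<otimes>\<^bsub>\<Gamma>\<^esub> gen (Inr (level2 e, snd d))"

text \<open>The two sides at vertex \<open>e\<close> carry groups that are neighbours in the cycle:
  $G_{1,k}$ and $G_{2,k}$ for even \<open>e\<close>, $G_{2,k}$ and $G_{1,k+1}$ for odd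
  \<open>e\<close>.\<close>

lemma level_commute:
  assumes "e < N" "g \<in> carrier G1" "h \<in> carrier G2"
  shows "gen (Inl (level1 e, g)) \<otimes>\<^bsub>\<Gamma>\<^esub> gen (Inr (level2 e, h)) =
    gen (Inr (level2 e, h)) \<otimes>\<^bsub>\<Gamma>\<^esub> gen (Inl (level1 e, g))"
proof (cases "even e")
  case True
  then show ?thesis using gen_commute assms level_less[OF assms(1)] by (simp add: level1_def)
next
  case False
  have "Suc (level2 e) mod m = e div 2" using assms(1) m by (auto simp: level2_def)
  then show ?thesis using gen_commute'[of "level2 e"] False assms level_less[OF assms(1)] by (simp add: level1_def)
qed

lemma vertex_emb_hom:
  assumes e: "e < N"
  shows "vertex_emb e \<in> hom GG \<Gamma>"
proof -
  have l: "level1 e < m" "level2 e < m" using level_less e by auto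
  have "gen (Inl (level1 e, g \<otimes>\<^bsub>G1\<^esub> g')) \<otimes>\<^bsub>\<Gamma>\<^esub> gen (Inr (level2 e, h \<otimes>\<^bsub>G2\<^esub> h')) =
      gen (Inl (level1 e, g)) \<otimes>\<^bsub>\<Gamma>\<^esub> gen (Inr (level2 e, h)) \<otimes>\<^bsub>\<Gamma>\<^esub>
      (gen (Inl (level1 e, g')) \<otimes>\<^bsub>\<Gamma>\<^esub> gen (Inr (level2 e, h')))"
    if *: "g \<in> carrier G1" "g' \<in> carrier G1" "h \<in> carrier G2" "h' \<in> carrier G2" for g g' h h'
  proof -
    let ?a = "gen (Inl (level1 e, g))" and ?a' = "gen (Inl (level1 e, g'))"
      and ?b = "gen (Inr (level2 e, h))" and ?b' = "gen (Inr (level2 e, h'))"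
    have c: "?a \<in> carrier \<Gamma>" "?a' \<in> carrier \<Gamma>" "?b \<in> carrier \<Gamma>" "?b' \<in> carrier \<Gamma>"
      using * l by simp_all
    have "?a \<otimes>\<^bsub>\<Gamma>\<^esub> ?a' \<otimes>\<^bsub>\<Gamma>\<^esub> (?b \<otimes>\<^bsub>\<Gamma>\<^esub> ?b') = ?a \<otimes>\<^bsub>\<Gamma>\<^esub> (?a' \<otimes>\<^bsub>\<Gamma>\<^esub> ?b) \<otimes>\<^bsub>\<Gamma>\<^esub> ?b'"
      using c by (simp add: m_assoc)
    also have "\<dots> = ?a \<otimes>\<^bsub>\<Gamma>\<^esub> (?b \<otimes>\<^bsub>\<Gamma>\<^esub> ?a') \<otimes>\<^bsub>\<Gamma>\<^esub> ?b'"
      using level_commute[OF e *(2,3)] by simp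
    also have "\<dots> = ?a \<otimes>\<^bsub>\<Gamma>\<^esub> ?b \<otimes>\<^bsub>\<Gamma>\<^esub> (?a' \<otimes>\<^bsub>\<Gamma>\<^esub> ?b')"
      using c by (simp add: m_assoc)
    finally show ?thesis using gen_hom1[OF l(1)] gen_hom2[OF l(2)] * by (simp add: hom_def)
  qed
  then show ?thesis using l by (auto simp: hom_def carrier_GG vertex_emb_def mult_DirProd')
qed

lemma vertex_emb_closed: "e < N \<Longrightarrow> d \<in> carrier GG \<Longrightarrow> vertex_emb e d \<in> carrier \<Gamma>"
  using vertex_emb_hom by (auto simp: hom_def)

lemma gen_one:
  "k < m \<Longrightarrow> gen (Inl (k, \<one>\<^bsub>G1\<^esub>)) = \<one>\<^bsub>\<Gamma>\<^esub>" "k < m \<Longrightarrow> gen (Inr (k, \<one>\<^bsub>G2\<^esub>)) = \<one>\<^bsub>\<Gamma>\<^esub>"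
  using hom_one[OF gen_hom1 G1.group_axioms group_presented_group]
    hom_one[OF gen_hom2 G2.group_axioms group_presented_group] by auto

lemma vertex_emb_fst: "e < N \<Longrightarrow> g \<in> carrier G1 \<Longrightarrow> vertex_emb e (g, \<one>\<^bsub>G2\<^esub>) = gen (Inl (level1 e, g))"
  and vertex_emb_snd: "e < N \<Longrightarrow> h \<in> carrier G2 \<Longrightarrow> vertex_emb e (\<one>\<^bsub>G1\<^esub>, h) = gen (Inr (level2 e, h))"
  by (simp_all add: vertex_emb_def gen_one level_less)

lemma proj_vertex_emb: "e < N \<Longrightarrow> d \<in> carrier GG \<Longrightarrow> proj (vertex_emb e d) = d"
  using level_less[of e] by (cases d) (auto simp: vertex_emb_def carrier_GG proj_gen_eq proj_gen_def)

text \<open>The group attached to a side is seen from both of its ends. Side \<open>0\<close> is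
  side \<open>2 * k + 2\<close> modulo \<open>N\<close> for \<open>k = m - 1\<close>, whence the
  special case.\<close>

lemma level_side:
  assumes "k < m" "e < N"
  shows "incident N e (2 * k + 1) \<Longrightarrow> level1 e = k"
    and "incident N e (2 * k) \<Longrightarrow> level2 e = (if k = 0 then m - 1 else k - 1)"
proof -
  assume "incident N e (2 * k + 1)"
  then consider "e = 2 * k + 1" | "e = 2 * k + 2" "k + 1 < m" | "e = 0" "k + 1 = m"
    using assms by (cases "k + 1 = m") (auto simp: incident_def)
  then show "level1 e = k" by cases (auto simp: level1_def level2_def)
next
  assume "incident N e (2 * k)"
  then have "e = 2 * k \<or> e = 2 * k + 1" using assms by (auto simp: incident_def)
  then show "level2 e = (if k = 0 then m - 1 else k - 1)" by (auto simp: level2_def)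
qed

text \<open>For \<open>e \<noteq> f\<close> a point of both stars lies on at most one side, which
  then joins the two vertices. The chambers differ only in the group attached to that side, on which
  both embeddings agree, and this factor cancels from the quotient.\<close>

lemma cocycle_chambers:
  assumes ef: "e < N" "f < N" and z: "z \<in> star N e" "z \<in> star N f"
    and d: "d \<in> carrier GG" "d' \<in> carrier GG" "pt d z = pt d' z"
  shows "vertex_emb e d \<otimes>\<^bsub>\<Gamma>\<^esub> inv\<^bsub>\<Gamma>\<^esub> vertex_emb f d = vertex_emb e d' \<otimes>\<^bsub>\<Gamma>\<^esub> inv\<^bsub>\<Gamma>\<^esub> vertex_emb f d'"
proof (cases "e = f")
  case True
  then show ?thesis using vertex_emb_closed ef d by simp
next
  case False
  obtain g h g' h' where gh: "d = (g, h)" "d' = (g', h')" "g \<in> carrier G1" "h \<in> carrier G2"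
      "g' \<in> carrier G1" "h' \<in> carrier G2"
    using d by (auto simp: carrier_GG)
  \<comment> \<open>The common factor \<open>c\<close> has to stand on the right, next to the
    inverse. The two components of a pair commute, so either of them can be put there.\<close>
  have cancel: "vertex_emb e (a \<otimes>\<^bsub>GG\<^esub> c) \<otimes>\<^bsub>\<Gamma>\<^esub> inv\<^bsub>\<Gamma>\<^esub> vertex_emb f (a \<otimes>\<^bsub>GG\<^esub> c) =
      vertex_emb e a \<otimes>\<^bsub>\<Gamma>\<^esub> inv\<^bsub>\<Gamma>\<^esub> vertex_emb f a"
    if "a \<in> carrier GG" "c \<in> carrier GG" "vertex_emb e c = vertex_emb f c" for a c
  proof -
    let ?x = "vertex_emb f c"
    have cl: "vertex_emb e a \<in> carrier \<Gamma>" "vertex_emb f a \<in> carrier \<Gamma>" "?x \<in> carrier \<Gamma>"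
      using vertex_emb_closed ef that by auto
    have "?x \<otimes>\<^bsub>\<Gamma>\<^esub> (inv\<^bsub>\<Gamma>\<^esub> ?x \<otimes>\<^bsub>\<Gamma>\<^esub> y) = y" if "y \<in> carrier \<Gamma>" for y
      using cl that by (simp add: m_assoc[symmetric])
    then show ?thesis
      using cl that vertex_emb_hom[OF ef(1)] vertex_emb_hom[OF ef(2)]
      by (simp add: hom_mult inv_mult_group m_assoc)
  qed
  have 1: "level1 e = level1 f" "\<exists>k<m. incident N e (2 * k + 1) \<and> incident N f (2 * k + 1)"
    if odd: "parity_dist m 1 z = 0"
  proof -
    obtain k where k: "k < m" "side_dist N (2 * k + 1) z = 0" using odd by (auto simp: parity_dist_eq_0)
    then have i: "incident N e (2 * k + 1)" "incident N f (2 * k + 1)"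
      using star_side[OF z(1)] star_side[OF z(2)] by auto
    then show "level1 e = level1 f" using level_side(1) k ef by metis
    show "\<exists>k<m. incident N e (2 * k + 1) \<and> incident N f (2 * k + 1)" using i k by blast
  qed
  have 2: "level2 e = level2 f" "\<exists>k<m. incident N e (2 * k) \<and> incident N f (2 * k)"
    if even: "parity_dist m 0 z = 0"
  proof -
    obtain k where k: "k < m" "side_dist N (2 * k) z = 0" using even by (auto simp: parity_dist_eq_0)
    then have i: "incident N e (2 * k)" "incident N f (2 * k)"
      using star_side[OF z(1)] star_side[OF z(2)] by auto
    then show "level2 e = level2 f" using level_side(2) k ef by metis
    show "\<exists>k<m. incident N e (2 * k) \<and> incident N f (2 * k)" using i k by blast
  qed
  have "\<not> (parity_dist m 1 z = 0 \<and> parity_dist m 0 z = 0)"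
  proof
    assume "parity_dist m 1 z = 0 \<and> parity_dist m 0 z = 0"
    then obtain k l where kl: "k < m" "l < m" "incident N e (2 * k + 1)" "incident N f (2 * k + 1)"
        "incident N e (2 * l)" "incident N f (2 * l)" using 1 2 by blast
    then have "2 * k + 1 = 2 * l"
      using incident_unique[OF N_ge_3 False ef, of "2 * k + 1" "2 * l"] by auto
    then show False by presburger
  qed
  then consider "g = g'" "h = h'" | "parity_dist m 1 z = 0" "h = h'" | "parity_dist m 0 z = 0" "g = g'"
    using d gh by (auto simp: pt_eq_iff)
  then show ?thesis
  proof cases
    case 1
    then show ?thesis using gh by simp
  next
    case 2
    have "vertex_emb e (x, \<one>\<^bsub>G2\<^esub>) = vertex_emb f (x, \<one>\<^bsub>G2\<^esub>)" if "x \<in> carrier G1" for x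
      using 1(1)[OF 2(1)] that ef by (simp add: vertex_emb_fst)
    then show ?thesis
      using cancel[of "(\<one>\<^bsub>G1\<^esub>, h)" "(g, \<one>\<^bsub>G2\<^esub>)"] cancel[of "(\<one>\<^bsub>G1\<^esub>, h)" "(g', \<one>\<^bsub>G2\<^esub>)"] gh 2(2)
      by (simp add: carrier_GG)
  next
    case 3
    have "vertex_emb e (\<one>\<^bsub>G1\<^esub>, x) = vertex_emb f (\<one>\<^bsub>G1\<^esub>, x)" if "x \<in> carrier G2" for x
      using 2(1)[OF 3(1)] that ef by (simp add: vertex_emb_snd)
    then show ?thesis
      using cancel[of "(g, \<one>\<^bsub>G2\<^esub>)" "(\<one>\<^bsub>G1\<^esub>, h)"] cancel[of "(g, \<one>\<^bsub>G2\<^esub>)" "(\<one>\<^bsub>G1\<^esub>, h')"] gh 3(2)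
      by (simp add: carrier_GG)
  qed
qed

definition chamber :: "complex \<times> real \<times> real \<Rightarrow> 'a \<times> 'b" where
  "chamber x = (SOME d. d \<in> carrier GG \<and> x \<in> pt d ` P)"

lemma chamber:
  assumes "x \<in> M"
  shows "chamber x \<in> carrier GG" "x \<in> pt (chamber x) ` P" "pt (chamber x) (fst x) = x"
proof -
  have "\<exists>d. d \<in> carrier GG \<and> x \<in> pt d ` P" using assms by (auto simp: M_eq)
  then have "chamber x \<in> carrier GG \<and> x \<in> pt (chamber x) ` P" unfolding chamber_def by (rule someI_ex)
  then show "chamber x \<in> carrier GG" "x \<in> pt (chamber x) ` P" "pt (chamber x) (fst x) = x" by auto
qed

sublocale H: holonomy \<Gamma> M "{..<N}" Q "\<lambda>e x. vertex_emb e (chamber x)"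
proof (intro holonomy.intro holonomy_axioms.intro)
  show "group \<Gamma>" by (rule group_presented_group)
  show "open (Q e)" for e by (rule open_Q)
  show "\<exists>e\<in>{..<N}. x \<in> Q e" if "x \<in> M" for x
    using that star_cover[OF N_ge_3] by (force elim!: in_M_E)
  show "vertex_emb e (chamber x) \<in> carrier \<Gamma>" if "e \<in> {..<N}" "x \<in> M" for e x
    using that vertex_emb_closed chamber by simp
  show "\<exists>V. open V \<and> x \<in> V \<and> (\<forall>y\<in>V \<inter> M.
      vertex_emb e (chamber y) \<otimes>\<^bsub>\<Gamma>\<^esub> inv\<^bsub>\<Gamma>\<^esub> vertex_emb f (chamber y) =
      vertex_emb e (chamber x) \<otimes>\<^bsub>\<Gamma>\<^esub> inv\<^bsub>\<Gamma>\<^esub> vertex_emb f (chamber x))"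
    if ef: "e \<in> {..<N}" "f \<in> {..<N}" and x: "x \<in> M" "x \<in> Q e" "x \<in> Q f" for e f x
  proof -
    \<comment> \<open>Removing the finitely many closed chambers that miss \<open>x\<close> leaves a
      neighbourhood of \<open>x\<close> in which only chambers containing \<open>x\<close> are
      met.\<close>
    let ?V = "- (\<Union>d\<in>{d \<in> carrier GG. x \<notin> pt d ` P}. pt d ` P)"
    have "open ?V"
      using finite_GG by (intro open_Compl closed_UN closed_chamber ballI) auto
    moreover have "vertex_emb e (chamber y) \<otimes>\<^bsub>\<Gamma>\<^esub> inv\<^bsub>\<Gamma>\<^esub> vertex_emb f (chamber y) =
        vertex_emb e (chamber x) \<otimes>\<^bsub>\<Gamma>\<^esub> inv\<^bsub>\<Gamma>\<^esub> vertex_emb f (chamber x)" if "y \<in> ?V \<inter> M" for y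
    proof -
      have "x \<in> pt (chamber y) ` P" using that chamber(1,2)[of y] by blast
      then have "pt (chamber y) (fst x) = pt (chamber x) (fst x)" using chamber(3)[OF x(1)] by auto
      then show ?thesis
        using that ef x chamber(1) by (intro cocycle_chambers[of e f "fst x"]) (auto simp: Q_def)
    qed
    ultimately show ?thesis by (intro exI[of _ ?V]) auto
  qed
qed

end

section \<open>Paths crossing the sides of chambers\<close>

context bourdon_complex
begin

declare carrier_DirProd [simp del] one_DirProd [simp del]

fun side_of :: "nat \<times> 'a + nat \<times> 'b \<Rightarrow> nat" where
  "side_of (Inl (k, _)) = 2 * k + 1"
| "side_of (Inr (k, _)) = 2 * (Suc k mod m)"

lemma side_of_less: "s \<in> S \<Longrightarrow> side_of s < N"
proof (induction s rule: side_of.induct)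
  case (2 k h)
  have "Suc k mod m < m" by (rule Suc_mod_less)
  then show ?case by simp
qed auto

abbreviation "lval \<equiv> letter_val GG proj_gen"
abbreviation "wval \<equiv> word_val GG proj_gen"

lemmas proj_gen_closed = bourdon_family_closed[OF proj_family]

lemma lval_closed [simp]: "fst l \<in> S \<Longrightarrow> lval l \<in> carrier GG"
  by (rule GG.letter_val_closed[OF proj_gen_closed])

lemma wval_closed [simp]: "w \<in> words S \<Longrightarrow> wval w \<in> carrier GG"
  by (rule GG.word_val_closed[OF proj_gen_closed])

lemma wval_append: "u \<in> words S \<Longrightarrow> v \<in> words S \<Longrightarrow> wval (u @ v) = wval u \<otimes>\<^bsub>GG\<^esub> wval v"
  by (rule GG.word_val_append[OF proj_gen_closed])

abbreviation "ctr \<equiv> center N"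

lemma ctr_P: "ctr \<in> P" and ctr_star: "ctr \<in> star N e"
  using center_in_polygon[OF N_pos] center_in_star[OF N_ge_3] by auto

lemma path_pt: "path p \<Longrightarrow> path (\<lambda>t. pt d (p t))"
  by (simp add: path_def continuous_intros)

lemma path_image_pt:
  assumes "d \<in> carrier GG" "path_image p \<subseteq> P \<inter> star N e"
  shows "path_image (\<lambda>t. pt d (p t)) \<subseteq> M \<inter> Q e"
proof -
  have "p t \<in> P" "p t \<in> star N e" if "t \<in> {0..1}" for t
    using assms(2) that by (auto simp: path_image_def)
  then show ?thesis using pt_in_M[OF assms(1)] by (auto simp: path_image_def simp del: atLeastAtMost_iff)
qed

text \<open>Changes chambers at the midpoint of side \<open>\<sigma>\<close>, so it is continuous
  when \<open>c\<close> and \<open>d\<close> coincide there.\<close>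

definition cross :: "nat \<Rightarrow> 'a \<times> 'b \<Rightarrow> 'a \<times> 'b \<Rightarrow> real \<Rightarrow> complex \<times> real \<times> real" where
  "cross \<sigma> c d = (\<lambda>t. pt c (side_path N \<sigma> t)) +++ reversepath (\<lambda>t. pt d (side_path N \<sigma> t))"

text \<open>A letter changes only one index, the one that gluing forgets on the side attached to the
  letter.\<close>

lemma pt_side_middle:
  assumes "fst l \<in> S" "c \<in> carrier GG"
  defines "\<sigma> \<equiv> side_of (fst l)"
  shows "pt c (side_point N \<sigma> t) = pt (c \<otimes>\<^bsub>GG\<^esub> lval l) (side_point N \<sigma> t)"
proof -
  obtain s b where l: "l = (s, b)" by fastforce
  have zero: "side_dist N \<sigma> (side_point N \<sigma> t) = 0"
    unfolding \<sigma>_def by (intro side_dist_side_point[OF N_ge_3] side_of_less assms(1))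
  obtain g h where c: "c = (g, h)" "g \<in> carrier G1" "h \<in> carrier G2" using assms by (auto simp: carrier_GG)
  have cl: "c \<otimes>\<^bsub>GG\<^esub> lval l \<in> carrier GG" using assms by simp
  show ?thesis
  proof (cases s)
    case (Inl kg)
    obtain k g' where kg: "kg = (k, g')" by fastforce
    have "k < m" "g' \<in> carrier G1" using assms l Inl kg by auto
    moreover have "parity_dist m 1 (side_point N \<sigma> t) = 0"
      using zero \<open>k < m\<close> unfolding \<sigma>_def l Inl kg by (auto simp: parity_dist_eq_0 intro!: exI[of _ k])
    moreover have "snd (c \<otimes>\<^bsub>GG\<^esub> lval l) = snd c"
      using c l Inl kg \<open>g' \<in> carrier G1\<close>
      by (auto simp: proj_gen_def inv_DirProd[OF G1.group_axioms G2.group_axioms])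
    ultimately show ?thesis using assms(2) cl by (simp add: pt_eq_iff)
  next
    case (Inr kh)
    obtain k h' where kh: "kh = (k, h')" by fastforce
    have "k < m" "h' \<in> carrier G2" using assms l Inr kh by auto
    moreover have "parity_dist m 0 (side_point N \<sigma> t) = 0"
      using zero Suc_mod_less[of k] unfolding \<sigma>_def l Inr kh
      by (auto simp: parity_dist_eq_0 intro!: exI[of _ "Suc k mod m"])
    moreover have "fst (c \<otimes>\<^bsub>GG\<^esub> lval l) = fst c"
      using c l Inr kh \<open>h' \<in> carrier G2\<close>
      by (auto simp: proj_gen_def inv_DirProd[OF G1.group_axioms G2.group_axioms])
    ultimately show ?thesis using assms(2) cl by (simp add: pt_eq_iff)
  qed
qed

lemma cross:
  assumes "fst l \<in> S" "c \<in> carrier GG"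
  defines "p \<equiv> cross (side_of (fst l)) c (c \<otimes>\<^bsub>GG\<^esub> lval l)"
  shows "path p" "pathstart p = pt c ctr" "pathfinish p = pt (c \<otimes>\<^bsub>GG\<^esub> lval l) ctr"
    "incident N e (side_of (fst l)) \<Longrightarrow> path_image p \<subseteq> M \<inter> Q e"
proof -
  let ?\<sigma> = "side_of (fst l)" and ?d = "c \<otimes>\<^bsub>GG\<^esub> lval l"
  have d: "?d \<in> carrier GG" using assms by simp
  have path: "path (side_path N ?\<sigma>)" by (simp add: side_path_def)
  have meet: "pathfinish (\<lambda>t. pt c (side_path N ?\<sigma> t)) = pathfinish (\<lambda>t. pt ?d (side_path N ?\<sigma> t))"
    using pt_side_middle[OF assms(1,2), of "1 / 2"]
    by (simp add: pathfinish_def side_path_def linepath_def)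
  then show "path p" unfolding p_def cross_def
    by (intro path_join_imp path_pt path) (simp_all add: path_pt path)
  show "pathstart p = pt c ctr" "pathfinish p = pt ?d ctr"
    by (simp_all add: p_def cross_def pathstart_def pathfinish_def joinpaths_def reversepath_def
        side_path_def linepath_def)
  assume e: "incident N e ?\<sigma>"
  have img: "path_image (side_path N ?\<sigma>) \<subseteq> P \<inter> star N e"
    using side_path_star[OF N_ge_3 side_of_less[OF assms(1)] e] by (auto simp: path_image_def)
  show "path_image p \<subseteq> M \<inter> Q e"
    unfolding p_def cross_def using path_image_pt[OF assms(2) img] path_image_pt[OF d img]
    by (intro subset_path_image_join) simp_all
qed

text \<open>A gallery of chambers: letters multiply the current chamber on the right, so the
  prefixes of the word give the chambers passed.\<close>

fun word_path :: "'a \<times> 'b \<Rightarrow> (nat \<times> 'a + nat \<times> 'b) word \<Rightarrow> real \<Rightarrow> complex \<times> real \<times> real" where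
  "word_path c [] = linepath (pt c ctr) (pt c ctr)"
| "word_path c (l # w) = cross (side_of (fst l)) c (c \<otimes>\<^bsub>GG\<^esub> lval l) +++ word_path (c \<otimes>\<^bsub>GG\<^esub> lval l) w"

lemma pathstart_word_path [simp]:
  "w \<in> words S \<Longrightarrow> c \<in> carrier GG \<Longrightarrow> pathstart (word_path c w) = pt c ctr"
  by (cases w) (auto simp: cross(2))

lemma pathfinish_word_path [simp]:
  "w \<in> words S \<Longrightarrow> c \<in> carrier GG \<Longrightarrow> pathfinish (word_path c w) = pt (c \<otimes>\<^bsub>GG\<^esub> wval w) ctr"
proof (induction w arbitrary: c)
  case (Cons l w)
  then show ?case using lval_closed[of l] by (simp add: GG.m_assoc)
qed simp

lemma path_word_path [simp]: "w \<in> words S \<Longrightarrow> c \<in> carrier GG \<Longrightarrow> path (word_path c w)"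
  by (induction w arbitrary: c) (auto simp: cross intro!: path_join_imp)

lemma word_path_star:
  assumes "\<forall>l\<in>set w. incident N e (side_of (fst l))" "w \<in> words S" "c \<in> carrier GG"
  shows "path_image (word_path c w) \<subseteq> M \<inter> Q e"
  using assms
proof (induction w arbitrary: c)
  case Nil
  then show ?case using pt_in_M[OF _ ctr_P] ctr_star by simp
next
  case (Cons l w)
  then have "path_image (cross (side_of (fst l)) c (c \<otimes>\<^bsub>GG\<^esub> lval l)) \<subseteq> M \<inter> Q e"
    by (intro cross(4)) auto
  moreover have "path_image (word_path (c \<otimes>\<^bsub>GG\<^esub> lval l) w) \<subseteq> M \<inter> Q e"
    using Cons.prems by (intro Cons.IH) auto
  ultimately show ?case unfolding word_path.simps by (rule subset_path_image_join)
qed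

lemma word_path_M [simp]:
  assumes "w \<in> words S" "c \<in> carrier GG"
  shows "path_image (word_path c w) \<subseteq> M"
  using assms
proof (induction w arbitrary: c)
  case Nil
  then show ?case using pt_in_M[OF _ ctr_P] by simp
next
  case (Cons l w)
  then have "path_image (cross (side_of (fst l)) c (c \<otimes>\<^bsub>GG\<^esub> lval l)) \<subseteq> M \<inter> Q (side_of (fst l))"
    by (intro cross(4)) (auto simp: incident_def)
  then have "path_image (cross (side_of (fst l)) c (c \<otimes>\<^bsub>GG\<^esub> lval l)) \<subseteq> M" by blast
  moreover have "path_image (word_path (c \<otimes>\<^bsub>GG\<^esub> lval l) w) \<subseteq> M"
    using Cons.prems by (intro Cons.IH) auto
  ultimately show ?case unfolding word_path.simps by (rule subset_path_image_join)
qed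

lemma word_path_local:
  assumes "e < N" "\<forall>l\<in>set w. incident N e (side_of (fst l))" "w \<in> words S" "c \<in> carrier GG" "wval w = \<one>\<^bsub>GG\<^esub>"
  shows "homotopic_paths M (word_path c w) (word_path c [])"
  using assms(5)
  by (intro homotopic_in_star[OF assms(1)] word_path_star assms)
    (use assms in \<open>auto simp del: word_path.simps\<close>)

lemma word_path_append:
  assumes "u \<in> words S" "v \<in> words S" "c \<in> carrier GG"
  shows "homotopic_paths M (word_path c (u @ v)) (word_path c u +++ word_path (c \<otimes>\<^bsub>GG\<^esub> wval u) v)"
  using assms
proof (induction u arbitrary: c)
  case Nil
  have c: "c \<otimes>\<^bsub>GG\<^esub> wval [] = c" using Nil.prems by simp
  show ?case
    unfolding c append_Nil word_path.simps
    by (rule homotopic_paths_sym[OF homotopic_paths_lid']) (use Nil.prems in simp_all)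
next
  case (Cons l u)
  let ?d = "c \<otimes>\<^bsub>GG\<^esub> lval l" and ?x = "cross (side_of (fst l)) c (c \<otimes>\<^bsub>GG\<^esub> lval l)"
  have l: "fst l \<in> S" "u \<in> words S" and d: "?d \<in> carrier GG" using Cons.prems by auto
  have x: "path ?x" "pathfinish ?x = pt ?d ctr" "path_image ?x \<subseteq> M"
    using cross(1,3)[OF l(1) Cons.prems(3)] cross(4)[OF l(1) Cons.prems(3), of "side_of (fst l)"]
    by (auto simp: incident_def)
  have dd: "?d \<otimes>\<^bsub>GG\<^esub> wval u = c \<otimes>\<^bsub>GG\<^esub> wval (l # u)"
    using l Cons.prems lval_closed[OF l(1)] wval_closed[OF l(2)] by (simp add: GG.m_assoc)
  have "homotopic_paths M (?x +++ word_path ?d (u @ v)) (?x +++ (word_path ?d u +++ word_path (?d \<otimes>\<^bsub>GG\<^esub> wval u) v))"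
    using Cons.IH[OF l(2) Cons.prems(2) d] x Cons.prems l d
    by (intro homotopic_paths_join) auto
  also have "homotopic_paths M \<dots> ((?x +++ word_path ?d u) +++ word_path (?d \<otimes>\<^bsub>GG\<^esub> wval u) v)"
    using x Cons.prems l d wval_closed[OF l(2)] by (intro homotopic_paths_assoc) auto
  finally (homotopic_paths_trans) show ?case unfolding dd by simp
qed

text \<open>A multiplication relator crosses a single side, and its first end serves. A commutator
  crosses two sides with a common vertex, and that vertex is chosen.\<close>

lemma relator_local:
  assumes "r \<in> R"
  shows "\<exists>e<N. \<forall>l\<in>set r. incident N e (side_of (fst l))"
  using assms
proof (cases rule: relator_cases)
  case (mult1 k g h)
  then show ?thesis by (intro exI[of _ "2 * k + 1"]) (auto simp: incident_def)
next
  case (mult2 k g h)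
  then show ?thesis using side_of_less[of "Inr (k, g)"]
    by (intro exI[of _ "side_of (Inr (k, g))"]) (auto simp: incident_def)
next
  case (comm1 k g h)
  have "2 * (Suc k mod m) = Suc (2 * k + 1) mod N"
    using mult_mod_right[of 2 "Suc k" m] by simp
  then show ?thesis using comm1 side_of_less[of "Inr (k, h)"]
    by (intro exI[of _ "side_of (Inr (k, h))"]) (auto simp: incident_def commutator_word_def)
next
  case (comm2 k g h)
  define j where "j = Suc k mod m"
  have "j < m" by (simp add: j_def)
  then have "2 * j + 1 < N" by linarith
  moreover from this have "Suc (2 * j) mod N = 2 * j + 1" by simp
  moreover have "r = commutator_word (Inr (k, h)) (Inl (j, g))" using comm2 by (simp add: j_def)
  ultimately show ?thesis
    by (intro exI[of _ "2 * j + 1"]) (auto simp: incident_def commutator_word_def simp flip: j_def)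
qed

text \<open>The path spelled by \<open>r\<close> stays in one star and returns to its chamber, so it
  contracts inside that star.\<close>

lemma word_path_delete:
  assumes "u \<in> words S" "r \<in> words S" "v \<in> words S" "c \<in> carrier GG" "wval r = \<one>\<^bsub>GG\<^esub>"
    and "e < N" "\<forall>l\<in>set r. incident N e (side_of (fst l))"
  shows "homotopic_paths M (word_path c (u @ r @ v)) (word_path c (u @ v))"
proof -
  let ?d = "c \<otimes>\<^bsub>GG\<^esub> wval u"
  have d: "?d \<in> carrier GG" "?d \<otimes>\<^bsub>GG\<^esub> wval r = ?d"
    using assms wval_closed[of u] by (simp_all)
  have "homotopic_paths M (word_path ?d (r @ v)) (word_path ?d r +++ word_path ?d v)"
    using word_path_append[OF assms(2,3) d(1)] d(2) by simp
  also have "homotopic_paths M \<dots> (word_path ?d [] +++ word_path ?d v)"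
    using word_path_local[OF assms(6,7,2) d(1) assms(5)] assms d
    by (intro homotopic_paths_join) (auto simp del: word_path.simps)
  also have "homotopic_paths M \<dots> (word_path ?d v)"
    unfolding word_path.simps by (rule homotopic_paths_lid') (use assms d in simp_all)
  finally (homotopic_paths_trans) have rv: "homotopic_paths M (word_path ?d (r @ v)) (word_path ?d v)" .
  have "homotopic_paths M (word_path c (u @ r @ v)) (word_path c u +++ word_path ?d (r @ v))"
    using assms by (intro word_path_append) auto
  also have "homotopic_paths M \<dots> (word_path c u +++ word_path ?d v)"
    using rv assms d by (intro homotopic_paths_join) auto
  also have "homotopic_paths M \<dots> (word_path c (u @ v))"
    using word_path_append assms homotopic_paths_sym by blast
  finally (homotopic_paths_trans) show ?thesis .
qed

lemma word_path_step:
  assumes "word_step S R u v" "c \<in> carrier GG"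
  shows "homotopic_paths M (word_path c u) (word_path c v)"
  using assms(1)
proof cases
  case (cancel u' v' s b)
  let ?r = "[(s, b), (s, \<not> b)]"
  have "proj_gen s \<in> carrier GG" using proj_gen_closed cancel by auto
  then have "wval ?r = \<one>\<^bsub>GG\<^esub>" by (cases b) (simp_all)
  then show ?thesis
    using cancel assms(2) side_of_less[of s]
    by (auto simp: incident_def simp del: append_Cons append_Nil
        intro!: word_path_delete[of u' ?r v' c "side_of s"])
next
  case (relator u' v' r)
  obtain e where "e < N" "\<forall>l\<in>set r. incident N e (side_of (fst l))"
    using relator_local relator by blast
  moreover have "wval r = \<one>\<^bsub>GG\<^esub>"
    by (rule bourdon_family_relators[OF group_GG proj_family relator(5)])
  ultimately show ?thesis
    using relator relators_words assms(2) word_path_delete[of u' r v' c e] by auto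
qed

lemma word_path_weq:
  assumes "weq u v" "u \<in> words S" "c \<in> carrier GG"
  shows "homotopic_paths M (word_path c u) (word_path c v)"
  using assms(1)
proof (induction rule: equivclp_induct)
  case base
  then show ?case using assms by simp
next
  case (step v w)
  then have "homotopic_paths M (word_path c v) (word_path c w)"
    using word_path_step[OF _ assms(3)] homotopic_paths_sym by blast
  then show ?case using step.IH homotopic_paths_trans by blast
qed

lemma chamber_ctr: "c \<in> carrier GG \<Longrightarrow> chamber (pt c ctr) = c"
proof -
  assume c: "c \<in> carrier GG"
  have "parity_dist m r ctr \<noteq> 0" if "r < 2" for r
  proof -
    have "0 < side_dist N (2 * k + r) ctr" if "k < m" for k
      by (rule side_dist_center[OF N_ge_3]) (use that \<open>r < 2\<close> in simp)
    then show ?thesis by (force simp: parity_dist_eq_0)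
  qed
  then show ?thesis
    using chamber(1,3)[OF pt_in_M[OF c ctr_P]] c pt_eq_iff[of "chamber (pt c ctr)" c ctr ctr]
    by (auto intro: prod_eqI)
qed

text \<open>The vertex is the first end of the side crossed, which has the same number as the side;
  its group contains the group of the letter.\<close>

lemma letter_level:
  assumes "fst l \<in> S"
  obtains e where "e < N" "incident N e (side_of (fst l))" "vertex_emb e (lval l) = letter_val \<Gamma> gen l"
proof -
  obtain s b where l: "l = (s, b)" by fastforce
  let ?e = "side_of s"
  have e: "?e < N" using assms side_of_less l by simp
  have "vertex_emb ?e (proj_gen s) = gen s"
  proof (cases s)
    case (Inl kg)
    then show ?thesis using assms l e
      by (cases kg) (auto simp: proj_gen_def vertex_emb_fst level1_def)
  next
    case (Inr kh)
    obtain k h where s: "s = Inr (k, h)" using Inr by (cases kh) auto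
    then have k: "k < m" "h \<in> carrier G2" using assms l by auto
    then have "level2 (2 * (Suc k mod m)) = k"
      by (cases "Suc k = m") (auto simp: level2_def)
    then show ?thesis using s k e by (simp add: proj_gen_def vertex_emb_snd)
  qed
  then have "vertex_emb ?e (lval l) = letter_val \<Gamma> gen l"
  proof -
    interpret h: group_hom GG \<Gamma> "vertex_emb ?e"
      by (intro group_hom.intro group_hom_axioms.intro group_GG group_presented_group vertex_emb_hom e)
    have "proj_gen s \<in> carrier GG" using proj_gen_closed assms l by auto
    then show ?thesis using l \<open>vertex_emb ?e (proj_gen s) = gen s\<close> by (cases b) simp_all
  qed
  then show ?thesis using that e l by (simp add: incident_def)
qed

text \<open>Each crossing lies in one star, where its holonomy is the quotient of the images of its
  end chambers under the homomorphism \<open>vertex_emb e\<close>; this quotient is the image of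
  \<open>lval l\<close>, the letter itself.\<close>

lemma hol_word_path:
  assumes "w \<in> words S" "c \<in> carrier GG"
  shows "H.hol (word_path c w) = word_class S R w"
  using assms
proof (induction w arbitrary: c)
  case Nil
  have "H.hol (word_path c []) = inv\<^bsub>\<Gamma>\<^esub> vertex_emb 0 c \<otimes>\<^bsub>\<Gamma>\<^esub> vertex_emb 0 c"
    using H.hol_chart[of 0 "word_path c []"] word_path_star[of "[]" 0 c] Nil N_pos
    by (simp add: chamber_ctr)
  then show ?case
    using Nil vertex_emb_closed N_pos by (simp add: one_presented_group del: word_path.simps)
next
  case (Cons l w)
  let ?d = "c \<otimes>\<^bsub>GG\<^esub> lval l" and ?x = "cross (side_of (fst l)) c (c \<otimes>\<^bsub>GG\<^esub> lval l)"
  have l: "fst l \<in> S" "w \<in> words S" and d: "?d \<in> carrier GG" using Cons.prems by auto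
  obtain e where e: "e < N" "incident N e (side_of (fst l))" "vertex_emb e (lval l) = letter_val \<Gamma> gen l"
    using letter_level[OF l(1)] .
  have x: "path ?x" "pathstart ?x = pt c ctr" "pathfinish ?x = pt ?d ctr" "path_image ?x \<subseteq> M \<inter> Q e"
    using cross[OF l(1) Cons.prems(2)] e by auto
  have "H.hol ?x = inv\<^bsub>\<Gamma>\<^esub> vertex_emb e c \<otimes>\<^bsub>\<Gamma>\<^esub> vertex_emb e ?d"
    using H.hol_chart[of e ?x] x e d Cons.prems by (simp add: chamber_ctr)
  also have "vertex_emb e ?d = vertex_emb e c \<otimes>\<^bsub>\<Gamma>\<^esub> letter_val \<Gamma> gen l"
    using hom_mult[OF vertex_emb_hom[OF e(1)] Cons.prems(2) lval_closed[OF l(1)]] e by simp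
  also have "inv\<^bsub>\<Gamma>\<^esub> vertex_emb e c \<otimes>\<^bsub>\<Gamma>\<^esub> (vertex_emb e c \<otimes>\<^bsub>\<Gamma>\<^esub> letter_val \<Gamma> gen l) = letter_val \<Gamma> gen l"
    using vertex_emb_closed e Cons.prems l vertex_emb_closed[OF e(1) lval_closed[OF l(1)]]
    by (simp add: m_assoc[symmetric])
  finally have "H.hol (word_path c (l # w)) = letter_val \<Gamma> gen l \<otimes>\<^bsub>\<Gamma>\<^esub> word_class S R w"
    using H.hol_join[of ?x "word_path ?d w"] x Cons.IH[OF l(2) d] l d by simp
  then show ?case using word_val_gen[of "l # w"] word_val_gen[of w] Cons.prems by simp
qed

text \<open>Leads between any two chambers around vertex \<open>e\<close>: crossing the two sides at
  \<open>e\<close> in turn multiplies by an arbitrary pair.\<close>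

definition local_word :: "nat \<Rightarrow> 'a \<times> 'b \<Rightarrow> (nat \<times> 'a + nat \<times> 'b) word" where
  "local_word e d = [(Inl (level1 e, fst d), True), (Inr (level2 e, snd d), True)]"

lemma local_word:
  assumes "e < N" "d \<in> carrier GG"
  shows "local_word e d \<in> words S" "wval (local_word e d) = d"
    "\<forall>l\<in>set (local_word e d). incident N e (side_of (fst l))"
proof -
  have l: "level1 e < m" "level2 e < m" using level_less assms by auto
  then show "local_word e d \<in> words S" "wval (local_word e d) = d"
    using assms by (auto simp: local_word_def carrier_GG proj_gen_def one_DirProd)
  have 1: "incident N e (2 * level1 e + 1)"
  proof (cases "even e")
    case True
    then obtain j where j: "e = 2 * j" by (elim evenE)
    have "N = Suc (Suc (2 * (m - 1)))" using m by simp
    then show ?thesis using assms(1) m j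
      by (cases j) (simp_all add: level1_def level2_def incident_def)
  qed (auto simp: level1_def incident_def)
  have "2 * (Suc (level2 e) mod m) = 2 * (e div 2)"
    using assms(1) m by (auto simp: level2_def)
  then have 2: "incident N e (2 * (Suc (level2 e) mod m))"
    using assms(1) by (cases "even e") (auto simp: incident_def elim!: evenE oddE)
  show "\<forall>l\<in>set (local_word e d). incident N e (side_of (fst l))"
    using 1 2 by (simp add: local_word_def)
qed

definition spoke :: "'a \<times> 'b \<Rightarrow> complex \<Rightarrow> real \<Rightarrow> complex \<times> real \<times> real" where
  "spoke d z = (\<lambda>t. pt d (linepath ctr z t))"

lemma spoke:
  assumes "d \<in> carrier GG" "z \<in> P"
  shows "path (spoke d z)" "pathstart (spoke d z) = pt d ctr" "pathfinish (spoke d z) = pt d z"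
    "path_image (spoke d z) \<subseteq> M" "z \<in> star N e \<Longrightarrow> path_image (spoke d z) \<subseteq> M \<inter> Q e"
proof -
  show "path (spoke d z)" unfolding spoke_def by (intro path_pt) simp
  show "pathstart (spoke d z) = pt d ctr" "pathfinish (spoke d z) = pt d z"
    by (simp_all add: spoke_def pathstart_def pathfinish_def linepath_def)
  have "linepath ctr z t \<in> P" if "t \<in> {0..1}" for t
    using that convex_polygon[of N] ctr_P assms by (auto simp: linepath_def convex_alt)
  then show M: "path_image (spoke d z) \<subseteq> M"
    using pt_in_M[OF assms(1)] by (auto simp: spoke_def path_image_def)
  assume "z \<in> star N e"
  then have "linepath ctr z t \<in> star N e" if "t \<in> {0..1}" for t
    using that convex_star[of N e] ctr_star by (auto simp: linepath_def convex_alt)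
  then show "path_image (spoke d z) \<subseteq> M \<inter> Q e"
    using M by (auto simp: spoke_def path_image_def)
qed

end

section \<open>The fundamental group of the complex\<close>

lemma homotopic_paths_join_left:
  assumes "homotopic_paths M p p'" "path q" "path_image q \<subseteq> M" "pathfinish p = pathstart q"
  shows "homotopic_paths M (p +++ q) (p' +++ q)"
  by (rule homotopic_paths_join) (use assms in auto)

lemma homotopic_paths_join_right:
  assumes "homotopic_paths M q q'" "path p" "path_image p \<subseteq> M" "pathfinish p = pathstart q"
  shows "homotopic_paths M (p +++ q) (p +++ q')"
  by (rule homotopic_paths_join) (use assms in auto)

lemma homotopic_paths_cancel_left:
  fixes p :: "real \<Rightarrow> 'a::real_normed_vector"
  assumes p: "path p" "path_image p \<subseteq> M" and q: "path q" "path_image q \<subseteq> M"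
    and pq: "pathfinish p = pathstart q"
  shows "homotopic_paths M (reversepath p +++ (p +++ q)) q"
proof -
  have "homotopic_paths M (reversepath p +++ (p +++ q)) ((reversepath p +++ p) +++ q)"
    using p q pq by (intro homotopic_paths_assoc) auto
  also have "homotopic_paths M \<dots> (linepath (pathfinish p) (pathfinish p) +++ q)"
    using p q pq by (intro homotopic_paths_join_left homotopic_paths_linv) auto
  also have "homotopic_paths M \<dots> q"
    using q pq by (intro homotopic_paths_lid') auto
  finally (homotopic_paths_trans) show ?thesis .
qed

lemma homotopic_paths_cancel_right:
  fixes p :: "real \<Rightarrow> 'a::real_normed_vector"
  assumes p: "path p" "path_image p \<subseteq> M" and q: "path q" "path_image q \<subseteq> M"
    and pq: "pathfinish p = pathfinish q"
  shows "homotopic_paths M ((p +++ reversepath q) +++ q) p"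
proof -
  have "homotopic_paths M ((p +++ reversepath q) +++ q) (p +++ (reversepath q +++ q))"
    using p q pq by (intro homotopic_paths_sym[OF homotopic_paths_assoc]) auto
  also have "homotopic_paths M \<dots> (p +++ linepath (pathfinish p) (pathfinish p))"
    unfolding pq using p q pq by (intro homotopic_paths_join_right homotopic_paths_linv) auto
  also have "homotopic_paths M \<dots> p"
    using p by (intro homotopic_paths_rid') auto
  finally (homotopic_paths_trans) show ?thesis .
qed

lemma homotopic_paths_cancel_middle:
  fixes p :: "real \<Rightarrow> 'a::real_normed_vector"
  assumes p: "path p" "path_image p \<subseteq> M" and q: "path q" "path_image q \<subseteq> M" and r: "path r" "path_image r \<subseteq> M"
    and pq: "pathfinish p = pathfinish q" and qr: "pathfinish q = pathstart r"
  shows "homotopic_paths M ((p +++ reversepath q) +++ (q +++ r)) (p +++ r)"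
proof -
  have "homotopic_paths M ((p +++ reversepath q) +++ (q +++ r)) (p +++ (reversepath q +++ (q +++ r)))"
    using p q r pq qr by (intro homotopic_paths_sym[OF homotopic_paths_assoc]) (auto simp: path_image_join)
  also have "homotopic_paths M \<dots> (p +++ r)"
    using p q r pq qr by (intro homotopic_paths_join_right homotopic_paths_cancel_left) (auto simp: path_image_join)
  finally (homotopic_paths_trans) show ?thesis .
qed

lemma homotopic_paths_conjugate_cancel:
  fixes p :: "real \<Rightarrow> 'a::real_normed_vector"
  assumes p: "path p" "path_image p \<subseteq> M" and q: "path q" "path_image q \<subseteq> M"
    and pq: "pathfinish p = pathstart q" "pathfinish q = pathstart q"
  shows "homotopic_paths M ((reversepath p +++ ((p +++ q) +++ reversepath p)) +++ p) q"
proof -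
  have "homotopic_paths M ((p +++ q) +++ reversepath p) (p +++ (q +++ reversepath p))"
    using p q pq by (intro homotopic_paths_sym[OF homotopic_paths_assoc]) auto
  then have "homotopic_paths M (reversepath p +++ ((p +++ q) +++ reversepath p)) (reversepath p +++ (p +++ (q +++ reversepath p)))"
    by (rule homotopic_paths_join_right) (use p q pq in auto)
  also have "homotopic_paths M \<dots> (q +++ reversepath p)"
    using p q pq by (intro homotopic_paths_cancel_left) (auto simp: path_image_join)
  finally (homotopic_paths_trans)
  have "homotopic_paths M ((reversepath p +++ ((p +++ q) +++ reversepath p)) +++ p) ((q +++ reversepath p) +++ p)"
    by (rule homotopic_paths_join_left) (use p q pq in auto)
  also have "homotopic_paths M \<dots> q"
    using p q pq by (intro homotopic_paths_cancel_right) auto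
  finally (homotopic_paths_trans) show ?thesis .
qed

text \<open>\<open>\<theta>\<close> is a complete and multiplicative homotopy invariant of loops.
  Each class is a fibre of it, so the union that defines a product collapses to one class, and the
  value at any representative gives the isomorphism.\<close>

lemma fundamental_group_iso:
  assumes "subgroup K G" and group: "group G"
    and homotopic: "\<And>g h. g \<in> loops T a \<Longrightarrow> h \<in> loops T a \<Longrightarrow> loop_homotopic T a g h \<longleftrightarrow> \<theta> g = \<theta> h"
    and join: "\<And>g h. g \<in> loops T a \<Longrightarrow> h \<in> loops T a \<Longrightarrow> join_loops g h \<in> loops T a"
      "\<And>g h. g \<in> loops T a \<Longrightarrow> h \<in> loops T a \<Longrightarrow> \<theta> (join_loops g h) = \<theta> g \<otimes>\<^bsub>G\<^esub> \<theta> h"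
    and onto: "\<theta> ` loops T a = K"
  shows "fundamental_group T a \<cong> G\<lparr>carrier := K\<rparr>"
proof -
  have class_eq: "loop_class T a g = {h \<in> loops T a. \<theta> h = \<theta> g}" if g: "g \<in> loops T a" for g
  proof -
    have "h \<in> loops T a" if "loop_homotopic T a g h" for h
    proof -
      have "continuous_map (top_of_set {0..1}) T h" "h 0 = a \<and> h 1 = a"
        using homotopic_with_imp_continuous_maps homotopic_with_imp_property that
        unfolding loop_homotopic_def by blast+
      then show ?thesis by (simp add: loops_def pathin_def)
    qed
    then have "loop_homotopic T a g h \<longleftrightarrow> h \<in> loops T a \<and> \<theta> h = \<theta> g" for h
      using homotopic[OF g, of h] by metis
    then show ?thesis unfolding loop_class_def by blast
  qed
  define \<phi> where "\<phi> A = \<theta> (SOME g. g \<in> A)" for A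
  have \<phi>: "\<phi> (loop_class T a g) = \<theta> g" if g: "g \<in> loops T a" for g
  proof -
    have "(SOME h. h \<in> loop_class T a g) \<in> loop_class T a g"
      by (rule someI[of _ g]) (use class_eq[OF g] g in simp)
    then show ?thesis unfolding \<phi>_def using class_eq[OF g] by simp
  qed
  have mult: "loop_class T a g \<otimes>\<^bsub>fundamental_group T a\<^esub> loop_class T a h = loop_class T a (join_loops g h)"
    if g: "g \<in> loops T a" and h: "h \<in> loops T a" for g h
  proof -
    have "loop_class T a (join_loops g' h') = loop_class T a (join_loops g h)"
      if "g' \<in> loop_class T a g" "h' \<in> loop_class T a h" for g' h'
      using that join g h by (simp add: class_eq)
    moreover have "g \<in> loop_class T a g" "h \<in> loop_class T a h" using class_eq g h by auto
    ultimately have "(\<Union>g'\<in>loop_class T a g. \<Union>h'\<in>loop_class T a h. loop_class T a (join_loops g' h')) =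
        loop_class T a (join_loops g h)" by blast
    then show ?thesis by (simp add: fundamental_group_def)
  qed
  have carrier: "carrier (fundamental_group T a) = loop_class T a ` loops T a"
    by (simp add: fundamental_group_def)
  have "\<phi> \<in> hom (fundamental_group T a) (G\<lparr>carrier := K\<rparr>)"
    using onto join mult \<phi> by (auto simp: hom_def carrier)
  moreover have "bij_betw \<phi> (carrier (fundamental_group T a)) K"
  proof (rule bij_betw_imageI)
    show "inj_on \<phi> (carrier (fundamental_group T a))"
    proof (rule inj_onI)
      fix A B
      assume "A \<in> carrier (fundamental_group T a)" "B \<in> carrier (fundamental_group T a)" and eq: "\<phi> A = \<phi> B"
      then obtain g h where gh: "g \<in> loops T a" "h \<in> loops T a" "A = loop_class T a g" "B = loop_class T a h"
        by (auto simp: carrier)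
      then have "\<theta> g = \<theta> h" using eq \<phi> by simp
      then show "A = B" using gh by (simp add: class_eq)
    qed
    show "\<phi> ` carrier (fundamental_group T a) = K"
      using onto \<phi> by (auto simp: carrier image_image)
  qed
  ultimately show ?thesis by (auto simp: is_iso_def iso_def)
qed

section \<open>Words and homotopy classes of paths\<close>

context bourdon_complex
begin

text \<open>Completes a path between arbitrary points to one between centers. The chambers are
  parameters, since an endpoint may lie in several of them.\<close>

definition spoked :: "(real \<Rightarrow> complex \<times> real \<times> real) \<Rightarrow> 'a \<times> 'b \<Rightarrow> complex \<Rightarrow> 'a \<times> 'b \<Rightarrow> complex \<Rightarrow>
    real \<Rightarrow> complex \<times> real \<times> real" where
  "spoked g d z d' z' = (spoke d z +++ g) +++ reversepath (spoke d' z')"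

text \<open>Both paths stay in one simply connected star and have the same ends;
  \<open>local_word\<close> supplies the word.\<close>

lemma spoked_in_star:
  assumes e: "e < N" and d: "d \<in> carrier GG" "d' \<in> carrier GG" and z: "z \<in> P" "z' \<in> P"
    and g: "path g" "path_image g \<subseteq> M \<inter> Q e" "pathstart g = pt d z" "pathfinish g = pt d' z'"
  shows "\<exists>w\<in>words S. d \<otimes>\<^bsub>GG\<^esub> wval w = d' \<and> homotopic_paths M (spoked g d z d' z') (word_path d w)"
proof -
  let ?k = "inv\<^bsub>GG\<^esub> d \<otimes>\<^bsub>GG\<^esub> d'"
  let ?w = "local_word e ?k"
  have k: "?k \<in> carrier GG" "d \<otimes>\<^bsub>GG\<^esub> ?k = d'" using d by (simp_all add: GG.m_assoc[symmetric])
  have "pt d z \<in> Q e" "pt d' z' \<in> Q e" using g pathstart_in_path_image pathfinish_in_path_image by force+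
  then have st: "z \<in> star N e" "z' \<in> star N e" by auto
  note s = spoke[OF d(1) z(1)] and s' = spoke[OF d(2) z(2)]
  have "homotopic_paths M (spoked g d z d' z') (word_path d ?w)"
  proof (rule homotopic_in_star[OF e])
    show "path (spoked g d z d' z')" using s s' g by (simp add: spoked_def)
    show "path_image (spoked g d z d' z') \<subseteq> M \<inter> Q e"
      unfolding spoked_def using s(5)[OF st(1)] s'(5)[OF st(2)] g
      by (intro subset_path_image_join) auto
    show "path_image (word_path d ?w) \<subseteq> M \<inter> Q e"
      by (rule word_path_star) (use local_word[OF e k(1)] d in auto)
  qed (use local_word[OF e k(1)] s s' d k in \<open>auto simp: spoked_def\<close>)
  then show ?thesis using local_word(1,2)[OF e k(1)] k by (intro bexI[of _ ?w]) simp_all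
qed

lemma spoked_join:
  assumes d: "d \<in> carrier GG" "d' \<in> carrier GG" "d'' \<in> carrier GG" and z: "z \<in> P" "z' \<in> P" "z'' \<in> P"
    and g: "path g" "path_image g \<subseteq> M" "pathstart g = pt d z" "pathfinish g = pt d' z'"
    and h: "path h" "path_image h \<subseteq> M" "pathstart h = pt d' z'" "pathfinish h = pt d'' z''"
  shows "homotopic_paths M (spoked g d z d' z' +++ spoked h d' z' d'' z'') (spoked (g +++ h) d z d'' z'')"
proof -
  note s = spoke(1-4)[OF d(1) z(1)] and s' = spoke(1-4)[OF d(2) z(2)] and s'' = spoke(1-4)[OF d(3) z(3)]
  let ?s = "spoke d z" and ?s' = "spoke d' z'" and ?c = "reversepath (spoke d'' z'')"
  have "homotopic_paths M (spoked g d z d' z' +++ spoked h d' z' d'' z'')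
      (((?s +++ g) +++ reversepath ?s') +++ (?s' +++ (h +++ ?c)))"
    unfolding spoked_def
    by (rule homotopic_paths_join_right[OF homotopic_paths_sym[OF homotopic_paths_assoc]])
      (use s s' s'' g h in \<open>simp_all add: path_image_join\<close>)
  also have "homotopic_paths M \<dots> ((?s +++ g) +++ (h +++ ?c))"
    by (rule homotopic_paths_cancel_middle) (use s s' s'' g h in \<open>simp_all add: path_image_join\<close>)
  also have "homotopic_paths M \<dots> (((?s +++ g) +++ h) +++ ?c)"
    by (rule homotopic_paths_assoc) (use s s' s'' g h in \<open>simp_all add: path_image_join\<close>)
  also have "homotopic_paths M \<dots> ((?s +++ (g +++ h)) +++ ?c)"
    by (rule homotopic_paths_join_left[OF homotopic_paths_sym[OF homotopic_paths_assoc]])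
      (use s s' s'' g h in \<open>simp_all add: path_image_join\<close>)
  finally (homotopic_paths_trans) show ?thesis by (simp add: spoked_def)
qed

lemma spoked_cong:
  assumes "d \<in> carrier GG" "d' \<in> carrier GG" "z \<in> P" "z' \<in> P"
    "homotopic_paths M g h" "pathstart g = pt d z" "pathfinish g = pt d' z'"
  shows "homotopic_paths M (spoked g d z d' z') (spoked h d z d' z')"
  unfolding spoked_def
  by (intro homotopic_paths_join_left homotopic_paths_join_right)
    (use spoke(1-4)[OF assms(1,3)] spoke(1-4)[OF assms(2,4)] assms(5-) in auto)

text \<open>Every path is cut into pieces lying in stars of vertices, and the cuts are joined to the
  centers of chambers.\<close>

lemma spoked_word_path:
  assumes g: "path g" "path_image g \<subseteq> M"
    and d: "d \<in> carrier GG" "d' \<in> carrier GG" and z: "z \<in> P" "z' \<in> P"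
    and ends: "pathstart g = pt d z" "pathfinish g = pt d' z'"
  shows "\<exists>w\<in>words S. d \<otimes>\<^bsub>GG\<^esub> wval w = d' \<and> homotopic_paths M (spoked g d z d' z') (word_path d w)"
proof -
  \<comment> \<open>Quantifying over all chambers at the two endpoints lets adjacent pieces agree on
    a chamber at the cut. The guard makes the claim vacuous for intervals that leave
    \<open>{0..1}\<close>, which the local step of the bisection also produces.\<close>
  define A where "A a b \<longleftrightarrow> (0 \<le> a \<and> a \<le> b \<and> b \<le> 1 \<longrightarrow>
      (\<forall>d z d' z'. d \<in> carrier GG \<longrightarrow> d' \<in> carrier GG \<longrightarrow> z \<in> P \<longrightarrow> z' \<in> P \<longrightarrow> g a = pt d z \<longrightarrow> g b = pt d' z' \<longrightarrow>
        (\<exists>w\<in>words S. d \<otimes>\<^bsub>GG\<^esub> wval w = d' \<and>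
          homotopic_paths M (spoked (subpath a b g) d z d' z') (word_path d w))))" for a b
  have A_D: "\<exists>w\<in>words S. d \<otimes>\<^bsub>GG\<^esub> wval w = d' \<and>
      homotopic_paths M (spoked (subpath a b g) d z d' z') (word_path d w)"
    if "A a b" "d \<in> carrier GG" "d' \<in> carrier GG" "z \<in> P" "z' \<in> P" "g a = pt d z" "g b = pt d' z'"
      "0 \<le> a" "a \<le> b" "b \<le> 1" for a b d d' z z'
    by (rule that(1)[unfolded A_def, rule_format]) (use that in auto)
  have sub: "path (subpath a b g)" "path_image (subpath a b g) \<subseteq> M" "pathstart (subpath a b g) = g a"
      "pathfinish (subpath a b g) = g b" if "a \<in> {0..1}" "b \<in> {0..1}" for a b
    using that g path_image_subpath_subset[OF that, of g] by (auto simp: path_subpath)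
  have "A 0 1"
    using zero_le_one
  proof (induction rule: Bolzano)
    case (trans a b c)
    show ?case
      unfolding A_def
    proof (intro impI allI)
      fix d z d'' z'' assume ac: "0 \<le> a \<and> a \<le> c \<and> c \<le> 1" and d: "d \<in> carrier GG" "d'' \<in> carrier GG"
        and z: "z \<in> P" "z'' \<in> P" and ends: "g a = pt d z" "g c = pt d'' z''"
      have I: "a \<in> {0..1}" "b \<in> {0..1}" "c \<in> {0..1}" using ac trans by auto
      have "g b \<in> M" using I g by (auto simp: path_image_def)
      then obtain d' z' where d': "d' \<in> carrier GG" "z' \<in> P" "g b = pt d' z'" by (rule in_M_E)
      obtain u where u: "u \<in> words S" "d \<otimes>\<^bsub>GG\<^esub> wval u = d'"
          "homotopic_paths M (spoked (subpath a b g) d z d' z') (word_path d u)"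
        using A_D[OF trans(1) d(1) d'(1) z(1) d'(2) ends(1) d'(3)] ac trans(3,4) by auto
      obtain v where v: "v \<in> words S" "d' \<otimes>\<^bsub>GG\<^esub> wval v = d''"
          "homotopic_paths M (spoked (subpath b c g) d' z' d'' z'') (word_path d' v)"
        using A_D[OF trans(2) d'(1) d(2) d'(2) z(2) d'(3) ends(2)] ac trans(3,4) by auto
      have "homotopic_paths M (spoked (subpath a c g) d z d'' z'')
          (spoked (subpath a b g +++ subpath b c g) d z d'' z'')"
        using homotopic_paths_sym[OF homotopic_join_subpaths[OF g I]] sub I d z ends by (intro spoked_cong) auto
      also have "homotopic_paths M \<dots> (spoked (subpath a b g) d z d' z' +++ spoked (subpath b c g) d' z' d'' z'')"
        using sub I d z d' ends by (intro homotopic_paths_sym[OF spoked_join]) auto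
      also have "homotopic_paths M \<dots> (word_path d u +++ word_path d' v)"
        using u v spoke d z d' by (intro homotopic_paths_join) (auto simp: spoked_def)
      also have "homotopic_paths M \<dots> (word_path d (u @ v))"
        using word_path_append[of u v d] u v d homotopic_paths_sym by blast
      finally (homotopic_paths_trans)
      have "homotopic_paths M (spoked (subpath a c g) d z d'' z'') (word_path d (u @ v))" .
      moreover have "d \<otimes>\<^bsub>GG\<^esub> wval (u @ v) = d''"
        using u v d wval_closed by (simp add: wval_append GG.m_assoc[symmetric])
      ultimately show "\<exists>w\<in>words S. d \<otimes>\<^bsub>GG\<^esub> wval w = d'' \<and>
          homotopic_paths M (spoked (subpath a c g) d z d'' z'') (word_path d w)"
        using u v by (intro bexI[of _ "u @ v"]) auto
    qed
  next
    case (local x)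
    then have "g x \<in> M" using g by (auto simp: path_image_def)
    then obtain e where e: "e < N" "g x \<in> Q e" using H.cover[of "g x"] by blast
    have "continuous_on {0..1} g" using g by (simp add: path_def)
    then obtain B where B: "open B" "x \<in> B" "\<And>y. y \<in> {0..1} \<Longrightarrow> y \<in> B \<Longrightarrow> g y \<in> Q e"
      using e local open_Q unfolding continuous_on_topological by (metis atLeastAtMost_iff)
    obtain \<epsilon> where \<epsilon>: "\<epsilon> > 0" "ball x \<epsilon> \<subseteq> B" using B open_contains_ball by blast
    have "A a b" if ab: "a \<le> x \<and> x \<le> b \<and> b - a < \<epsilon>" for a b
      unfolding A_def
    proof (intro impI allI)
      fix d z d' z' assume I: "0 \<le> a \<and> a \<le> b \<and> b \<le> 1" and d: "d \<in> carrier GG" "d' \<in> carrier GG"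
        and z: "z \<in> P" "z' \<in> P" and ends: "g a = pt d z" "g b = pt d' z'"
      have "g y \<in> M \<inter> Q e" if y: "y \<in> {a..b}" for y
      proof -
        have "y \<in> {0..1}" "y \<in> ball x \<epsilon>" using y I ab by (auto simp: dist_real_def)
        then show ?thesis using B \<epsilon> g by (auto simp: path_image_def)
      qed
      then have "path_image (subpath a b g) \<subseteq> M \<inter> Q e"
        using I by (auto simp: path_image_subpath)
      then show "\<exists>w\<in>words S. d \<otimes>\<^bsub>GG\<^esub> wval w = d' \<and>
          homotopic_paths M (spoked (subpath a b g) d z d' z') (word_path d w)"
        using sub[of a b] I ends by (intro spoked_in_star[OF e(1) d z]) auto
    qed
    then show ?case using \<epsilon>(1) by blast
  qed
  then show ?thesis
    using A_D[OF _ d z, of 0 1] ends by (simp add: pathstart_def pathfinish_def)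
qed

lemma homotopic_word_path:
  assumes g: "path g" "path_image g \<subseteq> M"
    and d: "d \<in> carrier GG" "d' \<in> carrier GG" and ends: "pathstart g = pt d ctr" "pathfinish g = pt d' ctr"
  shows "\<exists>w\<in>words S. d \<otimes>\<^bsub>GG\<^esub> wval w = d' \<and> homotopic_paths M g (word_path d w)"
proof -
  have const: "spoke c ctr = linepath (pt c ctr) (pt c ctr)" for c
    by (auto simp: spoke_def linepath_def fun_eq_iff algebra_simps)
  have M: "pt d ctr \<in> M" "pt d' ctr \<in> M" using pt_in_M ctr_P d by auto
  have "homotopic_paths M g (g +++ linepath (pt d' ctr) (pt d' ctr))"
    using g ends by (intro homotopic_paths_sym[OF homotopic_paths_rid']) auto
  also have "homotopic_paths M \<dots> ((linepath (pt d ctr) (pt d ctr) +++ g) +++ linepath (pt d' ctr) (pt d' ctr))"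
    by (rule homotopic_paths_join_left[OF homotopic_paths_sym[OF homotopic_paths_lid']]) (use g ends M in auto)
  finally (homotopic_paths_trans) have "homotopic_paths M g (spoked g d ctr d' ctr)"
    by (simp add: spoked_def const)
  then show ?thesis
    using spoked_word_path[OF g d ctr_P ctr_P ends] homotopic_paths_trans by blast
qed

text \<open>Loops at the given base point are conjugated by a fixed path \<open>\<delta>\<close>
  from the center of the identity chamber, where words apply. The holonomy of the conjugated loop is
  the invariant required by \<open>fundamental_group_iso\<close>.\<close>

theorem fundamental_group_polygon_complex:
  assumes x: "x \<in> topspace (polygon_complex m q1 q2)"
  shows "fundamental_group (polygon_complex m q1 q2) x \<cong> \<Gamma>\<lparr>carrier := kernel \<Gamma> GG proj\<rparr>"
proof -
  let ?T = "polygon_complex m q1 q2" and ?I = "top_of_set {0..1::real}" and ?o = "\<one>\<^bsub>GG\<^esub>"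
  obtain F F' where FF': "homeomorphic_maps ?T (top_of_set M) F F'"
    using homeomorphic_map_model[OF m] homeomorphic_map_maps by blast
  then have F: "continuous_map ?T (top_of_set M) F" and F': "continuous_map (top_of_set M) ?T F'"
      and F'F: "\<And>y. y \<in> topspace ?T \<Longrightarrow> F' (F y) = y" and F_F': "\<And>y. y \<in> M \<Longrightarrow> F (F' y) = y"
    by (auto simp: homeomorphic_maps_def)
  define a where "a = F x"
  have "a \<in> M" using x F by (auto simp: a_def continuous_map_def)
  then obtain d z where d: "d \<in> carrier GG" "z \<in> P" "a = pt d z" by (rule in_M_E)
  define \<delta> where "\<delta> = word_path ?o (local_word 0 d) +++ spoke d z"
  note lw = local_word[OF N_pos d(1)] and s = spoke[OF d(1,2)]
  have \<delta>: "path \<delta>" "path_image \<delta> \<subseteq> M" "pathstart \<delta> = pt ?o ctr" "pathfinish \<delta> = a"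
    using lw s d by (auto simp: \<delta>_def path_image_join)
  define conj where "conj g = (\<delta> +++ g) +++ reversepath \<delta>" for g
  define lp where "lp g \<longleftrightarrow> path g \<and> path_image g \<subseteq> M \<and> pathstart g = a \<and> pathfinish g = a" for g
  have conj: "path (conj g)" "path_image (conj g) \<subseteq> M" "pathstart (conj g) = pt ?o ctr"
      "pathfinish (conj g) = pt ?o ctr" if "lp g" for g
    using that \<delta> by (auto simp: conj_def lp_def path_image_join)
  have conj_word: "\<exists>w\<in>words S. wval w = ?o \<and> homotopic_paths M (conj g) (word_path ?o w)" if "lp g" for g
    using homotopic_word_path[OF conj(1,2)[OF that] _ _ conj(3,4)[OF that]] by auto
  have hol_conj: "H.hol (conj g) = H.hol \<delta> \<otimes>\<^bsub>\<Gamma>\<^esub> H.hol g \<otimes>\<^bsub>\<Gamma>\<^esub> inv\<^bsub>\<Gamma>\<^esub> H.hol \<delta>" if "lp g" for g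
    using that \<delta> by (simp add: conj_def lp_def H.hol_join H.hol_reversepath path_image_join)
  have lp_homotopic: "homotopic_paths M g h \<longleftrightarrow> H.hol (conj g) = H.hol (conj h)" if g: "lp g" and h: "lp h" for g h
  proof
    assume "homotopic_paths M g h"
    then have "homotopic_paths M (conj g) (conj h)"
      unfolding conj_def using \<delta> g h
      by (intro homotopic_paths_join_left homotopic_paths_join_right) (auto simp: lp_def)
    then show "H.hol (conj g) = H.hol (conj h)" by (rule H.hol_homotopic)
  next
    assume eq: "H.hol (conj g) = H.hol (conj h)"
    obtain u where u: "u \<in> words S" "homotopic_paths M (conj g) (word_path ?o u)"
      using conj_word[OF g] by blast
    obtain v where v: "v \<in> words S" "homotopic_paths M (conj h) (word_path ?o v)"
      using conj_word[OF h] by blast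
    \<comment> \<open>Equal holonomies mean equal elements of \<Gamma>, so the words differ by
      relators and their paths are homotopic: this yields injectivity.\<close>
    have "word_class S R u = word_class S R v"
      using eq H.hol_homotopic[OF u(2)] H.hol_homotopic[OF v(2)] hol_word_path u(1) v(1) by simp
    then have "homotopic_paths M (word_path ?o u) (word_path ?o v)"
      using word_path_weq[of u v ?o] u(1) by (simp add: word_class_eq_iff)
    then have gh: "homotopic_paths M (conj g) (conj h)"
      by (rule homotopic_paths_trans[OF u(2) homotopic_paths_trans[OF _ homotopic_paths_sym[OF v(2)]]])
    have "homotopic_paths M g ((reversepath \<delta> +++ conj g) +++ \<delta>)"
      unfolding conj_def using \<delta> g
      by (intro homotopic_paths_sym[OF homotopic_paths_conjugate_cancel]) (auto simp: lp_def)
    also have "homotopic_paths M \<dots> ((reversepath \<delta> +++ conj h) +++ \<delta>)"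
      using gh \<delta> conj[OF g] conj[OF h]
      by (intro homotopic_paths_join_left homotopic_paths_join_right) auto
    also have "homotopic_paths M \<dots> h"
      unfolding conj_def using \<delta> h by (intro homotopic_paths_conjugate_cancel) (auto simp: lp_def)
    finally (homotopic_paths_trans) show "homotopic_paths M g h" .
  qed
  have lp_loops: "lp (F \<circ> g)" if "g \<in> loops ?T x" for g
  proof -
    have g: "continuous_map ?I ?T g" "g 0 = x" "g 1 = x" using that by (auto simp: loops_def pathin_def)
    have "continuous_map ?I (top_of_set M) (F \<circ> g)" by (rule continuous_map_compose[OF g(1) F])
    then show ?thesis using g(2,3)
      by (auto simp: lp_def path_def path_image_def pathstart_def pathfinish_def a_def image_subset_iff Pi_iff)
  qed
  have loops_lp: "F' \<circ> p \<in> loops ?T x" "\<And>t. t \<in> {0..1} \<Longrightarrow> (F \<circ> (F' \<circ> p)) t = p t" if p: "lp p" for p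
  proof -
    have "continuous_map ?I (top_of_set M) p"
      using p by (auto simp: lp_def path_def path_image_def)
    then have "continuous_map ?I ?T (F' \<circ> p)" using F' by (rule continuous_map_compose)
    then show "F' \<circ> p \<in> loops ?T x"
      using p F'F[OF x] by (auto simp: loops_def pathin_def lp_def pathstart_def pathfinish_def a_def)
    show "(F \<circ> (F' \<circ> p)) t = p t" if "t \<in> {0..1}" for t
      using p that by (auto simp: lp_def path_image_def intro!: F_F')
  qed
  have loop_top: "g t \<in> topspace ?T" if "g \<in> loops ?T x" "t \<in> {0..1}" for g t
    using that by (auto simp: loops_def pathin_def continuous_map_def)
  have join_eq: "F \<circ> join_loops g h = (F \<circ> g) +++ (F \<circ> h)" for g h
    by (auto simp: join_loops_def joinpaths_def)
  have lp_join: "lp (p +++ q)" if "lp p" "lp q" for p q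
    using that by (auto simp: lp_def path_image_join)
  show ?thesis
  proof (rule fundamental_group_iso[where \<theta> = "\<lambda>g. H.hol (conj (F \<circ> g))"])
    show "subgroup (kernel \<Gamma> GG proj) \<Gamma>" by (rule proj.subgroup_kernel)
    show "group \<Gamma>" by (rule group_presented_group)
    fix g h assume g: "g \<in> loops ?T x" and h: "h \<in> loops ?T x"
    have "loop_homotopic ?T x g h \<longleftrightarrow> homotopic_paths M (F \<circ> g) (F \<circ> h)"
    proof
      assume "loop_homotopic ?T x g h"
      then show "homotopic_paths M (F \<circ> g) (F \<circ> h)"
        unfolding loop_homotopic_def homotopic_paths_def
        by (rule homotopic_with_compose_continuous_map_left[OF _ F])
          (use g in \<open>auto simp: pathstart_def pathfinish_def loops_def\<close>)
    next
      assume "homotopic_paths M (F \<circ> g) (F \<circ> h)"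
      then have "homotopic_with (\<lambda>r. r 0 = x \<and> r 1 = x) ?I ?T (F' \<circ> (F \<circ> g)) (F' \<circ> (F \<circ> h))"
        unfolding homotopic_paths_def
        by (rule homotopic_with_compose_continuous_map_left[OF _ F'])
          (use g F'F[OF x] in \<open>auto simp: pathstart_def pathfinish_def loops_def\<close>)
      then show "loop_homotopic ?T x g h"
        unfolding loop_homotopic_def
        by (rule homotopic_with_eq) (use loop_top g h F'F in auto)
    qed
    then show "loop_homotopic ?T x g h \<longleftrightarrow> H.hol (conj (F \<circ> g)) = H.hol (conj (F \<circ> h))"
      using lp_homotopic lp_loops g h by simp
    show "join_loops g h \<in> loops ?T x"
    proof -
      \<comment> \<open>The concatenation is formed in the model and carried back. Its agreement
        with \<open>join_loops g h\<close> is available on \<open>{0..1}\<close>, where the loops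
        take values in the space.\<close>
      let ?p = "(F \<circ> g) +++ (F \<circ> h)"
      have "F' \<circ> ?p \<in> loops ?T x" using loops_lp lp_join lp_loops g h by blast
      moreover have "(F' \<circ> ?p) t = join_loops g h t" if "t \<in> {0..1}" for t
      proof -
        have "join_loops g h t \<in> topspace ?T"
          using loop_top[OF g, of "2 * t"] loop_top[OF h, of "2 * t - 1"] that by (auto simp: join_loops_def)
        then show ?thesis using F'F unfolding join_eq[symmetric] by simp
      qed
      ultimately show ?thesis
        using continuous_map_eq[of ?I ?T "F' \<circ> ?p" "join_loops g h"] by (auto simp: loops_def pathin_def)
    qed
    have c: "H.hol \<delta> \<in> carrier \<Gamma>" "H.hol (F \<circ> g) \<in> carrier \<Gamma>" "H.hol (F \<circ> h) \<in> carrier \<Gamma>"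
      using H.hol_closed \<delta> lp_loops[OF g] lp_loops[OF h] by (auto simp: lp_def)
    have "inv\<^bsub>\<Gamma>\<^esub> H.hol \<delta> \<otimes>\<^bsub>\<Gamma>\<^esub> (H.hol \<delta> \<otimes>\<^bsub>\<Gamma>\<^esub> y) = y" if "y \<in> carrier \<Gamma>" for y
      using c that by (simp add: m_assoc[symmetric])
    moreover have "H.hol ((F \<circ> g) +++ (F \<circ> h)) = H.hol (F \<circ> g) \<otimes>\<^bsub>\<Gamma>\<^esub> H.hol (F \<circ> h)"
      using lp_loops[OF g] lp_loops[OF h] by (intro H.hol_join) (auto simp: lp_def)
    ultimately show "H.hol (conj (F \<circ> join_loops g h)) = H.hol (conj (F \<circ> g)) \<otimes>\<^bsub>\<Gamma>\<^esub> H.hol (conj (F \<circ> h))"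
      using c lp_loops[OF g] lp_loops[OF h] lp_join by (simp add: join_eq hol_conj m_assoc)
  next
    have "H.hol (conj p) \<in> kernel \<Gamma> GG proj" if p: "lp p" for p
    proof -
      obtain w where w: "w \<in> words S" "wval w = ?o" "homotopic_paths M (conj p) (word_path ?o w)"
        using conj_word[OF p] by blast
      then have "H.hol (conj p) = word_class S R w" using H.hol_homotopic hol_word_path by simp
      then show ?thesis
        using w ext_family_word_class[OF group_GG proj_family w(1)] by (simp add: kernel_def proj_def)
    qed
    moreover have "\<exists>g\<in>loops ?T x. H.hol (conj (F \<circ> g)) = y" if y: "y \<in> kernel \<Gamma> GG proj" for y
    proof -
      obtain w where w: "w \<in> words S" "y = word_class S R w" "proj y = ?o"
        using y by (auto simp: kernel_def carrier_presented_group)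
      then have wv: "wval w = ?o"
        using ext_family_word_class[OF group_GG proj_family w(1)] by (simp add: proj_def)
      define q where "q = word_path ?o w"
      have q: "path q" "path_image q \<subseteq> M" "pathstart q = pt ?o ctr" "pathfinish q = pt ?o ctr"
        using w wv by (auto simp: q_def)
      \<comment> \<open>\<open>conj\<close> undoes this conjugation up to homotopy, so the loop has
        the holonomy of \<open>q\<close>, which is \<open>y\<close>.\<close>
      define p where "p = (reversepath \<delta> +++ q) +++ \<delta>"
      have p: "lp p" using q \<delta> by (auto simp: lp_def p_def path_image_join)
      have hq: "H.hol q \<in> carrier \<Gamma>" "H.hol \<delta> \<in> carrier \<Gamma>" using H.hol_closed q \<delta> by auto
      have "H.hol p = inv\<^bsub>\<Gamma>\<^esub> H.hol \<delta> \<otimes>\<^bsub>\<Gamma>\<^esub> H.hol q \<otimes>\<^bsub>\<Gamma>\<^esub> H.hol \<delta>"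
        using q \<delta> by (simp add: p_def H.hol_join H.hol_reversepath path_image_join)
      moreover have "H.hol \<delta> \<otimes>\<^bsub>\<Gamma>\<^esub> (inv\<^bsub>\<Gamma>\<^esub> H.hol \<delta> \<otimes>\<^bsub>\<Gamma>\<^esub> H.hol q) = H.hol q"
        using hq by (simp add: m_assoc[symmetric])
      ultimately have "H.hol (conj p) = H.hol q"
        using hq by (simp add: hol_conj[OF p] m_assoc)
      moreover have "H.hol q = y" using hol_word_path[OF w(1), of ?o] w by (simp add: q_def)
      moreover have "homotopic_paths M (F \<circ> (F' \<circ> p)) p"
        using loops_lp[OF p] lp_loops[OF loops_lp(1)[OF p]] p
        by (intro homotopic_paths_eq) (auto simp: lp_def)
      then have "H.hol (conj (F \<circ> (F' \<circ> p))) = H.hol (conj p)"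
        using lp_homotopic[OF lp_loops[OF loops_lp(1)[OF p]] p] by simp
      ultimately show ?thesis using loops_lp(1)[OF p] by metis
    qed
    ultimately show "(\<lambda>g. H.hol (conj (F \<circ> g))) ` loops ?T x = kernel \<Gamma> GG proj"
      using lp_loops by (auto simp: image_iff)
  qed
qed

end

theorem theorem1p1:
  fixes m q1 q2 :: nat
    and G1 :: "('a, 'c) monoid_scheme" and G2 :: "('b, 'd) monoid_scheme"
  assumes "m \<ge> 2" and "q1 \<ge> 2" and "q2 \<ge> 2"
    and "group G1" and "order G1 = q1"
    and "group G2" and "order G2 = q2"
  shows "let \<Gamma> = bourdon_group m G1 G2 in \<exists>K. subgroup K \<Gamma> \<and>
    (\<forall>a \<in> topspace (polygon_complex m q1 q2).
       fundamental_group (polygon_complex m q1 q2) a \<cong> \<Gamma>\<lparr>carrier := K\<rparr>) \<and>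
    finite_index \<Gamma> K \<and> subgroup_index \<Gamma> K = q1 * q2 \<and>
    torsion_free_in \<Gamma> K \<and>
    (\<forall>K'. subgroup K' \<Gamma> \<and> torsion_free_in \<Gamma> K' \<longrightarrow> \<not> K \<subset> K') \<and>
    (\<forall>K'. subgroup K' \<Gamma> \<and> torsion_free_in \<Gamma> K' \<and> finite_index \<Gamma> K' \<longrightarrow>
       subgroup_index \<Gamma> K' \<ge> q1 * q2)"
proof -
  \<comment> \<open>An infinite carrier would have \<open>order\<close> 0, contrary to
    \<open>q1 \<ge> 2\<close> and \<open>q2 \<ge> 2\<close>.\<close>
  have "finite (carrier G1)" "finite (carrier G2)"
    using assms by (auto simp: order_def intro: card_ge_0_finite)
  then obtain n1 n2 where n: "bij_betw n1 (carrier G1) {..<q1}" "bij_betw n2 (carrier G2) {..<q2}"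
    using ex_bij_betw_finite_nat assms(5,7) unfolding order_def atLeast0LessThan by metis
  interpret bourdon_complex G1 G2 m q1 q2 n1 n2
    using assms n by (intro bourdon_complex.intro bourdon.intro bourdon_axioms.intro bourdon_complex_axioms.intro)
  let ?K = "kernel \<Gamma> GG proj"
  have order: "order GG = q1 * q2" using assms by (simp add: order_def carrier_GG card_cartesian_product)
  have surj: "proj ` carrier \<Gamma> = carrier GG"
    using proj_vertex_emb[OF N_pos] vertex_emb_closed[OF N_pos] proj.hom_closed by (force simp del: carrier_DirProd)
  \<comment> \<open>The section is the embedding at vertex \<open>0\<close>, whose image is
    generated by $G_{1,m-1}$ and $G_{2,m-1}$; any other vertex would do.\<close>
  note * = torsion_free_kernel_of_split_hom[OF proj_hom surj group_GG finite_GG vertex_emb_hom[OF N_pos]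
      proj_vertex_emb[OF N_pos] torsion_free_kernel_proj]
  show ?thesis
    unfolding Let_def bourdon_group_def
  proof (intro exI[of _ ?K] conjI ballI allI impI)
    show "subgroup ?K \<Gamma>" by (rule proj.subgroup_kernel)
    show "fundamental_group (polygon_complex m q1 q2) a \<cong> \<Gamma>\<lparr>carrier := ?K\<rparr>"
      if "a \<in> topspace (polygon_complex m q1 q2)" for a
      by (rule fundamental_group_polygon_complex[OF that])
    show "finite_index \<Gamma> ?K" "subgroup_index \<Gamma> ?K = q1 * q2" "torsion_free_in \<Gamma> ?K"
      using * order torsion_free_kernel_proj by auto
  qed (use * order in auto)
qed

end
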